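(* Let $D_{10}\subset \mathrm{Aut}(I_4)= A_5$ be a dihedral subgroup of order 10. A Belyi function for the quotient dessin $I_4/_{D_{10}}$ is the function $\beta_{I_4/_{D_{10}}}:\mathbb{CP}^1\to\mathbb{CP}^1$ given by $$\beta_{I_4/_{D_{10}}}(x) = \frac{(x-1)^5\big((2+i)x+(2-i)\big)}{(x+1)^5\big((2+i)x -(2-i)\big)}.$$
   Context: Bring's curve $\mathcal{B}\subset\mathbb{CP}^4$ is the genus-4 curve defined by $\sum_{i=1}^5 x_i=\sum_{i=1}^5 x_i^2=\sum_{i=1}^5 x_i^3=0$. A dessin d'enfant $M$ is a bicolored graph embedded in a compact oriented surface (adjacent vertices of opposite colors, complement a union of open disks). A Belyi pair $(X,\beta)$ (a compact Riemann surface $X$ and a non-constant meromorphic function $\beta:X\to\mathbb{CP}^1$ with all critical values in $\{0,1,\infty\}$) corresponds to $M$, and $\beta$ is called a Belyi function for $M$, if $M=\beta^{-1}([0,1])$ with black vertices the zeros of $\beta$ and white vertices the zeros of $\beta-1$. Each dessin has a Belyi pair, unique up to isomorphism. $\mathrm{Aut}(M)$ is the group of automorphisms $\varphi$ of $X$ with $\beta=\beta\circ\varphi$. A dessin is encoded by permutations $(\sigma,\alpha)$ of its edges, whose cycles list the edges counterclockwise around black, respectively white, vertices. The icosahedron $I_4$ of genus 4 is the dessin encoded by $(\sigma^2,\alpha)$, where $(\sigma,\alpha)$ encodes the regular icosahedron on the sphere (its 12 vertices black, white vertices in the middle of its 30 edges). It is embedded in $\mathcal{B}$ with Belyi function $$\beta_{I_4}(x)=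 1 + \frac{25b^2}{128a^5}\Big(125b^2 + \sqrt{5}\prod_{1\leqslant i<j \leqslant 5}(x_i - x_j)\Big),\quad a = \sum_{1 \leqslant i < j < k < s \leqslant 5} x_i x_j x_k x_s,\quad b = - x_1x_2x_3x_4x_5,$$ and $\mathrm{Aut}(I_4)=A_5$ acts on $\mathcal{B}$ by even permutations of the homogeneous coordinates. For a subgroup $G\subset\mathrm{Aut}(I_4)$, $\mathcal{B}/_G$ is the quotient Riemann surface and $I_4/_G$ is the quotient dessin on it, i.e. the image of $I_4$ under $\mathcal{B}\to\mathcal{B}/_G$; its Belyi function is the map $\mathcal{B}/_G\to\mathbb{CP}^1$ induced by $\beta_{I_4}$. So the claim means that the Belyi pair of $I_4/_{D_{10}}$ is isomorphic to $(\mathbb{CP}^1,\beta_{I_4/_{D_{10}}})$. *)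

theory Defs
  imports
    "HOL-Complex_Analysis.Complex_Analysis"
    "HOL-Algebra.Multiplicative_Group"
    "HOL-Algebra.Generated_Groups"
begin

section \<open>Complex spaces as spaces with a sheaf of holomorphic functions\<close>

text \<open>
  A complex structure on a topological space is represented by its sheaf of holomorphic functions:
  \<open>hol X U\<close> is the set of functions that are holomorphic on the open set \<open>U\<close>. Functions are total;
  only their values on \<open>U\<close> matter.
\<close>

record 'a cspace =
  ctop :: "'a topology"
  hol :: "'a set \<Rightarrow> ('a \<Rightarrow> complex) set"

abbreviation points :: "'a cspace \<Rightarrow> 'a set" where
  "points X \<equiv> topspace (ctop X)"

text \<open>Holomorphic functions on a subspace (open subset or closed submanifold) are the functions that
  extend locally to holomorphic functions of the ambient space.\<close>

definition csubspace :: "'a cspace \<Rightarrow> 'a set \<Rightarrow> 'a cspace" where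
  "csubspace X S =
     \<lparr>ctop = subtopology (ctop X) S,
      hol = (\<lambda>U. {h. \<forall>p\<in>U. \<exists>V. openin (ctop X) V \<and> p \<in> V \<and>
                       (\<exists>k \<in> hol X V. \<forall>q \<in> U \<inter> V. h q = k q)})\<rparr>"

text \<open>The quotient along \<open>q\<close>: both open sets and holomorphic functions are those whose pullback
  along \<open>q\<close> is open, respectively holomorphic.\<close>

definition quotient_top :: "'a topology \<Rightarrow> ('a \<Rightarrow> 'b) \<Rightarrow> 'b topology" where
  "quotient_top T q =
     topology (\<lambda>V. V \<subseteq> q ` topspace T \<and> openin T {p \<in> topspace T. q p \<in> V})"

lemma openin_quotient_top:
  "openin (quotient_top T q) V \<longleftrightarrow>
     V \<subseteq> q ` topspace T \<and> openin T {p \<in> topspace T. q p \<in> V}"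
proof -
  have "istopology (\<lambda>V. V \<subseteq> q ` topspace T \<and> openin T {p \<in> topspace T. q p \<in> V})"
    unfolding istopology_def
  proof (intro conjI allI impI)
    fix S V
    assume "S \<subseteq> q ` topspace T \<and> openin T {p \<in> topspace T. q p \<in> S}"
      and "V \<subseteq> q ` topspace T \<and> openin T {p \<in> topspace T. q p \<in> V}"
    then have "openin T ({p \<in> topspace T. q p \<in> S} \<inter> {p \<in> topspace T. q p \<in> V})"
      by (blast intro: openin_Int)
    moreover have "{p \<in> topspace T. q p \<in> S} \<inter> {p \<in> topspace T. q p \<in> V}
        = {p \<in> topspace T. q p \<in> S \<inter> V}" by blast
    ultimately show "openin T {p \<in> topspace T. q p \<in> S \<inter> V}" by simp
  next
    fix \<K>
    assume "\<forall>K\<in>\<K>. K \<subseteq> q ` topspace T \<and> openin T {p \<in> topspace T. q p \<in> K}"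
    then have "openin T (\<Union>K\<in>\<K>. {p \<in> topspace T. q p \<in> K})" by blast
    moreover have "(\<Union>K\<in>\<K>. {p \<in> topspace T. q p \<in> K}) = {p \<in> topspace T. q p \<in> \<Union>\<K>}"
      by blast
    ultimately show "openin T {p \<in> topspace T. q p \<in> \<Union>\<K>}" by simp
  qed blast+
  then show ?thesis by (simp add: quotient_top_def)
qed

definition cquotient :: "'a cspace \<Rightarrow> ('a \<Rightarrow> 'b) \<Rightarrow> 'b cspace" where
  "cquotient X q =
     \<lparr>ctop = quotient_top (ctop X) q,
      hol = (\<lambda>V. {h. h \<circ> q \<in> hol X {p \<in> points X. q p \<in> V}})\<rparr>"

definition holo_map :: "'a cspace \<Rightarrow> 'b cspace \<Rightarrow> ('a \<Rightarrow> 'b) \<Rightarrow> bool" where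
  "holo_map X Y f \<longleftrightarrow>
     continuous_map (ctop X) (ctop Y) f \<and>
     (\<forall>V. openin (ctop Y) V \<longrightarrow>
        (\<forall>h \<in> hol Y V. h \<circ> f \<in> hol X {p \<in> points X. f p \<in> V}))"

definition biholomorphic :: "'a cspace \<Rightarrow> 'b cspace \<Rightarrow> ('a \<Rightarrow> 'b) \<Rightarrow> bool" where
  "biholomorphic X Y f \<longleftrightarrow>
     (\<exists>g. homeomorphic_maps (ctop X) (ctop Y) f g \<and> holo_map X Y f \<and> holo_map Y X g)"

section \<open>Riemann surfaces\<close>

definition complex_plane :: "complex cspace" where
  "complex_plane = \<lparr>ctop = euclidean, hol = (\<lambda>U. {h. h holomorphic_on U})\<rparr>"

definition chart :: "'a cspace \<Rightarrow> 'a set \<Rightarrow> ('a \<Rightarrow> complex) \<Rightarrow> bool" where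
  "chart X U z \<longleftrightarrow>
     openin (ctop X) U \<and> open (z ` U) \<and>
     biholomorphic (csubspace X U) (csubspace complex_plane (z ` U)) z"

text \<open>The equation for \<open>hol X U\<close> below says that being holomorphic is a local property.
  Second countability is not demanded, since it is automatic.\<close>

definition riemann_surface :: "'a cspace \<Rightarrow> bool" where
  "riemann_surface X \<longleftrightarrow>
     points X \<noteq> {} \<and> connected_space (ctop X) \<and> Hausdorff_space (ctop X) \<and>
     (\<forall>U. openin (ctop X) U \<longrightarrow> hol X U = hol (csubspace X (points X)) U) \<and>
     (\<forall>p \<in> points X. \<exists>U z. p \<in> U \<and> chart X U z)"

definition critical_point :: "'a cspace \<Rightarrow> 'b cspace \<Rightarrow> ('a \<Rightarrow> 'b) \<Rightarrow> 'a \<Rightarrow> bool" where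
  "critical_point X Y f p \<longleftrightarrow>
     (\<exists>U z V w. chart X U z \<and> chart Y V w \<and> p \<in> U \<and> f ` U \<subseteq> V \<and>
        deriv (w \<circ> f \<circ> inv_into U z) (z p) = 0)"

section \<open>Complex projective spaces\<close>

text \<open>A function on an open subset of \<open>\<complex>\<^sup>n\<close> is holomorphic iff it is differentiable with
  complex linear derivative.\<close>

definition affine_space :: "(complex ^ 'n) cspace" where
  "affine_space =
     \<lparr>ctop = euclidean,
      hol = (\<lambda>U. {h. \<forall>x\<in>U. \<exists>D. (h has_derivative D) (at x) \<and>
                                (\<forall>c v. D (c *s v) = c * D v)})\<rparr>"

definition line :: "complex ^ 'n \<Rightarrow> (complex ^ 'n) set" where
  "line x = range (\<lambda>c. c *s x)"

definition proj_space :: "(complex ^ 'n) set cspace" where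
  "proj_space = cquotient (csubspace affine_space (- {0})) line"

type_synonym cp1 = "(complex ^ 2) set"
type_synonym cp4 = "(complex ^ 5) set"

abbreviation CP1 :: "cp1 cspace" where
  "CP1 \<equiv> proj_space"

definition fin :: "complex \<Rightarrow> cp1" where
  "fin z = line (vector [z, 1])"

definition infty :: cp1 where
  "infty = line (vector [1, 0])"

text \<open>A meromorphic function is usually written down by a formula that makes sense outside of a
  discrete set only. Given the graph \<open>R\<close> of such a formula, the following is the holomorphic map to
  the Riemann sphere that it determines.\<close>

definition meromorphic_given_by :: "'a cspace \<Rightarrow> ('a \<times> complex) set \<Rightarrow> 'a \<Rightarrow> cp1" where
  "meromorphic_given_by X R =
     (THE f. f \<in> extensional (points X) \<and> holo_map X CP1 f \<and> (\<forall>(p, w) \<in> R. f p = fin w))"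

section \<open>Belyi pairs and dessins\<close>

definition belyi_pair :: "'a cspace \<Rightarrow> ('a \<Rightarrow> cp1) \<Rightarrow> bool" where
  "belyi_pair X \<beta> \<longleftrightarrow>
     riemann_surface X \<and> compact_space (ctop X) \<and>
     holo_map X CP1 \<beta> \<and> \<not> \<beta> constant_on points X \<and>
     (\<forall>p \<in> points X. critical_point X CP1 \<beta> p \<longrightarrow> \<beta> p \<in> {fin 0, fin 1, infty})"

definition belyi_pairs_isomorphic ::
  "'a cspace \<Rightarrow> ('a \<Rightarrow> cp1) \<Rightarrow> 'b cspace \<Rightarrow> ('b \<Rightarrow> cp1) \<Rightarrow> bool" where
  "belyi_pairs_isomorphic X \<beta> Y \<gamma> \<longleftrightarrow>
     belyi_pair X \<beta> \<and> belyi_pair Y \<gamma> \<and>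
     (\<exists>\<phi>. biholomorphic X Y \<phi> \<and> (\<forall>p \<in> points X. \<gamma> (\<phi> p) = \<beta> p))"

text \<open>An embedded dessin is recorded by the point set of its graph together with its black and its
  white vertices; the edges are the components of the rest of the graph.\<close>

record 'a dessin =
  graph :: "'a set"
  black :: "'a set"
  white :: "'a set"

definition belyi_dessin :: "'a cspace \<Rightarrow> ('a \<Rightarrow> cp1) \<Rightarrow> 'a dessin" where
  "belyi_dessin X \<beta> =
     \<lparr>graph = {p \<in> points X. \<exists>t::real. 0 \<le> t \<and> t \<le> 1 \<and> \<beta> p = fin (of_real t)},
      black = {p \<in> points X. \<beta> p = fin 0},
      white = {p \<in> points X. \<beta> p = fin 1}\<rparr>"

definition belyi_pair_of :: "'a dessin \<Rightarrow> 'a cspace \<Rightarrow> ('a \<Rightarrow> cp1) \<Rightarrow> bool" where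
  "belyi_pair_of M X \<beta> \<longleftrightarrow> belyi_pair X \<beta> \<and> M = belyi_dessin X \<beta>"

definition image_dessin :: "('a \<Rightarrow> 'b) \<Rightarrow> 'a dessin \<Rightarrow> 'b dessin" where
  "image_dessin q M = \<lparr>graph = q ` graph M, black = q ` black M, white = q ` white M\<rparr>"

section \<open>Bring's curve and the icosahedron of genus 4\<close>

text \<open>The five coordinates are indexed by the type \<open>5\<close>, whose elements are
  \<open>0 < 1 < 2 < 3 < 4\<close>; so the usual \<open>x\<^sub>1, \<dots>, x\<^sub>5\<close> become
  \<open>x $ 0, \<dots>, x $ 4\<close> in this order.\<close>

definition on_bring :: "complex ^ 5 \<Rightarrow> bool" where
  "on_bring x \<longleftrightarrow>
     x \<noteq> 0 \<and> (\<Sum>i\<in>UNIV. x $ i) = 0 \<and> (\<Sum>i\<in>UNIV. (x $ i)^2) = 0 \<and> (\<Sum>i\<in>UNIV. (x $ i)^3) = 0"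

definition bring :: "cp4 cspace" where
  "bring = csubspace proj_space (line ` {x. on_bring x})"

definition coeff_a :: "complex ^ 5 \<Rightarrow> complex" where
  "coeff_a x = (\<Sum>(i, j, k, s) \<in> {(i, j, k, s). i < j \<and> j < k \<and> k < s}. x $ i * x $ j * x $ k * x $ s)"

definition coeff_b :: "complex ^ 5 \<Rightarrow> complex" where
  "coeff_b x = - (\<Prod>i\<in>UNIV. x $ i)"

definition vandermonde :: "complex ^ 5 \<Rightarrow> complex" where
  "vandermonde x = (\<Prod>(i, j) \<in> {(i, j). i < j}. x $ i - x $ j)"

definition beta_I4 :: "cp4 \<Rightarrow> cp1" where
  "beta_I4 = meromorphic_given_by bring
     {(line x, 1 + 25 * (coeff_b x)^2 / (128 * (coeff_a x)^5)
                   * (125 * (coeff_b x)^2 + of_real (sqrt 5) * vandermonde x))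
      | x. on_bring x \<and> coeff_a x \<noteq> 0}"

definition I4 :: "cp4 dessin" where
  "I4 = belyi_dessin bring beta_I4"

section \<open>The automorphism group and the quotients of the icosahedron\<close>

definition A5 :: "(5 \<Rightarrow> 5) monoid" where
  "A5 = \<lparr>carrier = {g. g permutes UNIV \<and> evenperm g}, mult = (\<circ>), one = id\<rparr>"

definition act :: "(5 \<Rightarrow> 5) \<Rightarrow> cp4 \<Rightarrow> cp4" where
  "act g P = (\<lambda>x. \<chi> i. x $ inv_into UNIV g i) ` P"

definition orbit_of :: "(5 \<Rightarrow> 5) set \<Rightarrow> cp4 \<Rightarrow> cp4 set" where
  "orbit_of G P = (\<lambda>g. act g P) ` G"

definition bring_quotient :: "(5 \<Rightarrow> 5) set \<Rightarrow> cp4 set cspace" where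
  "bring_quotient G = cquotient bring (orbit_of G)"

definition I4_quotient :: "(5 \<Rightarrow> 5) set \<Rightarrow> cp4 set dessin" where
  "I4_quotient G = image_dessin (orbit_of G) I4"

text \<open>The function induced on orbits; \<open>beta_I4\<close> is constant on each of them.\<close>

definition induced_beta :: "cp4 set \<Rightarrow> cp1" where
  "induced_beta Q = the_elem (beta_I4 ` Q)"

definition dihedral :: "('a, 'b) monoid_scheme \<Rightarrow> nat \<Rightarrow> bool" where
  "dihedral H n \<longleftrightarrow>
     group H \<and> order H = 2 * n \<and>
     (\<exists>r \<in> carrier H. \<exists>s \<in> carrier H.
        carrier H = generate H {r, s} \<and> group.ord H r = n \<and> group.ord H s = 2 \<and>
        s \<otimes>\<^bsub>H\<^esub> r \<otimes>\<^bsub>H\<^esub> s = inv\<^bsub>H\<^esub> r)"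

definition beta_D10 :: "cp1 \<Rightarrow> cp1" where
  "beta_D10 = meromorphic_given_by CP1
     {(fin x, ((x - 1)^5 * ((2 + \<i>) * x + (2 - \<i>))) / ((x + 1)^5 * ((2 + \<i>) * x - (2 - \<i>))))
      | x. (x + 1)^5 * ((2 + \<i>) * x - (2 - \<i>)) \<noteq> 0}"

end

theory Submission
  imports Defs
begin

text \<open>
  The points of Bring's curve are the orderings of the roots of the quintics \<open>t\<^sup>5 + a t + b\<close>. Let
  \<open>y\<^sub>1, \<dots>, y\<^sub>4\<close> be the discrete Fourier transform of the coordinates, listed in the cyclic order
  given by the elements of order 5 of the group. The curve becomes \<open>y\<^sub>1 y\<^sub>4 + y\<^sub>2 y\<^sub>3 = 0\<close>,
  \<open>y\<^sub>1\<^sup>2 y\<^sub>3 + y\<^sub>2\<^sup>2 y\<^sub>1 + y\<^sub>4\<^sup>2 y\<^sub>2 + y\<^sub>3\<^sup>2 y\<^sub>4 = 0\<close>; rotations multiply \<open>y\<^sub>k\<close> by the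
  \<open>k\<close>-th powers of a fifth root of unity and a reflection exchanges \<open>y\<^sub>k\<close> with \<open>y\<^bsub>-k\<^esub>\<close>. Normalising
  \<open>y\<^sub>4 = 1\<close>, \<open>y\<^sub>3 = -Y\<close> gives \<open>y\<^sub>2 = p Y\<^sup>2\<close>, \<open>y\<^sub>1 = p Y\<^sup>3\<close> with \<open>Y\<^sup>5 = (p + 1) / (p\<^sup>2 (1 - p))\<close>, so
  \<open>p\<close> is a coordinate on the quotient by the rotations; the reflection acts by \<open>p \<mapsto> -1/p\<close>, and
  \<open>w = p - 1/p\<close> is a coordinate on the dihedral quotient. Since
  \<open>5 V\<^sup>2 - (125 b\<^sup>2)\<^sup>2 = 1280 a\<^sup>5\<close> for the Vandermonde product \<open>V\<close>, the function \<open>\<beta>\<close> equals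
  \<open>(\<surd>5 V + 125 b\<^sup>2) / (\<surd>5 V - 125 b\<^sup>2)\<close>, and evaluating the cyclic norms \<open>b\<close> and \<open>V\<close> turns it into
  \<open>- w (w - 4)\<^sup>5 / (64 (w + 1)\<^sup>5)\<close>; a Moebius change of the coordinate \<open>w\<close> gives the claimed function.

  The bijection from the quotient to the projective line is a homeomorphism by compactness. Its
  inverse is holomorphic away from finitely many points because the curve has local holomorphic
  sections over \<open>w\<close> there, and everywhere because isolated singularities of continuous functions
  are removable.
\<close>

section \<open>Sheaves of holomorphic functions and Riemann surfaces\<close>

text \<open>\<open>beta_I4\<close> and \<open>beta_D10\<close> are definite descriptions, so a
  formula for them can be used only after an everywhere defined holomorphic map has been exhibited
  and shown to be the only extension. For \<open>beta_I4\<close> the candidate is the composite of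
  \<open>phi\<close>, \<open>D10_coord\<close> and \<open>D10_map\<close>, and uniqueness needs the
  points with \<open>a \<noteq> 0\<close> to be dense. Density is read off from the quotient:
  \<open>phi\<close> is open, being a group quotient followed by a homeomorphism, and nonempty open
  sets of the projective line are infinite. Hence the quotient is identified before anything is said
  about \<open>beta_I4\<close>. No chart of Bring's curve is constructed; the Riemann surface
  structure of the quotient is transported from the projective line. The formula contains
  \<open>\<surd>5\<close> and the Vandermonde product, while the cyclic order given by the group may
  be an odd rearrangement of the coordinates, which reverses the sign of that product. The sign is
  absorbed by the choice of the fifth root of unity \<open>z\<close>: its Gauss sum
  \<open>z + z^4 - z^2 - z^3\<close> can be either square root of 5.\<close>

lemma points_csubspace [simp]: "points (csubspace X S) = points X \<inter> S"
  by (simp add: csubspace_def)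

lemma ctop_csubspace [simp]: "ctop (csubspace X S) = subtopology (ctop X) S"
  by (simp add: csubspace_def)

lemma hol_csubspace:
  "h \<in> hol (csubspace X S) U \<longleftrightarrow>
     (\<forall>p\<in>U. \<exists>V. openin (ctop X) V \<and> p \<in> V \<and> (\<exists>k \<in> hol X V. \<forall>q \<in> U \<inter> V. h q = k q))"
  by (simp add: csubspace_def)

lemma hol_csubspaceI:
  assumes "openin (ctop X) U" "h \<in> hol X U"
  shows "h \<in> hol (csubspace X S) U"
  unfolding hol_csubspace using assms by blast

lemma hol_csubspaceD:
  assumes "h \<in> hol (csubspace X S) U" "p \<in> U"
  shows "\<exists>V k. openin (ctop X) V \<and> p \<in> V \<and> k \<in> hol X V \<and> (\<forall>q\<in>U \<inter> V. h q = k q)"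
  using bspec[OF iffD1[OF hol_csubspace assms(1)] assms(2)] by fast

text \<open>The locality clause of \<open>riemann_surface\<close> by itself. A \<open>cspace\<close>
  may carry any family \<open>hol\<close>; without this clause neither restriction to a smaller open
  set nor a change of values off the set has to preserve holomorphy.\<close>

definition local_hol :: "'a cspace \<Rightarrow> bool" where
  "local_hol X \<longleftrightarrow> (\<forall>U. openin (ctop X) U \<longrightarrow> hol X U = hol (csubspace X (points X)) U)"

lemma local_holD:
  assumes "local_hol X" "openin (ctop X) U"
  shows "h \<in> hol X U \<longleftrightarrow>
     (\<forall>p\<in>U. \<exists>V. openin (ctop X) V \<and> p \<in> V \<and> (\<exists>k \<in> hol X V. \<forall>q \<in> U \<inter> V. h q = k q))"
proof -
  have "hol X U = hol (csubspace X (points X)) U"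
    using assms unfolding local_hol_def by blast
  then show ?thesis by (subst \<open>hol X U = _\<close>) (rule hol_csubspace)
qed

lemma local_holI:
  assumes "\<And>U h. openin (ctop X) U \<Longrightarrow> h \<in> hol (csubspace X (points X)) U \<Longrightarrow> h \<in> hol X U"
  shows "local_hol X"
  unfolding local_hol_def using assms hol_csubspaceI by (metis subsetI subset_antisym)

lemma hol_mono:
  assumes "local_hol X" "openin (ctop X) U" "openin (ctop X) V" "V \<subseteq> U" "h \<in> hol X U"
  shows "h \<in> hol X V"
  unfolding local_holD[OF assms(1,3)]
  by (intro ballI exI[of _ U] conjI bexI[of _ h]) (use assms in auto)

lemma hol_cong:
  assumes "local_hol X" "openin (ctop X) U" "\<And>p. p \<in> U \<Longrightarrow> h p = k p" "h \<in> hol X U"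
  shows "k \<in> hol X U"
  unfolding local_holD[OF assms(1,2)]
proof
  fix p assume "p \<in> U"
  moreover have "\<forall>q\<in>U \<inter> U. k q = h q" using assms(3) by simp
  ultimately show "\<exists>V. openin (ctop X) V \<and> p \<in> V \<and> (\<exists>l\<in>hol X V. \<forall>q\<in>U \<inter> V. k q = l q)"
    using assms(2,4) by blast
qed

text \<open>The sheaf of \<open>csubspace X S\<close> is defined without reference to
  \<open>S\<close>, which enters through the topology alone. On sets open in \<open>X\<close> the
  condition is therefore just locality of \<open>X\<close>.\<close>

lemma hol_csubspace_open:
  assumes "local_hol X" "openin (ctop X) U"
  shows "hol (csubspace X S) U = hol X U"
proof (rule Set.set_eqI)
  fix h show "h \<in> hol (csubspace X S) U \<longleftrightarrow> h \<in> hol X U"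
    using local_holD[OF assms, of h] hol_csubspace[of h X S U] by (rule trans[OF _ sym, rotated])
qed

lemma local_hol_csubspace:
  assumes X: "local_hol X"
  shows "local_hol (csubspace X S)"
proof (rule local_holI)
  fix U h assume U: "openin (ctop (csubspace X S)) U"
    and h: "h \<in> hol (csubspace (csubspace X S) (points (csubspace X S))) U"
  show "h \<in> hol (csubspace X S) U"
    unfolding hol_csubspace
  proof
    fix p assume p: "p \<in> U"
    obtain V k where V: "openin (ctop (csubspace X S)) V" "p \<in> V"
      and k: "k \<in> hol (csubspace X S) V" "\<forall>q\<in>U \<inter> V. h q = k q"
      using hol_csubspaceD[OF h p] by (elim exE conjE)
    obtain V' where V': "openin (ctop X) V'" "V = V' \<inter> S"
      using V(1) by (auto simp: openin_subtopology)
    obtain V2 k2 where V2: "openin (ctop X) V2" "p \<in> V2" and k2: "k2 \<in> hol X V2"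
        "\<forall>q\<in>V \<inter> V2. k q = k2 q"
      using hol_csubspaceD[OF k(1) V(2)] by (elim exE conjE)
    have US: "U \<subseteq> S" using openin_subset[OF U] by simp
    have "openin (ctop X) (V' \<inter> V2)" using V' V2 by blast
    moreover have "k2 \<in> hol X (V' \<inter> V2)"
      using hol_mono[OF X V2(1)] calculation k2(1) by blast
    moreover have "p \<in> V' \<inter> V2" using V V' V2 by auto
    moreover have "\<forall>q\<in>U \<inter> (V' \<inter> V2). h q = k2 q"
      using k(2) k2(2) US V'(2) by auto
    ultimately show "\<exists>V. openin (ctop X) V \<and> p \<in> V \<and> (\<exists>k\<in>hol X V. \<forall>q\<in>U \<inter> V. h q = k q)"
      by blast
  qed
qed

section \<open>Topology and sheaf of a quotient\<close>

lemma points_cquotient [simp]: "points (cquotient X q) = q ` points X"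
proof -
  have "openin (quotient_top (ctop X) q) (q ` points X)"
    unfolding openin_quotient_top by (auto simp: conj_commute intro: back_subst[of "openin (ctop X)", OF openin_topspace])
  then show ?thesis
    by (auto simp: cquotient_def topspace_def openin_quotient_top)
qed

lemma openin_cquotient:
  "openin (ctop (cquotient X q)) V \<longleftrightarrow>
     V \<subseteq> q ` points X \<and> openin (ctop X) {p \<in> points X. q p \<in> V}"
  by (simp add: cquotient_def openin_quotient_top)

lemma hol_cquotient: "h \<in> hol (cquotient X q) V \<longleftrightarrow> h \<circ> q \<in> hol X {p \<in> points X. q p \<in> V}"
  by (simp add: cquotient_def)

lemma local_hol_cquotient:
  assumes X: "local_hol X"
  shows "local_hol (cquotient X q)"
proof (rule local_holI)
  fix U h assume U: "openin (ctop (cquotient X q)) U"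
    and h: "h \<in> hol (csubspace (cquotient X q) (points (cquotient X q))) U"
  have o: "openin (ctop X) {p \<in> points X. q p \<in> U}" using U by (simp add: openin_cquotient)
  show "h \<in> hol (cquotient X q) U"
    unfolding hol_cquotient local_holD[OF X o]
  proof
    fix p assume p: "p \<in> {p \<in> points X. q p \<in> U}"
    obtain V k where V: "openin (ctop (cquotient X q)) V" "q p \<in> V"
      and k: "k \<in> hol (cquotient X q) V" "\<forall>r\<in>U \<inter> V. h r = k r"
      using hol_csubspaceD[OF h, of "q p"] p by auto
    show "\<exists>V. openin (ctop X) V \<and> p \<in> V \<and>
            (\<exists>k\<in>hol X V. \<forall>r\<in>{p \<in> points X. q p \<in> U} \<inter> V. (h \<circ> q) r = k r)"
      by (intro exI[of _ "{p \<in> points X. q p \<in> V}"] conjI bexI[of _ "k \<circ> q"])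
        (use V k p in \<open>auto simp: openin_cquotient hol_cquotient\<close>)
  qed
qed

section \<open>Holomorphic and biholomorphic maps\<close>

lemma holo_mapD:
  assumes "holo_map X Y f" "openin (ctop Y) V" "h \<in> hol Y V"
  shows "h \<circ> f \<in> hol X {p \<in> points X. f p \<in> V}"
  using assms by (simp add: holo_map_def)

lemma holo_map_continuous: "holo_map X Y f \<Longrightarrow> continuous_map (ctop X) (ctop Y) f"
  by (simp add: holo_map_def)

lemma holo_map_openin:
  assumes "holo_map X Y f" "openin (ctop Y) V"
  shows "openin (ctop X) {p \<in> points X. f p \<in> V}"
  using assms by (simp add: holo_map_def continuous_map_def)

lemma holo_map_in: "holo_map X Y f \<Longrightarrow> p \<in> points X \<Longrightarrow> f p \<in> points Y"
  by (auto simp: holo_map_def continuous_map_def)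

lemma holo_map_cong:
  assumes X: "local_hol X" and f: "holo_map X Y f" and eq: "\<And>p. p \<in> points X \<Longrightarrow> f p = g p"
  shows "holo_map X Y g"
  unfolding holo_map_def
proof (intro conjI allI impI ballI)
  show "continuous_map (ctop X) (ctop Y) g"
    using continuous_map_eq[of _ _ f g] f eq by (auto simp: holo_map_def)
  fix V h assume V: "openin (ctop Y) V" "h \<in> hol Y V"
  have e: "{p \<in> points X. f p \<in> V} = {p \<in> points X. g p \<in> V}" using eq by auto
  show "h \<circ> g \<in> hol X {p \<in> points X. g p \<in> V}"
    using hol_cong[OF X holo_map_openin[OF f V(1)] _ holo_mapD[OF f V], of "h \<circ> g"] eq e by auto
qed

lemma holo_map_compose:
  assumes X: "local_hol X" and f: "holo_map X Y f" and g: "holo_map Y Z g"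
  shows "holo_map X Z (g \<circ> f)"
  unfolding holo_map_def
proof (intro conjI allI impI ballI)
  show "continuous_map (ctop X) (ctop Z) (g \<circ> f)"
    by (rule continuous_map_compose[OF holo_map_continuous[OF f] holo_map_continuous[OF g]])
  fix V h assume V: "openin (ctop Z) V" "h \<in> hol Z V"
  have "h \<circ> g \<circ> f \<in> hol X {p \<in> points X. f p \<in> {p \<in> points Y. g p \<in> V}}"
    by (intro holo_mapD[OF f] holo_map_openin[OF g] holo_mapD[OF g] V)
  moreover have "{p \<in> points X. f p \<in> {p \<in> points Y. g p \<in> V}} = {p \<in> points X. (g \<circ> f) p \<in> V}"
    using holo_map_in[OF f] by auto
  ultimately show "h \<circ> (g \<circ> f) \<in> hol X {p \<in> points X. (g \<circ> f) p \<in> V}"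
    by (simp add: comp_assoc)
qed

lemma holo_map_restrict:
  assumes X: "local_hol X" and Y: "local_hol Y" and f: "holo_map X Y f"
    and U: "openin (ctop X) U" and V: "openin (ctop Y) V" and UV: "f ` U \<subseteq> V"
  shows "holo_map (csubspace X U) (csubspace Y V) f"
  unfolding holo_map_def
proof (intro conjI allI impI ballI)
  show "continuous_map (ctop (csubspace X U)) (ctop (csubspace Y V)) f"
    using f UV by (auto simp: holo_map_def continuous_map_in_subtopology
        intro: continuous_map_from_subtopology)
  fix O1 h assume O1: "openin (ctop (csubspace Y V)) O1" and h: "h \<in> hol (csubspace Y V) O1"
  have O1': "openin (ctop Y) O1" using O1 V by (simp add: openin_open_subtopology)
  have h': "h \<in> hol Y O1" using h hol_csubspace_open[OF Y O1'] by simp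
  have e: "{p \<in> points (csubspace X U). f p \<in> O1} = U \<inter> {p \<in> points X. f p \<in> O1}"
    using openin_subset[OF U] by auto
  have o: "openin (ctop X) (U \<inter> {p \<in> points X. f p \<in> O1})"
    using holo_map_openin[OF f O1'] U by blast
  show "h \<circ> f \<in> hol (csubspace X U) {p \<in> points (csubspace X U). f p \<in> O1}"
    unfolding e hol_csubspace_open[OF X o]
    by (rule hol_mono[OF X holo_map_openin[OF f O1'] o _ holo_mapD[OF f O1' h']]) auto
qed

lemma holo_map_csubspace_points:
  assumes "local_hol X" "holo_map (csubspace X (points X)) Y f"
  shows "holo_map X Y f"
proof -
  have "continuous_map (ctop X) (ctop Y) f"
    using assms(2) by (simp add: holo_map_def)
  then have "openin (ctop X) {p \<in> points X. f p \<in> V}" if "openin (ctop Y) V" for V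
    using that by (simp add: continuous_map_def)
  then show ?thesis
    using assms(2) hol_csubspace_open[OF assms(1), of _ "points X"] by (simp add: holo_map_def)
qed

lemma biholomorphicI:
  assumes "holo_map X Y f" "holo_map Y X g"
    and "\<And>p. p \<in> points X \<Longrightarrow> g (f p) = p" "\<And>p. p \<in> points Y \<Longrightarrow> f (g p) = p"
  shows "biholomorphic X Y f"
  unfolding biholomorphic_def homeomorphic_maps_def
  using assms holo_map_continuous[OF assms(1)] holo_map_continuous[OF assms(2)] by (intro exI[of _ g]) simp

lemma biholomorphicE:
  assumes "biholomorphic X Y f"
  obtains g where "holo_map X Y f" "holo_map Y X g"
    "\<And>p. p \<in> points X \<Longrightarrow> g (f p) = p" "\<And>p. p \<in> points Y \<Longrightarrow> f (g p) = p"
proof -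
  obtain g where "homeomorphic_maps (ctop X) (ctop Y) f g" "holo_map X Y f" "holo_map Y X g"
    using assms unfolding biholomorphic_def by (elim exE conjE)
  then show thesis using that[of g] by (simp add: homeomorphic_maps_def)
qed

lemma biholomorphic_compose:
  assumes "local_hol X" "local_hol Z" "biholomorphic X Y f" "biholomorphic Y Z g"
  shows "biholomorphic X Z (g \<circ> f)"
proof -
  from assms(3) obtain f' where f: "holo_map X Y f" "holo_map Y X f'"
    "\<And>p. p \<in> points X \<Longrightarrow> f' (f p) = p" "\<And>p. p \<in> points Y \<Longrightarrow> f (f' p) = p"
    by (elim biholomorphicE) simp
  from assms(4) obtain g' where g: "holo_map Y Z g" "holo_map Z Y g'"
    "\<And>p. p \<in> points Y \<Longrightarrow> g' (g p) = p" "\<And>p. p \<in> points Z \<Longrightarrow> g (g' p) = p"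
    by (elim biholomorphicE) simp
  show ?thesis
    by (rule biholomorphicI[of _ _ _ "f' \<circ> g'"])
      (use assms f g holo_map_compose holo_map_in[OF f(1)] holo_map_in[OF g(2)] in auto)
qed

lemma biholomorphic_restrict:
  assumes "local_hol X" "local_hol Y" "biholomorphic X Y f" "openin (ctop Y) V"
  shows "biholomorphic (csubspace X {p \<in> points X. f p \<in> V}) (csubspace Y V) f"
proof -
  from assms(3) obtain g where f: "holo_map X Y f" "holo_map Y X g"
    "\<And>p. p \<in> points X \<Longrightarrow> g (f p) = p" "\<And>p. p \<in> points Y \<Longrightarrow> f (g p) = p"
    by (elim biholomorphicE) simp
  show ?thesis
    by (rule biholomorphicI[of _ _ _ g])
      (use assms f holo_map_in[OF f(2)] openin_subset[OF assms(4)]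
        in \<open>auto intro!: holo_map_restrict holo_map_openin[OF f(1)]\<close>)
qed

lemma local_hol_complex_plane: "local_hol complex_plane"
proof (rule local_holI)
  fix U h assume U: "openin (ctop complex_plane) U"
    and h: "h \<in> hol (csubspace complex_plane (points complex_plane)) U"
  have U': "open U" using U by (simp add: complex_plane_def)
  have "h field_differentiable at z" if z: "z \<in> U" for z
  proof -
    obtain V k where "openin (ctop complex_plane) V" "z \<in> V" "k \<in> hol complex_plane V"
      and eq: "\<forall>q\<in>U \<inter> V. h q = k q"
      using hol_csubspaceD[OF h z] by (elim exE conjE)
    then have V: "open V" "z \<in> V" "k holomorphic_on V" by (auto simp: complex_plane_def)
    have "k field_differentiable at z"
      using V holomorphic_on_imp_differentiable_at by blast
    then show ?thesis
      using V z U' eq unfolding field_differentiable_def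
      by (metis IntD1 IntD2 IntI has_field_derivative_transform_within_open open_Int)
  qed
  then show "h \<in> hol complex_plane U"
    using U' by (simp add: complex_plane_def holomorphic_on_open field_differentiable_def)
qed

section \<open>Charts, transport of structure, critical points\<close>

lemma chart_pullback:
  assumes X: "local_hol X" and Y: "local_hol Y" and f: "biholomorphic X Y f" and c: "chart Y V w"
  shows "chart X {p \<in> points X. f p \<in> V} (w \<circ> f)"
proof -
  let ?U = "{p \<in> points X. f p \<in> V}"
  from f obtain g where fg: "holo_map X Y f" "holo_map Y X g"
    "\<And>p. p \<in> points X \<Longrightarrow> g (f p) = p" "\<And>p. p \<in> points Y \<Longrightarrow> f (g p) = p"
    by (elim biholomorphicE) simp
  have V: "openin (ctop Y) V" using c by (simp add: chart_def)
  have "f ` ?U = V"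
  proof
    show "V \<subseteq> f ` ?U"
    proof
      fix v assume v: "v \<in> V"
      then have vp: "v \<in> points Y" using openin_subset[OF V] by auto
      then have "g v \<in> ?U" using fg(4)[OF vp] v holo_map_in[OF fg(2) vp] by simp
      then show "v \<in> f ` ?U" using fg(4)[OF vp] by (intro image_eqI[of _ _ "g v"]) simp_all
    qed
  qed auto
  then have im: "(w \<circ> f) ` ?U = w ` V" by (simp only: image_comp[symmetric])
  show ?thesis
    unfolding chart_def im
  proof (intro conjI)
    show "openin (ctop X) ?U" using holo_map_openin[OF fg(1) V] .
    show "open (w ` V)" using c by (simp add: chart_def)
    show "biholomorphic (csubspace X ?U) (csubspace complex_plane (w ` V)) (w \<circ> f)"
      by (rule biholomorphic_compose[OF local_hol_csubspace[OF X]
            local_hol_csubspace[OF local_hol_complex_plane] biholomorphic_restrict[OF X Y f V]])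
        (use c in \<open>simp add: chart_def\<close>)
  qed
qed

text \<open>The quotient of the curve obtains its charts, connectedness and separation from
  \<open>CP1\<close> in this way; only locality has to come from the construction of
  \<open>X\<close>.\<close>

lemma riemann_surface_pullback:
  assumes X: "local_hol X" and Y: "riemann_surface Y" and f: "biholomorphic X Y f"
  shows "riemann_surface X"
proof -
  obtain g where fg: "homeomorphic_maps (ctop X) (ctop Y) f g" and h: "holo_map X Y f"
    using f unfolding biholomorphic_def by (elim exE conjE)
  have hs: "ctop X homeomorphic_space ctop Y" using fg homeomorphic_space_def by blast
  have Yl: "local_hol Y" and Y': "points Y \<noteq> {}" "connected_space (ctop Y)" "Hausdorff_space (ctop Y)"
    using Y unfolding riemann_surface_def local_hol_def by blast+
  show ?thesis
    unfolding riemann_surface_def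
  proof (intro conjI ballI)
    show "points X \<noteq> {}"
      using Y'(1) homeomorphic_empty_space[OF hs] by (auto simp: null_topspace_iff_trivial)
    show "connected_space (ctop X)"
      using homeomorphic_connected_space[OF hs] Y' by blast
    show "Hausdorff_space (ctop X)"
      using homeomorphic_Hausdorff_space[OF hs] Y' by blast
    show "\<forall>U. openin (ctop X) U \<longrightarrow> hol X U = hol (csubspace X (points X)) U"
      using X unfolding local_hol_def .
    fix p assume p: "p \<in> points X"
    then have "f p \<in> points Y" by (rule holo_map_in[OF h])
    then obtain V w where V: "f p \<in> V" "chart Y V w" using Y unfolding riemann_surface_def by blast
    show "\<exists>U z. p \<in> U \<and> chart X U z"
      by (intro exI[of _ "{p \<in> points X. f p \<in> V}"] exI[of _ "w \<circ> f"] conjI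
          chart_pullback[OF X Yl f V(2)]) (simp add: V(1) p)
  qed
qed

text \<open>An injective holomorphic function of one variable has no zero of the derivative, and
  injectivity is visible in every pair of charts. As \<open>critical_point\<close> quantifies
  existentially over charts, this avoids comparing derivatives in different ones.\<close>

lemma locally_injective_not_critical:
  assumes X: "local_hol X" and Y: "local_hol Y" and f: "holo_map X Y f"
    and N: "openin (ctop X) N" "p \<in> N" "inj_on f N"
  shows "\<not> critical_point X Y f p"
proof
  assume "critical_point X Y f p"
  then obtain U z V w where cz: "chart X U z" and cw: "chart Y V w" and pU: "p \<in> U"
    and UV: "f ` U \<subseteq> V" and d: "deriv (w \<circ> f \<circ> inv_into U z) (z p) = 0"
    unfolding critical_point_def by blast
  have U: "openin (ctop X) U" and V: "openin (ctop Y) V" and zU: "open (z ` U)" and wV: "open (w ` V)"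
    using cz cw by (auto simp: chart_def)
  have Us: "U \<subseteq> points X" and Vs: "V \<subseteq> points Y"
    using openin_subset[OF U] openin_subset[OF V] .
  obtain z' where z: "holo_map (csubspace X U) (csubspace complex_plane (z ` U)) z"
    "holo_map (csubspace complex_plane (z ` U)) (csubspace X U) z'"
    "\<And>p. p \<in> U \<Longrightarrow> z' (z p) = p"
  proof -
    have "biholomorphic (csubspace X U) (csubspace complex_plane (z ` U)) z"
      using cz by (simp add: chart_def)
    then obtain g where "holo_map (csubspace X U) (csubspace complex_plane (z ` U)) z"
      "holo_map (csubspace complex_plane (z ` U)) (csubspace X U) g"
      "\<And>p. p \<in> points (csubspace X U) \<Longrightarrow> g (z p) = p"
      by (elim biholomorphicE) simp
    then show thesis using that[of g] Us by (simp add: subset_iff)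
  qed
  obtain w' where w: "holo_map (csubspace Y V) (csubspace complex_plane (w ` V)) w"
    "\<And>p. p \<in> V \<Longrightarrow> w' (w p) = p"
  proof -
    have "biholomorphic (csubspace Y V) (csubspace complex_plane (w ` V)) w"
      using cw by (simp add: chart_def)
    then obtain g where "holo_map (csubspace Y V) (csubspace complex_plane (w ` V)) w"
      "holo_map (csubspace complex_plane (w ` V)) (csubspace Y V) g"
      "\<And>p. p \<in> points (csubspace Y V) \<Longrightarrow> g (w p) = p"
      by (elim biholomorphicE) simp
    then show thesis using that[of g] Vs by (simp add: subset_iff)
  qed
  have zinj: "inj_on z U" and winj: "inj_on w V" using z(3) w(2) by (metis inj_onI)+
  have fr: "holo_map (csubspace X U) (csubspace Y V) f"
    using holo_map_restrict[OF X Y f U V UV] .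
  have lC: "local_hol (csubspace complex_plane S)" for S
    by (intro local_hol_csubspace local_hol_complex_plane)
  have "holo_map (csubspace complex_plane (z ` U)) (csubspace complex_plane (w ` V)) (w \<circ> (f \<circ> z'))"
    by (rule holo_map_compose[OF lC holo_map_compose[OF lC z(2) fr] w(1)])
  from holo_mapD[OF this, of "w ` V" "\<lambda>t. t"]
  have "(\<lambda>t. t) \<circ> (w \<circ> (f \<circ> z')) \<in> hol (csubspace complex_plane (z ` U))
      {p \<in> points (csubspace complex_plane (z ` U)). (w \<circ> (f \<circ> z')) p \<in> w ` V}"
    using wV hol_csubspace_open[OF local_hol_complex_plane, of "w ` V" "w ` V"]
    by (auto simp: complex_plane_def openin_open_subtopology)
  moreover have "{p \<in> points (csubspace complex_plane (z ` U)). (w \<circ> (f \<circ> z')) p \<in> w ` V} = z ` U"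
    using z(3) UV by (auto simp: complex_plane_def)
  ultimately have "(w \<circ> (f \<circ> z')) holomorphic_on z ` U"
    using zU hol_csubspace_open[OF local_hol_complex_plane, of "z ` U" "z ` U"]
    by (auto simp: complex_plane_def comp_def)
  moreover have "(w \<circ> f \<circ> inv_into U z) t = (w \<circ> (f \<circ> z')) t" if "t \<in> z ` U" for t
    using that z(3) zinj by auto
  ultimately have hol: "(w \<circ> f \<circ> inv_into U z) holomorphic_on z ` U"
    by (metis (no_types, lifting) holomorphic_transform)
  define M where "M = z ` (U \<inter> N)"
  have "openin (ctop (csubspace X U)) (U \<inter> N)"
    using N U by (auto simp: openin_open_subtopology)
  then have "openin (ctop (csubspace complex_plane (z ` U)))
      {t \<in> points (csubspace complex_plane (z ` U)). z' t \<in> U \<inter> N}"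
    using holo_map_openin[OF z(2)] by blast
  moreover have "{t \<in> points (csubspace complex_plane (z ` U)). z' t \<in> U \<inter> N} = M"
    using z(3) by (auto simp: M_def complex_plane_def)
  ultimately have oM: "open M" using zU by (auto simp: complex_plane_def openin_open_subtopology)
  have "inj_on (w \<circ> f \<circ> inv_into U z) M"
  proof (rule inj_onI)
    fix s t assume "s \<in> M" "t \<in> M" and eq: "(w \<circ> f \<circ> inv_into U z) s = (w \<circ> f \<circ> inv_into U z) t"
    then obtain a b where ab: "s = z a" "t = z b" "a \<in> U" "b \<in> U" "a \<in> N" "b \<in> N"
      by (auto simp: M_def)
    then have "w (f a) = w (f b)" using eq zinj by simp
    then have "f a = f b" using winj UV ab by (meson image_subset_iff inj_onD)
    then show "s = t" using N(3) ab by (auto dest: inj_onD)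
  qed
  moreover have "(w \<circ> f \<circ> inv_into U z) holomorphic_on M"
    by (rule holomorphic_on_subset[OF hol]) (auto simp: M_def)
  moreover have "z p \<in> M" using pU N(2) by (auto simp: M_def)
  ultimately show False using holomorphic_injective_imp_regular oM d by blast
qed

section \<open>Holomorphic functions on projective spaces\<close>

lemma has_derivative_vecI:
  fixes F :: "'a::euclidean_space \<Rightarrow> complex ^ 'n"
  assumes "\<And>i. ((\<lambda>x. F x $ i) has_derivative (\<lambda>v. D v $ i)) (at x)"
  shows "(F has_derivative D) (at x)"
proof -
  have l: "linear D"
    by (rule linearI; rule vec_eq_iff[THEN iffD2])
      (simp_all add: linear_add[OF has_derivative_linear[OF assms]]
        linear_scale[OF has_derivative_linear[OF assms]])
  have "((\<lambda>y. (F y - F x - D (y - x)) /\<^sub>R norm (y - x)) \<longlongrightarrow> 0) (at x)"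
    using assms by (intro vec_tendstoI) (simp add: has_derivative_def Lim_ident_at)
  then show ?thesis
    using l by (simp add: linear_conv_bounded_linear has_derivative_def Lim_ident_at)
qed

text \<open>The condition in \<open>affine_space\<close> at a single point, so that closure under
  arithmetic is a pointwise matter and no domains have to be carried along.\<close>

definition chol :: "(complex ^ 'n \<Rightarrow> complex) \<Rightarrow> complex ^ 'n \<Rightarrow> bool" where
  "chol h x \<longleftrightarrow> (\<exists>D. (h has_derivative D) (at x) \<and> (\<forall>c v. D (c *s v) = c * D v))"

lemma chol_isCont: "chol h x \<Longrightarrow> isCont h x"
  unfolding chol_def using has_derivative_continuous by blast

lemma chol_transform:
  assumes "chol k x" "open V" "x \<in> V" "\<And>y. y \<in> V \<Longrightarrow> k y = h y"
  shows "chol h x"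
  using assms unfolding chol_def by (metis has_derivative_transform_within_open)

lemma chol_const [simp]: "chol (\<lambda>x. c) x"
  unfolding chol_def by (intro exI[of _ "\<lambda>_. 0"]) simp

lemma chol_nth [simp]: "chol (\<lambda>x. x $ i) x"
  unfolding chol_def
  by (intro exI[of _ "\<lambda>v. v $ i"])
    (simp add: bounded_linear_imp_has_derivative bounded_linear_vec_nth)

lemma chol_add [intro]:
  assumes "chol f x" "chol g x" shows "chol (\<lambda>x. f x + g x) x"
proof -
  obtain D E where "(f has_derivative D) (at x)" "\<forall>c v. D (c *s v) = c * D v"
    "(g has_derivative E) (at x)" "\<forall>c v. E (c *s v) = c * E v"
    using assms unfolding chol_def by blast
  then show ?thesis unfolding chol_def
    by (intro exI[of _ "\<lambda>v. D v + E v"]) (auto intro: has_derivative_add simp: algebra_simps)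
qed

lemma chol_mult [intro]:
  assumes "chol f x" "chol g x" shows "chol (\<lambda>x. f x * g x) x"
proof -
  obtain D E where "(f has_derivative D) (at x)" "\<forall>c v. D (c *s v) = c * D v"
    "(g has_derivative E) (at x)" "\<forall>c v. E (c *s v) = c * E v"
    using assms unfolding chol_def by blast
  then show ?thesis unfolding chol_def
    by (intro exI[of _ "\<lambda>v. f x * E v + D v * g x"] conjI has_derivative_mult)
      (simp_all add: algebra_simps)
qed

lemma chol_uminus [intro]: "chol f x \<Longrightarrow> chol (\<lambda>x. - f x) x"
  using chol_mult[of "\<lambda>_. -1" x f] by simp

lemma chol_diff [intro]: "chol f x \<Longrightarrow> chol g x \<Longrightarrow> chol (\<lambda>x. f x - g x) x"
  using chol_add[of f x "\<lambda>x. - g x"] by auto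

lemma chol_power [intro]: "chol f x \<Longrightarrow> chol (\<lambda>x. f x ^ n) x"
  by (induction n) auto

lemma chol_sum [intro]: "(\<And>i. i \<in> I \<Longrightarrow> chol (f i) x) \<Longrightarrow> chol (\<lambda>x. \<Sum>i\<in>I. f i x) x"
  by (induction I rule: infinite_finite_induct) auto

lemma chol_compose_field:
  assumes g: "g field_differentiable (at (f x))" and f: "chol f x"
  shows "chol (\<lambda>x. g (f x)) x"
proof -
  obtain d where d: "(g has_field_derivative d) (at (f x))"
    using g by (auto simp: field_differentiable_def)
  obtain D where D: "(f has_derivative D) (at x)" "\<forall>c v. D (c *s v) = c * D v"
    using f by (auto simp: chol_def)
  have "((\<lambda>x. g (f x)) has_derivative (\<lambda>v. d * D v)) (at x)"
    by (rule has_derivative_compose[OF D(1) d[unfolded has_field_derivative_def]])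
  then show ?thesis
    unfolding chol_def using D(2) by (intro exI[of _ "\<lambda>v. d * D v"]) simp
qed

lemma chol_divide:
  assumes "chol f x" "chol g x" "g x \<noteq> 0" shows "chol (\<lambda>x. f x / g x) x"
proof -
  have "chol (\<lambda>x. inverse (g x)) x"
    by (rule chol_compose_field[of inverse g x])
      (use assms in \<open>auto intro: field_differentiable_inverse field_differentiable_ident\<close>)
  from chol_mult[OF assms(1) this] show ?thesis by (simp add: divide_inverse)
qed

lemma chol_compose:
  fixes F :: "complex ^ 'n \<Rightarrow> complex ^ 'm"
  assumes h: "chol h (F x)" and F: "\<And>i. chol (\<lambda>x. F x $ i) x"
  shows "chol (\<lambda>x. h (F x)) x"
proof -
  obtain H where H: "(h has_derivative H) (at (F x))" "\<forall>c v. H (c *s v) = c * H v"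
    using h by (auto simp: chol_def)
  obtain D where D: "\<And>i. ((\<lambda>x. F x $ i) has_derivative D i) (at x)" "\<And>i c v. D i (c *s v) = c * D i v"
    using F unfolding chol_def by metis
  have "(F has_derivative (\<lambda>v. \<chi> i. D i v)) (at x)"
    by (rule has_derivative_vecI) (use D in simp)
  from has_derivative_compose[OF this H(1)]
  have "((\<lambda>x. h (F x)) has_derivative (\<lambda>v. H (\<chi> i. D i v))) (at x)" .
  moreover have "H (\<chi> i. D i (c *s v)) = c * H (\<chi> i. D i v)" for c v
  proof -
    have "(\<chi> i. D i (c *s v)) = c *s (\<chi> i. D i v)" by (simp add: vec_eq_iff D(2))
    then show ?thesis using H(2) by simp
  qed
  ultimately show ?thesis unfolding chol_def by blast
qed

lemma chol_curve:
  fixes \<gamma> :: "complex \<Rightarrow> complex ^ 'n"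
  assumes h: "chol h (\<gamma> z)" and g: "\<And>i. (\<lambda>z. \<gamma> z $ i) field_differentiable (at z)"
  shows "(\<lambda>z. h (\<gamma> z)) field_differentiable (at z)"
proof -
  obtain H where H: "(h has_derivative H) (at (\<gamma> z))" "\<forall>c v. H (c *s v) = c * H v"
    using h by (auto simp: chol_def)
  obtain d where d: "\<And>i. ((\<lambda>z. \<gamma> z $ i) has_field_derivative d i) (at z)"
    using g unfolding field_differentiable_def by metis
  have "(\<gamma> has_derivative (\<lambda>v. v *s (\<chi> i. d i))) (at z)"
  proof (rule has_derivative_vecI)
    fix i
    have "(\<lambda>v. (v *s (\<chi> i. d i)) $ i) = (*) (d i)" by (simp add: fun_eq_iff)
    then show "((\<lambda>x. \<gamma> x $ i) has_derivative (\<lambda>v. (v *s (\<chi> i. d i)) $ i)) (at z)"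
      using d[of i] by (simp only: has_field_derivative_def)
  qed
  from has_derivative_compose[OF this H(1)]
  have "((\<lambda>x. h (\<gamma> x)) has_derivative (\<lambda>v. H (v *s (\<chi> i. d i)))) (at z)" .
  moreover have "(\<lambda>v. H (v *s (\<chi> i. d i))) = (*) (H (\<chi> i. d i))"
    by (simp add: fun_eq_iff H(2))
  ultimately have "((\<lambda>x. h (\<gamma> x)) has_field_derivative H (\<chi> i. d i)) (at z)"
    unfolding has_field_derivative_def by (simp only:)
  then show ?thesis by (auto simp: field_differentiable_def)
qed

lemma chol_continuous_on: "(\<And>x. x \<in> S \<Longrightarrow> chol h x) \<Longrightarrow> continuous_on S h"
  by (simp add: chol_isCont continuous_at_imp_continuous_on)

lemma hol_affine_space: "h \<in> hol affine_space U \<longleftrightarrow> (\<forall>x\<in>U. chol h x)"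
  by (simp add: affine_space_def chol_def)

lemma ctop_affine_space [simp]: "ctop affine_space = euclidean"
  by (simp add: affine_space_def)

lemma hol_punctured_space:
  fixes U :: "(complex ^ 'n) set"
  assumes U: "open U"
  shows "h \<in> hol (csubspace affine_space S) U \<longleftrightarrow> (\<forall>x\<in>U. chol h x)"
proof
  assume h: "h \<in> hol (csubspace affine_space S) U"
  show "\<forall>x\<in>U. chol h x"
  proof
    fix x assume x: "x \<in> U"
    obtain V k where "openin (ctop affine_space) V" "x \<in> V" "k \<in> hol affine_space V"
      and "\<forall>q\<in>U \<inter> V. h q = k q"
      using hol_csubspaceD[OF h x] by (elim exE conjE)
    then show "chol h x"
      using x U by - (rule chol_transform[of k x "U \<inter> V"], auto simp: hol_affine_space)
  qed
next
  assume "\<forall>x\<in>U. chol h x"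
  then show "h \<in> hol (csubspace affine_space S) U"
    using U by (intro hol_csubspaceI) (simp_all add: hol_affine_space)
qed

section \<open>Lines, cones and functions on projective space\<close>

lemma line_scale: "c \<noteq> 0 \<Longrightarrow> line (c *s x) = line x"
proof -
  have "d *s x \<in> range (\<lambda>d. d *s (c *s x))" if "c \<noteq> 0" for d
    using that by (intro image_eqI[of _ _ "d / c"]) (simp_all add: vector_smult_assoc)
  then show "c \<noteq> 0 \<Longrightarrow> line (c *s x) = line x"
    by (auto simp: line_def vector_smult_assoc)
qed

lemma line_self: "x \<in> line x"
  unfolding line_def by (intro image_eqI[of _ _ 1]) simp_all

lemma line_eqD:
  assumes "line x = line y" "y \<noteq> 0"
  obtains c where "c \<noteq> 0" "y = c *s x"
proof -
  have "y \<in> line x" using assms(1) line_self by blast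
  then obtain c where "y = c *s x" by (auto simp: line_def)
  then show thesis using that assms(2) by (cases "c = 0") auto
qed

lemma local_hol_affine_space: "local_hol (affine_space :: (complex ^ 'n) cspace)"
proof (rule local_holI)
  fix U and h :: "complex ^ 'n \<Rightarrow> complex"
  assume U: "openin (ctop affine_space) U" and h: "h \<in> hol (csubspace affine_space (points affine_space)) U"
  have "open U" using U by simp
  from hol_punctured_space[OF this] h show "h \<in> hol affine_space U" by (simp add: hol_affine_space)
qed

lemma local_hol_proj_space: "local_hol proj_space"
  unfolding proj_space_def by (intro local_hol_cquotient local_hol_csubspace local_hol_affine_space)

lemma points_proj_space: "points proj_space = line ` (- {0})"
  by (simp add: proj_space_def)

lemma openin_proj_space:
  "openin (ctop proj_space) V \<longleftrightarrow> V \<subseteq> line ` (- {0}) \<and> open {x. x \<noteq> 0 \<and> line x \<in> V}"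
proof -
  have "{p \<in> - {0}. line p \<in> V} = {x. x \<noteq> 0 \<and> line x \<in> V}" by auto
  moreover have "openin (top_of_set (- {0})) {x. x \<noteq> 0 \<and> line x \<in> V} \<longleftrightarrow> open {x. x \<noteq> 0 \<and> line x \<in> V}"
    using openin_open_eq[of "- {0}" "{x. x \<noteq> 0 \<and> line x \<in> V}"] by auto
  ultimately show ?thesis
    by (simp add: proj_space_def openin_cquotient)
qed

lemma hol_proj_space:
  assumes "openin (ctop proj_space) V"
  shows "h \<in> hol proj_space V \<longleftrightarrow> (\<forall>x. x \<noteq> 0 \<and> line x \<in> V \<longrightarrow> chol (\<lambda>x. h (line x)) x)"
proof -
  have o: "open {x. x \<noteq> 0 \<and> line x \<in> V}" using assms by (simp add: openin_proj_space)
  have "{p \<in> points (csubspace affine_space (- {0})). line p \<in> V} = {x. x \<noteq> 0 \<and> line x \<in> V}"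
    by (auto simp: affine_space_def)
  then show ?thesis
    unfolding proj_space_def hol_cquotient using hol_punctured_space[OF o, of "h \<circ> line" "- {0}"]
    by (simp add: comp_def)
qed

lemma openin_cone:
  fixes T :: "(complex ^ 'n) set"
  assumes "open T" "0 \<notin> T" "\<And>c x. c \<noteq> 0 \<Longrightarrow> x \<in> T \<Longrightarrow> c *s x \<in> T"
  shows "openin (ctop proj_space) (line ` T)"
    and "x \<noteq> 0 \<Longrightarrow> line x \<in> line ` T \<longleftrightarrow> x \<in> T"
proof -
  have *: "line x \<in> line ` T \<longleftrightarrow> x \<in> T" if nz: "x \<noteq> 0" for x :: "complex ^ 'n"
  proof
    assume "line x \<in> line ` T"
    then obtain y where y: "y \<in> T" "line x = line y" by blast
    obtain c where "c \<noteq> 0" "x = c *s y" using line_eqD[OF y(2)[symmetric] nz] .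
    then show "x \<in> T" using assms(3) y by simp
  qed simp
  have "{x. x \<noteq> 0 \<and> line x \<in> line ` T} = T" using * assms(2) by auto
  then show "openin (ctop proj_space) (line ` T)"
    using assms by (auto simp: openin_proj_space)
  show "x \<noteq> 0 \<Longrightarrow> line x \<in> line ` T \<longleftrightarrow> x \<in> T" by (rule *)
qed

text \<open>The chosen representative is harmless only when \<open>F\<close> is invariant under
  scaling, which is the hypothesis of \<open>lift_line\<close>.\<close>

definition lift :: "(complex ^ 'n \<Rightarrow> 'b) \<Rightarrow> (complex ^ 'n) set \<Rightarrow> 'b" where
  "lift F P = F (SOME x. x \<noteq> 0 \<and> line x = P)"

lemma lift_line:
  assumes "\<And>c x. c \<noteq> 0 \<Longrightarrow> x \<noteq> 0 \<Longrightarrow> F (c *s x) = F x" "x \<noteq> 0"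
  shows "lift F (line x) = F x"
proof -
  define y where "y = (SOME y. y \<noteq> 0 \<and> line y = line x)"
  have "y \<noteq> 0 \<and> line y = line x" unfolding y_def by (rule someI[of _ x]) (simp add: assms(2))
  then obtain c where "c \<noteq> 0" "y = c *s x" using line_eqD[of x y] by metis
  then show ?thesis using assms unfolding lift_def y_def[symmetric] by simp
qed

section \<open>The projective line\<close>

text \<open>The point \<open>[a : b]\<close> in homogeneous coordinates. For
  \<open>a = b = 0\<close> the value is the zero line, which is not a point of \<open>CP1\<close>;
  hence the nonvanishing conditions in most lemmas about \<open>hc\<close>.\<close>

definition hc :: "complex \<Rightarrow> complex \<Rightarrow> cp1" where
  "hc a b = line (vector [a, b])"

lemma vector2_eq_0 [simp]: "(vector [a, b] :: complex ^ 2) = 0 \<longleftrightarrow> a = 0 \<and> b = 0"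
  by (simp add: vec_eq_iff forall_2)

lemma vector2_eta: "vector [x $ 1, x $ 2] = (x :: complex ^ 2)"
  by (simp add: vec_eq_iff forall_2)

lemma smult_vector2: "c *s (vector [a, b] :: complex ^ 2) = vector [c * a, c * b]"
  by (simp add: vec_eq_iff forall_2)

lemma line_hc: "line (x :: complex ^ 2) = hc (x $ 1) (x $ 2)"
  by (simp add: hc_def vector2_eta)

lemma hc_scale: "c \<noteq> 0 \<Longrightarrow> hc (c * a) (c * b) = hc a b"
  using line_scale[of c "vector [a, b] :: complex ^ 2"] by (simp add: hc_def smult_vector2)

lemma fin_hc: "fin z = hc z 1" and infty_hc: "infty = hc 1 0"
  by (simp_all add: fin_def infty_def hc_def)

lemma hc_fin: "b \<noteq> 0 \<Longrightarrow> hc a b = fin (a / b)"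
  using hc_scale[of b "a / b" 1] by (simp add: fin_hc)

lemma hc_infty: "a \<noteq> 0 \<Longrightarrow> hc a 0 = infty"
  using hc_scale[of a 1 0] by (simp add: infty_hc)

lemma hc_eq_iff:
  assumes "a \<noteq> 0 \<or> b \<noteq> 0" "c \<noteq> 0 \<or> d \<noteq> 0"
  shows "hc a b = hc c d \<longleftrightarrow> a * d = b * c"
proof
  assume "hc a b = hc c d"
  then obtain k where "k \<noteq> 0" "(vector [c, d] :: complex ^ 2) = k *s vector [a, b]"
    using line_eqD[of "vector [a, b] :: complex ^ 2" "vector [c, d]"] assms unfolding hc_def by auto
  then have "c = k * a" "d = k * b" by (simp_all add: smult_vector2 vec_eq_iff forall_2)
  then show "a * d = b * c" by simp
next
  assume e: "a * d = b * c"
  show "hc a b = hc c d"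
  proof (cases "a = 0")
    case True
    then have "b \<noteq> 0" "c = 0" "d \<noteq> 0" using e assms by auto
    then show ?thesis using hc_scale[of "b / d" 0 d] True by simp
  next
    case False
    then have "c \<noteq> 0" using e assms by auto
    then show ?thesis using hc_scale[of "a / c" c d] False e by (simp add: field_simps)
  qed
qed

lemma fin_inject [simp]: "fin z = fin w \<longleftrightarrow> z = w"
  by (simp add: fin_hc hc_eq_iff)

lemma fin_neq_infty [simp]: "fin z \<noteq> infty" "infty \<noteq> fin z"
  by (simp_all add: fin_hc infty_hc hc_eq_iff)

lemma hc_in_CP1 [simp]: "a \<noteq> 0 \<or> b \<noteq> 0 \<Longrightarrow> hc a b \<in> points CP1"
  unfolding points_proj_space hc_def by (intro image_eqI[of _ _ "vector [a, b]"]) auto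

lemma fin_in_CP1 [simp]: "fin z \<in> points CP1" and infty_in_CP1 [simp]: "infty \<in> points CP1"
  by (simp_all add: fin_hc infty_hc)

lemma CP1_hcE:
  assumes "P \<in> points CP1"
  obtains a b where "a \<noteq> 0 \<or> b \<noteq> 0" "P = hc a b"
proof -
  obtain x where x: "x \<noteq> 0" "P = line (x :: complex ^ 2)"
    using assms by (auto simp: points_proj_space)
  then have "x $ 1 \<noteq> 0 \<or> x $ 2 \<noteq> 0" by (auto simp: vec_eq_iff forall_2)
  then show thesis using that x line_hc by blast
qed

lemma CP1_cases:
  assumes "P \<in> points CP1"
  obtains z where "P = fin z" | "P = infty"
  using assms by (metis CP1_hcE hc_fin hc_infty)

lemma CP1_eq: "points CP1 = insert infty (range fin)"
  by (auto elim: CP1_cases)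

lemma continuous_vector2: "continuous_on S f \<Longrightarrow> continuous_on S g \<Longrightarrow>
    continuous_on S (\<lambda>x. vector [f x, g x] :: complex ^ 2)"
proof -
  assume fg: "continuous_on S f" "continuous_on S g"
  have "(\<lambda>x. vector [f x, g x] :: complex ^ 2) = (\<lambda>x. \<chi> i. if i = 1 then f x else g x)"
    by (simp add: fun_eq_iff vec_eq_iff forall_2)
  then show ?thesis
    by (simp only:) (rule continuous_on_vec_lambda, case_tac "i = 1", use fg in simp_all)
qed

lemma openin_hc:
  assumes V: "openin (ctop CP1) V" and "continuous_on UNIV f" "continuous_on UNIV g"
  shows "open {x. (f x \<noteq> 0 \<or> g x \<noteq> 0) \<and> hc (f x) (g x) \<in> V}"
proof -
  have "open {x :: complex ^ 2. x \<noteq> 0 \<and> line x \<in> V}" using V by (simp add: openin_proj_space)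
  then have "open ((\<lambda>x. vector [f x, g x]) -` {x :: complex ^ 2. x \<noteq> 0 \<and> line x \<in> V})"
    by (intro open_vimage continuous_vector2 assms)
  then show ?thesis by (simp add: vimage_def hc_def)
qed

lemma openin_CP1_fin: "openin (ctop CP1) V \<Longrightarrow> open {z. fin z \<in> V}"
  and openin_CP1_infty: "openin (ctop CP1) V \<Longrightarrow> open {z. hc 1 z \<in> V}"
  using openin_hc[of V "\<lambda>z. z" "\<lambda>z. 1"] openin_hc[of V "\<lambda>z. 1" "\<lambda>z. z"] by (simp_all add: fin_hc)

text \<open>In one of the two affine charts the set has a nonempty open trace, and the plane has no
  finite nonempty open sets. It serves as the density statement: a nonempty open set cannot hide
  inside a finite exceptional set.\<close>

lemma openin_CP1_infinite:
  assumes "openin (ctop CP1) V" "V \<noteq> {}"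
  shows "infinite V"
proof
  assume "finite V"
  obtain P where P: "P \<in> V" using assms by blast
  have "finite {z. fin z \<in> V}"
    using finite_vimageI[OF \<open>finite V\<close>, of fin] by (simp add: inj_on_def vimage_def)
  then have 1: "{z. fin z \<in> V} = {}" using openin_CP1_fin[OF assms(1)] finite_imp_not_open by blast
  have "inj (hc 1)" by (rule injI) (simp add: hc_eq_iff)
  then have "finite {z. hc 1 z \<in> V}"
    using finite_vimageI[OF \<open>finite V\<close>, of "hc 1"] by (simp add: vimage_def)
  then have 2: "{z. hc 1 z \<in> V} = {}" using openin_CP1_infty[OF assms(1)] finite_imp_not_open by blast
  have "P \<in> points CP1" using P openin_subset[OF assms(1)] by auto
  then show False using P 1 2 by (cases rule: CP1_cases) (auto simp: infty_hc)
qed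

text \<open>Off \<open>x $ 2 = 0\<close> a function of lines depends on
  \<open>x $ 1 / x $ 2\<close>, and off \<open>x $ 1 = 0\<close> on \<open>x $ 2 / x $ 1\<close>.
  Holomorphy thus becomes a statement about functions of one variable, for which removable
  singularities are available.\<close>

lemma hol_CP1:
  assumes V: "openin (ctop CP1) V"
  shows "h \<in> hol CP1 V \<longleftrightarrow>
    (\<forall>z. fin z \<in> V \<longrightarrow> (\<lambda>z. h (fin z)) field_differentiable (at z)) \<and>
    (\<forall>z. hc 1 z \<in> V \<longrightarrow> (\<lambda>z. h (hc 1 z)) field_differentiable (at z))" (is "_ \<longleftrightarrow> ?R")
proof
  assume "h \<in> hol CP1 V"
  then have h: "chol (\<lambda>x. h (line x)) x" if "x \<noteq> 0" "line x \<in> V" for x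
    using that hol_proj_space[OF V] by blast
  have d1: "(\<lambda>z. (vector [z, 1] :: complex ^ 2) $ i) field_differentiable (at z)" for i z
    using exhaust_2[of i] by (auto intro: field_differentiable_ident)
  have d2: "(\<lambda>z. (vector [1, z] :: complex ^ 2) $ i) field_differentiable (at z)" for i z
    using exhaust_2[of i] by (auto intro: field_differentiable_ident)
  show ?R
  proof (intro conjI allI impI)
    fix z assume "fin z \<in> V"
    then have "chol (\<lambda>x. h (line x)) (vector [z, 1])" by (intro h) (simp_all add: fin_def)
    from chol_curve[OF this d1] show "(\<lambda>z. h (fin z)) field_differentiable (at z)"
      by (simp add: fin_def)
  next
    fix z assume "hc 1 z \<in> V"
    then have "chol (\<lambda>x. h (line x)) (vector [1, z])" by (intro h) (simp_all add: hc_def)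
    from chol_curve[OF this d2] show "(\<lambda>z. h (hc 1 z)) field_differentiable (at z)"
      by (simp add: hc_def)
  qed
next
  assume R: ?R
  show "h \<in> hol CP1 V"
    unfolding hol_proj_space[OF V]
  proof (intro allI impI)
    fix x :: "complex ^ 2" assume x: "x \<noteq> 0 \<and> line x \<in> V"
    show "chol (\<lambda>x. h (line x)) x"
    proof (cases "x $ 2 = 0")
      case False
      have f: "line y = fin (y $ 1 / y $ 2)" if "y $ 2 \<noteq> 0" for y :: "complex ^ 2"
        using that by (simp add: line_hc hc_fin)
      have "chol (\<lambda>y. h (fin (y $ 1 / y $ 2))) x"
        by (rule chol_compose_field[of "\<lambda>z. h (fin z)"])
          (use R x f False in \<open>auto intro!: chol_divide\<close>)
      moreover have "open {y :: complex ^ 2. y $ 2 \<noteq> 0}"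
        by (intro open_Collect_neq continuous_intros)
      ultimately show ?thesis
        by (rule chol_transform) (use False f in auto)
    next
      case True
      then have nz: "x $ 1 \<noteq> 0" using x by (auto simp: vec_eq_iff forall_2)
      have f: "line y = hc 1 (y $ 2 / y $ 1)" if "y $ 1 \<noteq> 0" for y :: "complex ^ 2"
        using that hc_scale[of "y $ 1" 1 "y $ 2 / y $ 1"] by (simp add: line_hc)
      have "chol (\<lambda>y. h (hc 1 (y $ 2 / y $ 1))) x"
        by (rule chol_compose_field[of "\<lambda>z. h (hc 1 z)"])
          (use R x f nz in \<open>auto intro!: chol_divide\<close>)
      moreover have "open {y :: complex ^ 2. y $ 1 \<noteq> 0}"
        by (intro open_Collect_neq continuous_intros)
      ultimately show ?thesis
        by (rule chol_transform) (use nz f in auto)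
    qed
  qed
qed

section \<open>Compactness, connectedness and separation of the projective line\<close>

lemma continuous_map_line: "continuous_map (top_of_set (- {0})) (ctop proj_space) line"
  unfolding continuous_map_def
proof (intro conjI allI impI)
  show "line \<in> topspace (top_of_set (- {0})) \<rightarrow> points proj_space"
    by (auto simp: points_proj_space)
  fix V :: "(complex ^ 'a) set set" assume V: "openin (ctop proj_space) V"
  have "{x \<in> topspace (top_of_set (- {0})). line x \<in> V} = {x. x \<noteq> 0 \<and> line x \<in> V}" by auto
  then show "openin (top_of_set (- {0})) {x \<in> topspace (top_of_set (- {0})). line x \<in> V}"
    using V openin_open_eq[of "- {0 :: complex ^ 'a}" "{x. x \<noteq> 0 \<and> line x \<in> V}"] by (auto simp: openin_proj_space)
qed

lemma compactin_line:
  assumes "compact K" "0 \<notin> K"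
  shows "compactin (ctop proj_space) (line ` K)"
  by (rule image_compactin[OF _ continuous_map_line]) (use assms in \<open>auto simp: compactin_subtopology\<close>)

lemma norm_smult_real: "norm (complex_of_real r *s (x :: complex ^ 'n)) = \<bar>r\<bar> * norm x"
proof -
  have "complex_of_real r *s x = r *\<^sub>R x"
    unfolding vec_eq_iff vector_scaleR_component vector_smult_component
    by (simp add: scaleR_conv_of_real)
  then show ?thesis by simp
qed

lemma line_image_sphere:
  assumes "0 \<notin> S" "\<And>c x. c \<noteq> 0 \<Longrightarrow> x \<in> S \<Longrightarrow> c *s x \<in> S"
  shows "line ` S = line ` (S \<inter> sphere 0 1)"
proof (intro equalityI subsetI)
  fix P assume "P \<in> line ` S"
  then obtain x where x: "x \<in> S" "P = line x" by blast
  then have "x \<noteq> 0" using assms by auto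
  then have "complex_of_real (1 / norm x) *s x \<in> S \<inter> sphere 0 1" "line (complex_of_real (1 / norm x) *s x) = P"
    using x norm_smult_real[of "1 / norm x" x] by (simp_all add: assms line_scale)
  then show "P \<in> line ` (S \<inter> sphere 0 1)" by (metis image_eqI)
qed auto

lemma compact_space_CP1: "compact_space (ctop CP1)"
proof -
  have "line ` (- {0}) = line ` (- {0} \<inter> sphere (0 :: complex ^ 2) 1)"
    by (rule line_image_sphere) auto
  moreover have "- {0} \<inter> sphere (0 :: complex ^ 2) 1 = sphere 0 1" by auto
  ultimately have "points CP1 = line ` sphere (0 :: complex ^ 2) 1" by (simp add: points_proj_space)
  then show ?thesis unfolding compact_space_def using compactin_line[of "sphere (0 :: complex ^ 2) 1"] by simp
qed

lemma connected_space_CP1: "connected_space (ctop CP1)"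
proof -
  have "connected (- {0 :: complex ^ 2})" by (rule connected_punctured_universe) simp
  then have "connectedin (top_of_set (- {0 :: complex ^ 2})) (- {0})"
    by (simp add: connectedin_subtopology)
  from connectedin_continuous_map_image[OF continuous_map_line this] show ?thesis
    by (simp add: connectedin_topspace[symmetric] points_proj_space[symmetric])
qed

text \<open>A continuous injection into a Hausdorff space suffices. The components of
  \<open>F\<close> are two entries of the matrix of the orthogonal projection onto the line; on
  \<open>fin z\<close> they are the inverse stereographic projection onto a sphere of diameter
  1.\<close>

lemma Hausdorff_space_CP1: "Hausdorff_space (ctop CP1)"
proof (rule Hausdorff_space_injective_preimage)
  define F :: "complex ^ 2 \<Rightarrow> complex \<times> real" where
    "F = (\<lambda>x. (x $ 1 * cnj (x $ 2) / of_real ((cmod (x $ 1))\<^sup>2 + (cmod (x $ 2))\<^sup>2),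
              (cmod (x $ 1))\<^sup>2 / ((cmod (x $ 1))\<^sup>2 + (cmod (x $ 2))\<^sup>2)))"
  have F: "F (c *s x) = F x" if "c \<noteq> 0" for c x
  proof -
    have "c * x $ 1 * (cnj c * cnj (x $ 2)) = of_real ((cmod c)\<^sup>2) * (x $ 1 * cnj (x $ 2))"
      by (simp only: complex_norm_square mult_ac)
    then have "c * x $ 1 * (cnj c * cnj (x $ 2)) / (of_real ((cmod c)\<^sup>2 * (cmod (x $ 1))\<^sup>2 + (cmod c)\<^sup>2 * (cmod (x $ 2))\<^sup>2)) =
        (of_real ((cmod c)\<^sup>2) * (x $ 1 * cnj (x $ 2))) / (of_real ((cmod c)\<^sup>2) * of_real ((cmod (x $ 1))\<^sup>2 + (cmod (x $ 2))\<^sup>2))"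
      by (simp only: distrib_left[symmetric] of_real_mult)
    also have "\<dots> = x $ 1 * cnj (x $ 2) / of_real ((cmod (x $ 1))\<^sup>2 + (cmod (x $ 2))\<^sup>2)"
      using that by (intro mult_divide_mult_cancel_left) simp
    moreover have "(cmod c)\<^sup>2 * (cmod (x $ 1))\<^sup>2 / ((cmod c)\<^sup>2 * (cmod (x $ 1))\<^sup>2 + (cmod c)\<^sup>2 * (cmod (x $ 2))\<^sup>2)
        = (cmod (x $ 1))\<^sup>2 / ((cmod (x $ 1))\<^sup>2 + (cmod (x $ 2))\<^sup>2)"
      using that by (simp add: distrib_left[symmetric])
    ultimately show ?thesis by (simp add: F_def norm_mult power_mult_distrib)
  qed
  have nz: "(cmod (x $ 1))\<^sup>2 + (cmod (x $ 2))\<^sup>2 \<noteq> 0" if "x \<noteq> 0" for x :: "complex ^ 2"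
    using that by (simp add: sum_power2_eq_zero_iff vec_eq_iff forall_2)
  show "Hausdorff_space (euclidean :: (complex \<times> real) topology)" by simp
  show "continuous_map (ctop CP1) euclidean (lift F)"
    unfolding continuous_map_def
  proof (intro conjI allI impI)
    fix O1 :: "(complex \<times> real) set" assume "openin euclidean O1"
    then have O1: "open O1" by simp
    have c: "continuous_on (- {0}) F"
      unfolding F_def by (intro continuous_intros) (use nz in \<open>auto simp del: of_real_add\<close>)
    have "{x. x \<noteq> 0 \<and> line x \<in> {P \<in> points CP1. lift F P \<in> O1}} = F -` O1 \<inter> (- {0})"
      using lift_line[of F] F by (auto simp: points_proj_space)
    moreover have "open (F -` O1 \<inter> (- {0}))"
      by (rule continuous_open_preimage[OF c _ O1, simplified Int_commute]) auto
    ultimately show "openin (ctop CP1) {P \<in> points CP1. lift F P \<in> O1}"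
      unfolding openin_proj_space by (auto simp: points_proj_space)
  qed simp
  have lf: "lift F (fin z) = (z / of_real ((cmod z)\<^sup>2 + 1), (cmod z)\<^sup>2 / ((cmod z)\<^sup>2 + 1))" for z
    using lift_line[of F "vector [z, 1]"] F by (simp add: fin_def F_def)
  have li: "lift F infty = (0, 1)"
    using lift_line[of F "vector [1, 0]"] F by (simp add: infty_def F_def)
  have sq: "(cmod z)\<^sup>2 + 1 > 0" for z by (simp add: add_nonneg_pos)
  have nf: "lift F (fin z) \<noteq> lift F infty" for z
    using sq[of z] by (simp add: lf li field_simps)
  have ff: "z = w" if "lift F (fin z) = lift F (fin w)" for z w
  proof -
    have "(cmod z)\<^sup>2 / ((cmod z)\<^sup>2 + 1) = (cmod w)\<^sup>2 / ((cmod w)\<^sup>2 + 1)" using that by (simp add: lf)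
    then have "(cmod z)\<^sup>2 = (cmod w)\<^sup>2" using sq[of z] sq[of w] by (simp add: field_simps)
    moreover have "z / of_real ((cmod z)\<^sup>2 + 1) = w / of_real ((cmod w)\<^sup>2 + 1)" using that by (simp add: lf)
    ultimately show ?thesis using sq[of w] by (simp del: of_real_add of_real_power) 
  qed
  show "inj_on (lift F) (points CP1)"
    using nf nf[symmetric] ff unfolding CP1_eq by (auto simp: inj_on_def)
qed

section \<open>Maps given by pairs of forms\<close>

definition hom_pair :: "nat \<Rightarrow> (complex ^ 'n \<Rightarrow> complex) \<Rightarrow> (complex ^ 'n \<Rightarrow> complex) \<Rightarrow> bool" where
  "hom_pair d F0 F1 \<longleftrightarrow> (\<forall>x. chol F0 x \<and> chol F1 x) \<and>
     (\<forall>c x. F0 (c *s x) = c ^ d * F0 x \<and> F1 (c *s x) = c ^ d * F1 x)"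

lemma holo_map_hom_pairs_local:
  fixes S :: "(complex ^ 'n) set"
  assumes S: "0 \<notin> S" and F: "hom_pair d F0 F1"
    and f: "\<forall>y\<in>S. F0 y \<noteq> 0 \<or> F1 y \<noteq> 0 \<longrightarrow> f (line y) = hc (F0 y) (F1 y)"
    and x: "x \<in> S" "F0 x \<noteq> 0 \<or> F1 x \<noteq> 0" "f (line x) \<in> W" and W: "openin (ctop CP1) W"
  shows "\<exists>V. openin (ctop proj_space) V \<and> line x \<in> V \<and>
     (\<forall>y\<in>S. line y \<in> V \<longrightarrow> f (line y) \<in> W) \<and>
     (\<forall>h\<in>hol CP1 W. \<exists>k\<in>hol proj_space V. \<forall>y\<in>S. line y \<in> V \<longrightarrow> h (f (line y)) = k (line y))"
proof -
  have hom: "F0 (c *s x) = c ^ d * F0 x" "F1 (c *s x) = c ^ d * F1 x" for c x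
    using F by (auto simp: hom_pair_def)
  have ch: "chol F0 x" "chol F1 x" for x
    using F by (auto simp: hom_pair_def)
  have inv: "hc (F0 (c *s x)) (F1 (c *s x)) = hc (F0 x) (F1 x)" if "c \<noteq> 0" for c x
    using that hc_scale[of "c ^ d"] by (simp add: hom)
  \<comment> \<open>The cone on which the pair is not \<open>0/0\<close> and has its value in
    \<open>W\<close>. It is open in the ambient space, so it supplies both the neighbourhood and the
    domain of the ambient extension \<open>k\<close> that \<open>csubspace\<close> asks for.\<close>
  define T where "T = {y. y \<noteq> 0 \<and> (F0 y \<noteq> 0 \<or> F1 y \<noteq> 0) \<and> hc (F0 y) (F1 y) \<in> W}"
  have "T = - {0} \<inter> {y. (F0 y \<noteq> 0 \<or> F1 y \<noteq> 0) \<and> hc (F0 y) (F1 y) \<in> W}" by (auto simp: T_def)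
  moreover have "open {y. (F0 y \<noteq> 0 \<or> F1 y \<noteq> 0) \<and> hc (F0 y) (F1 y) \<in> W}"
    by (intro openin_hc[OF W] chol_continuous_on ch)
  ultimately have oT: "open T" by auto
  have cT: "c *s y \<in> T" if "c \<noteq> 0" "y \<in> T" for c y
    using that inv by (auto simp: T_def hom)
  have zT: "0 \<notin> T" by (simp add: T_def)
  have cone1: "openin (ctop proj_space) (line ` T)"
    by (rule openin_cone(1)[OF oT zT]) (rule cT)
  have cone2: "line y \<in> line ` T \<longleftrightarrow> y \<in> T" if "y \<noteq> 0" for y
    by (rule openin_cone(2)[OF oT zT _ that]) (rule cT)
  have fT: "f (line y) = hc (F0 y) (F1 y)" if "y \<in> T" "y \<in> S" for y
    using f that by (auto simp: T_def)
  have Snz: "y \<noteq> 0" if "y \<in> S" for y using S that by auto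
  have ST: "y \<in> S \<Longrightarrow> line y \<in> line ` T \<longleftrightarrow> y \<in> T" for y using cone2 Snz by simp
  have xT: "x \<in> T" using x f Snz by (auto simp: T_def)
  have k: "\<exists>k\<in>hol proj_space (line ` T). \<forall>y\<in>S. line y \<in> line ` T \<longrightarrow> h (f (line y)) = k (line y)"
    if h: "h \<in> hol CP1 W" for h
  proof -
    define k where "k = lift (\<lambda>y. h (hc (F0 y) (F1 y)))"
    have kl: "k (line y) = h (hc (F0 y) (F1 y))" if "y \<noteq> 0" for y
      unfolding k_def by (rule lift_line) (use that inv in auto)
    have "k \<in> hol proj_space (line ` T)"
      unfolding hol_proj_space[OF cone1]
    proof (intro allI impI)
      fix y assume y: "y \<noteq> 0 \<and> line y \<in> line ` T"
      then have yT: "y \<in> T" using cone2[of y] by blast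
      have c1: "chol (\<lambda>x. (vector [F0 x, F1 x] :: complex ^ 2) $ i) y" for i :: 2
        using exhaust_2[of i] ch by auto
      have "chol (\<lambda>x. h (line x)) (vector [F0 y, F1 y] :: complex ^ 2)"
        using h yT unfolding hol_proj_space[OF W] by (auto simp: T_def hc_def)
      from chol_compose[OF this c1] have "chol (\<lambda>x. h (hc (F0 x) (F1 x))) y"
        by (simp add: hc_def)
      then show "chol (\<lambda>x. k (line x)) y"
      proof (rule chol_transform[OF _ oT yT])
        fix y assume "y \<in> T"
        then have "y \<noteq> 0" using zT by blast
        then show "h (hc (F0 y) (F1 y)) = k (line y)" by (rule kl[symmetric])
      qed
    qed
    moreover have "\<forall>y\<in>S. line y \<in> line ` T \<longrightarrow> h (f (line y)) = k (line y)"
      using fT ST kl Snz by simp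
    ultimately show ?thesis by blast
  qed
  show ?thesis
  proof (intro exI[of _ "line ` T"] conjI)
    show "openin (ctop proj_space) (line ` T)" by (rule cone1)
    show "line x \<in> line ` T" using xT by blast
    show "\<forall>y\<in>S. line y \<in> line ` T \<longrightarrow> f (line y) \<in> W" using ST fT by (auto simp: T_def)
  qed (use k in blast)
qed

text \<open>Each pair describes \<open>f\<close> only off its common zeros in \<open>S\<close>, and
  every single pair used later for \<open>phi\<close> has such zeros. So the pair may depend on the
  point, as long as all pairs describe the same \<open>f\<close>.\<close>

lemma holo_map_hom_pairs:
  fixes S :: "(complex ^ 'n) set"
  assumes S: "0 \<notin> S"
    and f: "\<And>x. x \<in> S \<Longrightarrow> \<exists>d F0 F1. hom_pair d F0 F1 \<and> (F0 x \<noteq> 0 \<or> F1 x \<noteq> 0) \<and>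
         (\<forall>y\<in>S. F0 y \<noteq> 0 \<or> F1 y \<noteq> 0 \<longrightarrow> f (line y) = hc (F0 y) (F1 y))"
  shows "holo_map (csubspace proj_space (line ` S)) CP1 f"
proof -
  let ?C = "csubspace proj_space (line ` S)"
  have pC: "points ?C = line ` S"
    using S by (auto simp: points_proj_space)
  have loc: "\<exists>V. openin (ctop proj_space) V \<and> line x \<in> V \<and>
     (\<forall>y\<in>S. line y \<in> V \<longrightarrow> f (line y) \<in> W) \<and>
     (\<forall>h\<in>hol CP1 W. \<exists>k\<in>hol proj_space V. \<forall>y\<in>S. line y \<in> V \<longrightarrow> h (f (line y)) = k (line y))"
    if x: "x \<in> S" "f (line x) \<in> W" and W: "openin (ctop CP1) W" for x W
  proof -
    obtain d F0 F1 where F: "hom_pair d F0 F1" "F0 x \<noteq> 0 \<or> F1 x \<noteq> 0"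
      "\<forall>y\<in>S. F0 y \<noteq> 0 \<or> F1 y \<noteq> 0 \<longrightarrow> f (line y) = hc (F0 y) (F1 y)"
      using f[OF x(1)] by (elim exE conjE)
    show ?thesis by (rule holo_map_hom_pairs_local[OF S F(1,3) x(1) F(2) x(2) W])
  qed
  show ?thesis
    unfolding holo_map_def
  proof (intro conjI allI impI ballI)
    show "continuous_map (ctop ?C) (ctop CP1) f"
      unfolding continuous_map_def
    proof (intro conjI allI impI)
      show "f \<in> points ?C \<rightarrow> points CP1"
      proof
        fix P assume "P \<in> points ?C"
        then obtain x where x: "x \<in> S" "P = line x" using pC by auto
        obtain d F0 F1 where "F0 x \<noteq> 0 \<or> F1 x \<noteq> 0" "f (line x) = hc (F0 x) (F1 x)"
          using f[OF x(1)] x(1) by blast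
        then show "f P \<in> points CP1" using x by simp
      qed
      fix W assume W: "openin (ctop CP1) W"
      show "openin (ctop ?C) {P \<in> points ?C. f P \<in> W}"
      proof (subst openin_subopen, intro ballI)
        fix P assume P: "P \<in> {P \<in> points ?C. f P \<in> W}"
        then obtain x where x: "x \<in> S" "P = line x" using pC by auto
        then have fx: "f (line x) \<in> W" using P by simp
        obtain V where V: "openin (ctop proj_space) V" "line x \<in> V" "\<forall>y\<in>S. line y \<in> V \<longrightarrow> f (line y) \<in> W"
          using loc[OF x(1) fx W] by (elim exE conjE)
        have "openin (ctop ?C) (V \<inter> line ` S)" using V(1) by (auto simp: openin_subtopology)
        moreover have "V \<inter> line ` S \<subseteq> {P \<in> points ?C. f P \<in> W}" using V pC by auto
        ultimately show "\<exists>U. openin (ctop ?C) U \<and> P \<in> U \<and> U \<subseteq> {P \<in> points ?C. f P \<in> W}"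
          using V(2) x by blast
      qed
    qed
    fix W h assume W: "openin (ctop CP1) W" and h: "h \<in> hol CP1 W"
    show "h \<circ> f \<in> hol ?C {P \<in> points ?C. f P \<in> W}"
      unfolding hol_csubspace
    proof
      fix P assume P: "P \<in> {P \<in> points ?C. f P \<in> W}"
      then obtain x where x: "x \<in> S" "P = line x" using pC by auto
      then have fx: "f (line x) \<in> W" using P by simp
      obtain V k where V: "openin (ctop proj_space) V" "line x \<in> V" "k \<in> hol proj_space V"
        "\<forall>y\<in>S. line y \<in> V \<longrightarrow> h (f (line y)) = k (line y)"
        using loc[OF x(1) fx W] h by blast
      have "\<forall>Q\<in>{P \<in> points ?C. f P \<in> W} \<inter> V. (h \<circ> f) Q = k Q" using V(4) pC by auto
      then show "\<exists>V. openin (ctop proj_space) V \<and> P \<in> V \<and>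
          (\<exists>k\<in>hol proj_space V. \<forall>Q\<in>{P \<in> points ?C. f P \<in> W} \<inter> V. (h \<circ> f) Q = k Q)"
        using V x by blast
    qed
  qed
qed

lemma holo_map_CP1_hom_pair:
  assumes "hom_pair d F0 F1" "\<And>x. x \<noteq> 0 \<Longrightarrow> F0 x \<noteq> 0 \<or> F1 x \<noteq> 0"
    and "\<And>x. x \<noteq> 0 \<Longrightarrow> f (line x) = hc (F0 x) (F1 x)"
  shows "holo_map proj_space CP1 f"
proof (rule holo_map_csubspace_points[OF local_hol_proj_space], unfold points_proj_space,
    rule holo_map_hom_pairs)
  fix x :: "complex ^ 'a" assume "x \<in> - {0}"
  then show "\<exists>d F0 F1. hom_pair d F0 F1 \<and> (F0 x \<noteq> 0 \<or> F1 x \<noteq> 0) \<and>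
         (\<forall>y\<in>- {0}. F0 y \<noteq> 0 \<or> F1 y \<noteq> 0 \<longrightarrow> f (line y) = hc (F0 y) (F1 y))"
    using assms by (intro exI[of _ d] exI[of _ F0] exI[of _ F1]) simp
qed simp

section \<open>Restriction to curves, dense sets, meromorphic extension\<close>

lemma field_differentiable_transform_open:
  assumes "f field_differentiable (at z)" "open M" "z \<in> M" "\<And>y. y \<in> M \<Longrightarrow> f y = g y"
  shows "g field_differentiable (at z)"
proof -
  obtain d where "(f has_field_derivative d) (at z)"
    using assms(1) by (auto simp: field_differentiable_def)
  from has_field_derivative_transform_within_open[OF this assms(2-4)] show ?thesis
    by (auto simp: field_differentiable_def)
qed

lemma hol_along_curve:
  fixes \<gamma> :: "complex \<Rightarrow> complex ^ 'n"
  assumes S: "0 \<notin> S" and U: "openin (ctop (csubspace proj_space (line ` S))) U"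
    and h: "h \<in> hol (csubspace proj_space (line ` S)) U"
    and N: "open N" "z \<in> N" and d: "\<And>i t. t \<in> N \<Longrightarrow> (\<lambda>t. \<gamma> t $ i) field_differentiable (at t)"
    and g: "\<And>t. t \<in> N \<Longrightarrow> \<gamma> t \<in> S" and zU: "line (\<gamma> z) \<in> U"
  shows "(\<lambda>t. h (line (\<gamma> t))) field_differentiable (at z)"
proof -
  obtain V k where V: "openin (ctop proj_space) V" "line (\<gamma> z) \<in> V" "k \<in> hol proj_space V"
    and e: "\<forall>q\<in>U \<inter> V. h q = k q"
    using hol_csubspaceD[OF h zU] by (elim exE conjE)
  obtain V' where V': "openin (ctop proj_space) V'" "U = V' \<inter> line ` S"
    using U by (auto simp: openin_subtopology)
  have nz: "\<gamma> t \<noteq> 0" if "t \<in> N" for t using g[OF that] S by auto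
  define M where "M = N \<inter> \<gamma> -` {x. x \<noteq> 0 \<and> line x \<in> V \<inter> V'}"
  have "openin (ctop proj_space) (V \<inter> V')" using V V' by blast
  then have o: "open {x. x \<noteq> 0 \<and> line x \<in> V \<inter> V'}" using openin_proj_space by blast
  have "continuous_on N (\<lambda>t. \<gamma> t $ i)" for i
    by (rule continuous_at_imp_continuous_on) (use d field_differentiable_imp_continuous_at in blast)
  then have "continuous_on N (\<lambda>t. \<chi> i. \<gamma> t $ i)" by (intro continuous_on_vec_lambda)
  then have "continuous_on N \<gamma>" by simp
  then have oM: "open M" unfolding M_def using continuous_open_preimage N(1) o by blast
  have zM: "z \<in> M" using N V(2) zU V' nz by (auto simp: M_def)
  have "chol (\<lambda>x. k (line x)) (\<gamma> z)"
    using V nz[OF N(2)] hol_proj_space[OF V(1)] by blast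
  from chol_curve[of "\<lambda>x. k (line x)" \<gamma> z, OF this d[OF N(2)]]
  have kd: "(\<lambda>t. k (line (\<gamma> t))) field_differentiable (at z)" .
  show ?thesis
    by (rule field_differentiable_transform_open[OF kd oM zM]) (use e V' g in \<open>auto simp: M_def\<close>)
qed

lemma continuous_maps_eq_on_dense:
  assumes f: "continuous_map X Y f" and g: "continuous_map X Y g" and Y: "Hausdorff_space Y"
    and D: "\<And>U. openin X U \<Longrightarrow> U \<noteq> {} \<Longrightarrow> \<exists>p\<in>U. f p = g p" and p: "p \<in> topspace X"
  shows "f p = g p"
proof (rule ccontr)
  assume ne: "f p \<noteq> g p"
  have "closedin X {x \<in> topspace X. f x = g x}"
    by (rule closedin_continuous_maps_eq[OF Y f g])
  then have "openin X (topspace X - {x \<in> topspace X. f x = g x})" by blast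
  then show False using D[of "topspace X - {x \<in> topspace X. f x = g x}"] ne p by blast
qed

text \<open>Two extensions are continuous maps into a Hausdorff space that agree on a dense set,
  hence agree on \<open>X\<close>; the clause on \<open>extensional\<close> fixes the values
  elsewhere. Both together make the definite description unique.\<close>

lemma meromorphic_given_by_eqI:
  assumes f: "f \<in> extensional (points X)" "holo_map X CP1 f" and R: "\<forall>(p, w) \<in> R. f p = fin w"
    and D: "\<And>U. openin (ctop X) U \<Longrightarrow> U \<noteq> {} \<Longrightarrow> \<exists>p\<in>U. p \<in> fst ` R"
  shows "meromorphic_given_by X R = f"
  unfolding meromorphic_given_by_def
proof (rule the_equality)
  show "f \<in> extensional (points X) \<and> holo_map X CP1 f \<and> (\<forall>(p, w) \<in> R. f p = fin w)"
    using f R by blast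
  fix g assume g: "g \<in> extensional (points X) \<and> holo_map X CP1 g \<and> (\<forall>(p, w) \<in> R. g p = fin w)"
  show "g = f"
  proof (rule extensionalityI[of _ "points X"])
    fix p assume p: "p \<in> points X"
    show "g p = f p"
    proof (rule continuous_maps_eq_on_dense[OF _ _ Hausdorff_space_CP1 _ p])
      show "continuous_map (ctop X) (ctop CP1) g" "continuous_map (ctop X) (ctop CP1) f"
        using g f holo_map_continuous by blast+
      fix U assume "openin (ctop X) U" "U \<noteq> {}"
      then obtain p w where "p \<in> U" "(p, w) \<in> R" using D by force
      moreover from this have "g p = fin w" "f p = fin w" using g R by auto
      ultimately show "\<exists>p\<in>U. g p = f p" by force
    qed
  qed (use g f in auto)
qed

section \<open>Moebius transformations\<close>

lemma hom_pair_linear: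
  "hom_pair 1 (\<lambda>x :: complex ^ 2. a * x $ 1 + b * x $ 2) (\<lambda>x. c * x $ 1 + d * x $ 2)"
  by (auto simp: hom_pair_def algebra_simps intro!: chol_add chol_mult)

definition moebius :: "complex \<Rightarrow> complex \<Rightarrow> complex \<Rightarrow> complex \<Rightarrow> cp1 \<Rightarrow> cp1" where
  "moebius a b c d = lift (\<lambda>x. hc (a * x $ 1 + b * x $ 2) (c * x $ 1 + d * x $ 2))"

lemma moebius_line:
  assumes "x \<noteq> 0"
  shows "moebius a b c d (line x) = hc (a * x $ 1 + b * x $ 2) (c * x $ 1 + d * x $ 2)"
proof -
  have "hc (a * (k * y $ 1) + b * (k * y $ 2)) (c * (k * y $ 1) + d * (k * y $ 2)) =
      hc (a * y $ 1 + b * y $ 2) (c * y $ 1 + d * y $ 2)" if "k \<noteq> 0" for k and y :: "complex ^ 2"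
    using hc_scale[OF that, of "a * y $ 1 + b * y $ 2" "c * y $ 1 + d * y $ 2"]
    by (simp add: algebra_simps)
  then show ?thesis unfolding moebius_def using assms by (subst lift_line) auto
qed

lemma moebius_hc:
  "u \<noteq> 0 \<or> v \<noteq> 0 \<Longrightarrow> moebius a b c d (hc u v) = hc (a * u + b * v) (c * u + d * v)"
  using moebius_line[of "vector [u, v]" a b c d] by (simp add: hc_def)

lemma linear_det_nonzero:
  fixes a b c d u v :: complex
  assumes "a * d - b * c \<noteq> 0" "u \<noteq> 0 \<or> v \<noteq> 0"
  shows "a * u + b * v \<noteq> 0 \<or> c * u + d * v \<noteq> 0"
proof (rule ccontr)
  assume "\<not> ?thesis"
  then have "a * u + b * v = 0" "c * u + d * v = 0" by auto
  moreover have "(a * d - b * c) * u = d * (a * u + b * v) - b * (c * u + d * v)"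
    and "(a * d - b * c) * v = a * (c * u + d * v) - c * (a * u + b * v)"
    by (simp_all add: algebra_simps)
  ultimately have "(a * d - b * c) * u = 0" "(a * d - b * c) * v = 0" by simp_all
  then show False using assms by simp
qed

lemma holo_map_moebius:
  assumes "a * d - b * c \<noteq> 0"
  shows "holo_map CP1 CP1 (moebius a b c d)"
proof (rule holo_map_CP1_hom_pair[OF hom_pair_linear])
  fix x :: "complex ^ 2" assume x: "x \<noteq> 0"
  show "a * x $ 1 + b * x $ 2 \<noteq> 0 \<or> c * x $ 1 + d * x $ 2 \<noteq> 0"
    by (rule linear_det_nonzero[OF assms]) (use x in \<open>auto simp: vec_eq_iff forall_2\<close>)
  show "moebius a b c d (line x) = hc (a * x $ 1 + b * x $ 2) (c * x $ 1 + d * x $ 2)"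
    by (rule moebius_line[OF x])
qed

lemma biholomorphic_moebius:
  assumes D: "a * d - b * c \<noteq> 0"
  shows "biholomorphic CP1 CP1 (moebius a b c d)"
\<comment> \<open>The adjugate matrix: both composites multiply the homogeneous coordinates by the
  determinant, which \<open>hc_scale\<close> removes.\<close>
proof (rule biholomorphicI[of _ _ _ "moebius d (- b) (- c) a"])
  show "holo_map CP1 CP1 (moebius a b c d)" "holo_map CP1 CP1 (moebius d (- b) (- c) a)"
    using D by (auto intro!: holo_map_moebius simp: algebra_simps)
  fix P assume "P \<in> points CP1"
  then obtain u v where P: "u \<noteq> 0 \<or> v \<noteq> 0" "P = hc u v" by (rule CP1_hcE)
  have 1: "a * u + b * v \<noteq> 0 \<or> c * u + d * v \<noteq> 0" using linear_det_nonzero[OF D P(1)] .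
  have D': "d * a - - b * - c \<noteq> 0" using D by (simp add: algebra_simps)
  have 2: "d * u + - b * v \<noteq> 0 \<or> - c * u + a * v \<noteq> 0" using linear_det_nonzero[OF D' P(1)] .
  have "moebius d (- b) (- c) a (moebius a b c d P) = hc ((a * d - b * c) * u) ((a * d - b * c) * v)"
    using moebius_hc[OF 1, of d "- b" "- c" a] unfolding P(2) moebius_hc[OF P(1)] by (simp add: algebra_simps)
  then show "moebius d (- b) (- c) a (moebius a b c d P) = P" using D P by (simp add: hc_scale)
  have "moebius a b c d (moebius d (- b) (- c) a P) = hc ((a * d - b * c) * u) ((a * d - b * c) * v)"
    using moebius_hc[OF 2, of a b c d] unfolding P(2) moebius_hc[OF P(1)] by (simp add: algebra_simps)
  then show "moebius a b c d (moebius d (- b) (- c) a P) = P" using D P by (simp add: hc_scale)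
qed

lemma local_hol_CP1: "local_hol CP1" by (rule local_hol_proj_space)

section \<open>Charts of the projective line\<close>

lemma openin_range_fin: "openin (ctop CP1) (range fin)"
proof -
  have "{x :: complex ^ 2. x \<noteq> 0 \<and> line x \<in> range fin} = {x. x $ 2 \<noteq> 0}"
  proof (intro Set.set_eqI iffI CollectI conjI)
    fix x :: "complex ^ 2" assume x: "x \<in> {x. x \<noteq> 0 \<and> line x \<in> range fin}"
    then show "x $ 2 \<noteq> 0"
      by (auto simp: line_hc vec_eq_iff forall_2 hc_infty)
  next
    fix x :: "complex ^ 2" assume x: "x \<in> {x. x $ 2 \<noteq> 0}"
    then show "x \<noteq> 0" "line x \<in> range fin" by (auto simp: line_hc hc_fin)
  qed
  moreover have "open {x :: complex ^ 2. x $ 2 \<noteq> 0}" by (intro open_Collect_neq continuous_intros)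
  ultimately show ?thesis unfolding openin_proj_space
    using fin_in_CP1 unfolding points_proj_space by auto
qed

lemma holo_map_fin: "holo_map complex_plane CP1 fin"
  unfolding holo_map_def
proof (intro conjI allI impI ballI)
  show "continuous_map (ctop complex_plane) (ctop CP1) fin"
    using openin_CP1_fin by (auto simp: continuous_map_def complex_plane_def)
  fix V h assume V: "openin (ctop CP1) V" "h \<in> hol CP1 V"
  then show "h \<circ> fin \<in> hol complex_plane {p \<in> points complex_plane. fin p \<in> V}"
    using openin_CP1_fin[OF V(1)] unfolding hol_CP1[OF V(1)]
    by (auto simp: complex_plane_def holomorphic_on_def comp_def
        intro: field_differentiable_at_within)
qed

lemma holo_map_inv_fin: "holo_map (csubspace CP1 (range fin)) complex_plane (inv_into UNIV fin)"
  unfolding holo_map_def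
proof (intro conjI allI impI ballI)
  have inj: "inj fin" by (simp add: inj_def)
  let ?X = "csubspace CP1 (range fin)"
  have pX: "points ?X = range fin" using fin_in_CP1 by auto
  have pre: "{p \<in> points ?X. inv_into UNIV fin p \<in> V} = fin ` V" for V
    unfolding pX using inj by (auto simp: inv_f_f)
  have o: "openin (ctop CP1) (fin ` V)" if "open V" for V
  proof -
    have "{x :: complex ^ 2. x \<noteq> 0 \<and> line x \<in> fin ` V} = {x. x $ 2 \<noteq> 0} \<inter> (\<lambda>x. x $ 1 / x $ 2) -` V"
    proof (intro Set.set_eqI iffI)
      fix x :: "complex ^ 2" assume x: "x \<in> {x. x \<noteq> 0 \<and> line x \<in> fin ` V}"
      then have nz: "x $ 2 \<noteq> 0" by (auto simp: line_hc vec_eq_iff forall_2 hc_infty)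
      then have "line x = fin (x $ 1 / x $ 2)" by (simp add: line_hc hc_fin)
      then show "x \<in> {x. x $ 2 \<noteq> 0} \<inter> (\<lambda>x. x $ 1 / x $ 2) -` V" using x nz by auto
    qed (auto simp: line_hc hc_fin)
    moreover have "open ({x :: complex ^ 2. x $ 2 \<noteq> 0} \<inter> (\<lambda>x. x $ 1 / x $ 2) -` V)"
      by (intro continuous_open_preimage continuous_intros open_Collect_neq that) auto
    moreover have "fin ` V \<subseteq> line ` (- {0})" using fin_in_CP1 unfolding points_proj_space by blast
    ultimately show ?thesis unfolding openin_proj_space by simp
  qed
  show "continuous_map (ctop ?X) (ctop complex_plane) (inv_into UNIV fin)"
    unfolding continuous_map_def
  proof (intro conjI allI impI)
    fix V assume "openin (ctop complex_plane) V"
    then have "openin (ctop CP1) (fin ` V)" by (intro o) (simp add: complex_plane_def)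
    then show "openin (ctop ?X) {p \<in> points ?X. inv_into UNIV fin p \<in> V}"
      unfolding pre using openin_range_fin by (auto simp: openin_open_subtopology)
  qed (simp add: complex_plane_def)
  fix V h assume V: "openin (ctop complex_plane) V" "h \<in> hol complex_plane V"
  then have V': "open V" "h holomorphic_on V" by (auto simp: complex_plane_def)
  have "h \<circ> inv_into UNIV fin \<in> hol CP1 (fin ` V)"
    unfolding hol_CP1[OF o[OF V'(1)]]
  proof (intro conjI allI impI)
    fix z assume "fin z \<in> fin ` V"
    then have "z \<in> V" by auto
    then show "(\<lambda>z. (h \<circ> inv_into UNIV fin) (fin z)) field_differentiable (at z)"
      using V' inj by (simp add: holomorphic_on_imp_differentiable_at)
  next
    fix z assume "hc 1 z \<in> fin ` V"
    then obtain w where w: "w \<in> V" "hc 1 z = fin w" by auto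
    then have nz: "z \<noteq> 0" using hc_infty[of 1] by auto
    then have "1 / z \<in> V" using w by (auto simp: hc_fin)
    then have "h field_differentiable (at (1 / z))"
      using V' holomorphic_on_imp_differentiable_at by blast
    moreover have "(\<lambda>z. 1 / z) field_differentiable (at z)"
      using nz by (intro derivative_intros field_differentiable_divide) auto
    ultimately have "(h \<circ> (\<lambda>z. 1 / z)) field_differentiable (at z)"
      by (intro field_differentiable_compose)
    then show "(\<lambda>z. (h \<circ> inv_into UNIV fin) (hc 1 z)) field_differentiable (at z)"
      by (rule field_differentiable_transform_open[of _ _ "- {0}"])
        (use nz inj in \<open>auto simp: hc_fin\<close>)
  qed
  then show "h \<circ> inv_into UNIV fin \<in> hol ?X {p \<in> points ?X. inv_into UNIV fin p \<in> V}"
    unfolding pre using hol_csubspace_open[OF local_hol_CP1 o[OF V'(1)]] by simp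
qed

lemma chart_fin: "chart CP1 (range fin) (inv_into UNIV fin)"
proof -
  have inj: "inj fin" by (simp add: inj_def)
  have im: "inv_into UNIV fin ` range fin = UNIV" using inj by (auto simp: image_comp)
  have pX: "points (csubspace CP1 (range fin)) = range fin" using fin_in_CP1 by auto
  have oU: "openin (ctop complex_plane) UNIV" by (simp add: complex_plane_def)
  have "holo_map (csubspace complex_plane UNIV) (csubspace CP1 (range fin)) fin"
    by (rule holo_map_restrict[OF local_hol_complex_plane local_hol_CP1 holo_map_fin oU openin_range_fin]) simp
  moreover have "holo_map (csubspace CP1 (range fin)) (csubspace complex_plane UNIV) (inv_into UNIV fin)"
    using holo_map_inv_fin local_hol_complex_plane hol_csubspace_open[OF local_hol_complex_plane]
    unfolding holo_map_def by (auto simp: subtopology_UNIV)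
  ultimately have "biholomorphic (csubspace CP1 (range fin)) (csubspace complex_plane UNIV) (inv_into UNIV fin)"
    by (intro biholomorphicI[of _ _ _ fin]) (use inj pX in auto)
  then show ?thesis unfolding chart_def im using openin_range_fin by simp
qed

lemma riemann_surface_CP1: "riemann_surface CP1"
  unfolding riemann_surface_def
proof (intro conjI ballI)
  show "points CP1 \<noteq> {}" using infty_in_CP1 by blast
  show "connected_space (ctop CP1)" by (rule connected_space_CP1)
  show "Hausdorff_space (ctop CP1)" by (rule Hausdorff_space_CP1)
  show "\<forall>U. openin (ctop CP1) U \<longrightarrow> hol CP1 U = hol (csubspace CP1 (points CP1)) U"
    using local_hol_CP1 unfolding local_hol_def .
  \<comment> \<open>Inversion carries a neighbourhood of infinity to the affine chart, so a second
    chart is obtained by pullback.\<close>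
  have m: "biholomorphic CP1 CP1 (moebius 0 1 1 0)" by (rule biholomorphic_moebius) simp
  fix P assume "P \<in> points CP1"
  then show "\<exists>U z. P \<in> U \<and> chart CP1 U z"
  proof (cases rule: CP1_cases)
    case (1 z)
    then show ?thesis using chart_fin by blast
  next
    case 2
    have "moebius 0 1 1 0 P = fin 0" unfolding 2 infty_hc by (subst moebius_hc) (auto simp: fin_hc)
    then have "P \<in> {p \<in> points CP1. moebius 0 1 1 0 p \<in> range fin}" using 2 by simp
    then show ?thesis
      by (intro exI conjI) (assumption, rule chart_pullback[OF local_hol_CP1 local_hol_CP1 m chart_fin])
  qed
qed

section \<open>The discrete Fourier transform of length five\<close>

text \<open>The inverse transform without its factor \<open>1/5\<close>, which accounts for the
  factors 5 in \<open>idft_dft\<close> and \<open>dft_idft\<close>. The coefficient of index 0 is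
  dropped because the coordinates sum to 0. The exponents 4, 3, 2, 1 stand for -1, -2, -3, -4 modulo
  5.\<close>

definition idft :: "complex \<Rightarrow> complex \<Rightarrow> complex \<Rightarrow> complex \<Rightarrow> complex \<Rightarrow> nat \<Rightarrow> complex" where
  "idft z a b c d j = z ^ (4 * j) * a + z ^ (3 * j) * b + z ^ (2 * j) * c + z ^ j * d"

definition dft :: "complex \<Rightarrow> (nat \<Rightarrow> complex) \<Rightarrow> nat \<Rightarrow> complex" where
  "dft z f k = (\<Sum>j<5. z ^ (k * j) * f j)"

text \<open>The norm form of the fifth cyclotomic extension: the product of the values of \<open>idft\<close>.\<close>

definition norm_form :: "complex \<Rightarrow> complex \<Rightarrow> complex \<Rightarrow> complex \<Rightarrow> complex" where
  "norm_form a b c d = (let s0 = a^2 + b^2 + c^2 + d^2; s1 = a * b + b * c + c * d; s2 = a * c + b * d + a * d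
     in (a + b + c + d) * (s0^2 - s0 * (s1 + s2) + 3 * s1 * s2 - s1^2 - s2^2))"

definition bring_eq :: "complex \<Rightarrow> complex \<Rightarrow> complex \<Rightarrow> complex \<Rightarrow> bool" where
  "bring_eq a b c d \<longleftrightarrow> a * d + b * c = 0 \<and> a^2 * c + b^2 * a + d^2 * b + c^2 * d = 0"

definition vandermonde5 :: "(nat \<Rightarrow> complex) \<Rightarrow> complex" where
  "vandermonde5 f = (f 0 - f 1) * (f 0 - f 2) * (f 0 - f 3) * (f 0 - f 4) * (f 1 - f 2) *
     (f 1 - f 3) * (f 1 - f 4) * (f 2 - f 3) * (f 2 - f 4) * (f 3 - f 4)"

definition e4 :: "(nat \<Rightarrow> complex) \<Rightarrow> complex" where
  "e4 f = f 0 * f 1 * f 2 * f 3 + f 0 * f 1 * f 2 * f 4 + f 0 * f 1 * f 3 * f 4 +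
     f 0 * f 2 * f 3 * f 4 + f 1 * f 2 * f 3 * f 4"

lemma bring_eq_swap: "bring_eq d c b a \<longleftrightarrow> bring_eq a b c d"
  by (simp add: bring_eq_def ac_simps)

text \<open>The Fourier indices are doubled modulo 5, which comes from permuting the coordinates of
  the curve by a unit modulo 5. This symmetry moves the four coordinate points in a cycle, whereas
  \<open>bring_eq_swap\<close> only exchanges them in pairs.\<close>

lemma bring_eq_rot: "bring_eq b d a c \<longleftrightarrow> bring_eq a b c d"
  by (simp add: bring_eq_def ac_simps)

lemma sum5: "(\<Sum>j<5. f j) = f 0 + f 1 + f 2 + f 3 + f (4::nat)"
  and prod5: "(\<Prod>j<5. h j) = h 0 * h 1 * h 2 * h 3 * h (4::nat)"
  for f :: "nat \<Rightarrow> 'a::comm_monoid_add" and h :: "nat \<Rightarrow> 'b::comm_monoid_mult"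
  by (simp_all add: eval_nat_numeral)

context
  fixes z :: complex
  assumes z: "1 + z + z^2 + z^3 + z^4 = 0"
begin

lemma z5: "z^5 = 1"
  using z by Groebner_Basis.algebra

lemma z_pow_mod: "z ^ n = z ^ (n mod 5)"
proof -
  have "z ^ n = z ^ (5 * (n div 5) + n mod 5)" by simp
  also have "\<dots> = z ^ (n mod 5)" unfolding power_add power_mult z5 by simp
  finally show ?thesis .
qed

lemma idft_values:
  "idft z a b c d 0 = a + b + c + d"
  "idft z a b c d 1 = z^4 * a + z^3 * b + z^2 * c + z * d"
  "idft z a b c d 2 = z^3 * a + z * b + z^4 * c + z^2 * d"
  "idft z a b c d 3 = z^2 * a + z^4 * b + z * c + z^3 * d"
  "idft z a b c d 4 = z * a + z^2 * b + z^3 * c + z^4 * d"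
  using z_pow_mod[of 6] z_pow_mod[of 8] z_pow_mod[of 9] z_pow_mod[of 12] z_pow_mod[of 16]
  by (simp_all add: idft_def)

lemma dft_values:
  "dft z f 1 = f 0 + z * f 1 + z^2 * f 2 + z^3 * f 3 + z^4 * f 4"
  "dft z f 2 = f 0 + z^2 * f 1 + z^4 * f 2 + z * f 3 + z^3 * f 4"
  "dft z f 3 = f 0 + z^3 * f 1 + z * f 2 + z^4 * f 3 + z^2 * f 4"
  "dft z f 4 = f 0 + z^4 * f 1 + z^3 * f 2 + z^2 * f 3 + z * f 4"
  using z_pow_mod[of 6] z_pow_mod[of 8] z_pow_mod[of 9] z_pow_mod[of 12] z_pow_mod[of 16]
  by (simp_all add: dft_def sum5)

lemma idft_dft:
  assumes "f 0 + f 1 + f 2 + f 3 + f 4 = 0" "j < 5"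
  shows "idft z (dft z f 1) (dft z f 2) (dft z f 3) (dft z f 4) j = 5 * f j"
proof -
  have "idft z (dft z f 1) (dft z f 2) (dft z f 3) (dft z f 4) 0 = 5 * f 0"
    and "idft z (dft z f 1) (dft z f 2) (dft z f 3) (dft z f 4) 1 = 5 * f 1"
    and "idft z (dft z f 1) (dft z f 2) (dft z f 3) (dft z f 4) 2 = 5 * f 2"
    and "idft z (dft z f 1) (dft z f 2) (dft z f 3) (dft z f 4) 3 = 5 * f 3"
    and "idft z (dft z f 1) (dft z f 2) (dft z f 3) (dft z f 4) 4 = 5 * f 4"
    unfolding idft_values dft_values using assms(1) z by Groebner_Basis.algebra+
  moreover have "j = 0 \<or> j = 1 \<or> j = 2 \<or> j = 3 \<or> j = 4" using assms(2) by linarith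
  ultimately show ?thesis by metis
qed

lemma dft_idft:
  "dft z (idft z a b c d) 1 = 5 * a" "dft z (idft z a b c d) 2 = 5 * b"
  "dft z (idft z a b c d) 3 = 5 * c" "dft z (idft z a b c d) 4 = 5 * d"
  unfolding idft_values dft_values using z by Groebner_Basis.algebra+

lemma idft_sum: "(\<Sum>j<5. idft z a b c d j) = 0"
  unfolding sum5 idft_values using z by Groebner_Basis.algebra

lemma idft_sum2: "(\<Sum>j<5. idft z a b c d j ^ 2) = 10 * (a * d + b * c)"
  unfolding sum5 idft_values using z by Groebner_Basis.algebra

lemma idft_sum3: "(\<Sum>j<5. idft z a b c d j ^ 3) = 15 * (a^2 * c + b^2 * a + d^2 * b + c^2 * d)"
  unfolding sum5 idft_values using z by Groebner_Basis.algebra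

text \<open>Values with opposite indices are exchanged by \<open>z \<mapsto> z^4\<close>, so their
  sums and products lie in the quadratic field generated by \<open>z + z^4\<close>. Symmetric
  functions of all five values can then be computed with one quadratic relation instead of the
  quartic one.\<close>

lemma idft_pairs:
  "idft z a b c d 1 * idft z a b c d 4 =
     (a^2 + b^2 + c^2 + d^2) + (a * b + b * c + c * d) * (z + z^4) + (a * c + b * d + a * d) * (-1 - (z + z^4))"
  "idft z a b c d 2 * idft z a b c d 3 =
     (a^2 + b^2 + c^2 + d^2) + (a * c + b * d + a * d) * (z + z^4) + (a * b + b * c + c * d) * (-1 - (z + z^4))"
  "idft z a b c d 1 + idft z a b c d 4 = (a + d) * (z + z^4) + (b + c) * (-1 - (z + z^4))"
  "idft z a b c d 2 + idft z a b c d 3 = (b + c) * (z + z^4) + (a + d) * (-1 - (z + z^4))"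
  unfolding idft_values using z by Groebner_Basis.algebra+

lemma g_quadratic: "(z + z^4)^2 = 1 - (z + z^4)"
  using z by Groebner_Basis.algebra

lemma idft_prod: "(\<Prod>j<5. idft z a b c d j) = norm_form a b c d"
proof -
  define g where "g = z + z^4"
  have g: "g^2 = 1 - g" using g_quadratic by (simp add: g_def)
  have "(\<Prod>j<5. idft z a b c d j) = idft z a b c d 0 * (idft z a b c d 1 * idft z a b c d 4)
      * (idft z a b c d 2 * idft z a b c d 3)"
    unfolding prod5 by (simp only: ac_simps)
  also have "\<dots> = norm_form a b c d"
    unfolding idft_pairs g_def[symmetric] norm_form_def Let_def idft_values(1) using g by Groebner_Basis.algebra
  finally show ?thesis .
qed

lemma idft_e4:
  "e4 (idft z a b c d) = - 5 * a^3 * b + 5 * a^2 * d^2 - 5 * a * b * c * d - 5 * a * c^3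
     - 5 * b^3 * d + 5 * b^2 * c^2 - 5 * c * d^3"
proof -
  define g where "g = z + z^4"
  have g: "g^2 = 1 - g" using g_quadratic by (simp add: g_def)
  have "e4 (idft z a b c d) = idft z a b c d 0 * ((idft z a b c d 1 * idft z a b c d 4) * (idft z a b c d 2 + idft z a b c d 3)
      + (idft z a b c d 2 * idft z a b c d 3) * (idft z a b c d 1 + idft z a b c d 4))
      + (idft z a b c d 1 * idft z a b c d 4) * (idft z a b c d 2 * idft z a b c d 3)"
    by (simp add: e4_def algebra_simps)
  also have "\<dots> = - 5 * a^3 * b + 5 * a^2 * d^2 - 5 * a * b * c * d - 5 * a * c^3
     - 5 * b^3 * d + 5 * b^2 * c^2 - 5 * c * d^3"
    unfolding idft_pairs g_def[symmetric] idft_values(1) using g by Groebner_Basis.algebra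
  finally show ?thesis .
qed

lemma norm_form_scale: "norm_form (k * a) (k * b) (k * c) (k * d) = k^5 * norm_form a b c d"
  unfolding norm_form_def Let_def by Groebner_Basis.algebra

text \<open>The ten differences are five between cyclic neighbours and five at distance two. Each
  family is again a cyclic sequence whose Fourier coefficients are the old ones times
  \<open>u\<close> or \<open>v\<close> up to sign, so its product is a norm form. As
  \<open>v = r * u\<close> and \<open>u = (1 + r) * v\<close>, the factors \<open>u^5\<close> and
  \<open>v^5\<close> come out and leave only \<open>r\<close>; since \<open>u * v = s\<close>, the
  extra \<open>s\<close> on the left produces \<open>s^6 = 125\<close>.\<close>

lemma idft_vandermonde:
  defines "r \<equiv> - (1 + (z + z^4 - z^2 - z^3)) / 2"
  shows "(z + z^4 - z^2 - z^3) * vandermonde5 (idft z a b c d) =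
     125 * norm_form a (r * b) (- (r * c)) (- d) * norm_form (- a) ((1 + r) * b) (- ((1 + r) * c)) d"
proof -
  define s where "s = z + z^4 - z^2 - z^3"
  define u where "u = z^2 - z^3"
  define v where "v = z^4 - z"
  have s2: "s^2 = 5" using z unfolding s_def by Groebner_Basis.algebra
  have uv: "u * v = s" using z unfolding s_def u_def v_def by Groebner_Basis.algebra
  have r: "2 * r = - (1 + s)" by (simp add: r_def s_def)
  have "2 * v = - (1 + s) * u" using z unfolding s_def u_def v_def by Groebner_Basis.algebra
  then have vr: "v = r * u" using r by (metis mult.assoc mult_left_cancel zero_neq_numeral)
  have "2 * u = (1 - s) * v" using z unfolding s_def u_def v_def by Groebner_Basis.algebra
  moreover have "2 * (1 + r) = 1 - s" using r by (simp add: algebra_simps)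
  ultimately have ur: "u = (1 + r) * v" by (metis mult.assoc mult_left_cancel zero_neq_numeral)
  let ?X = "idft z a b c d"
  \<comment> \<open>The sequences start with the differences of indices 3, 2 and of indices 4, 1,
    which lie symmetrically about 5/2. This makes the multipliers of opposite Fourier indices equal
    up to sign.\<close>
  let ?A = "idft z (u * a) (v * b) (- (v * c)) (- (u * d))"
  let ?B = "idft z (- (v * a)) (u * b) (- (u * c)) (v * d)"
  have A0: "?A 0 = ?X 3 - ?X 2" and B0: "?B 0 = ?X 4 - ?X 1"
    unfolding u_def v_def idft_values by Groebner_Basis.algebra+
  have A: "?A 1 = ?X 4 - ?X 3" "?A 2 = ?X 0 - ?X 4" "?A 3 = ?X 1 - ?X 0" "?A 4 = ?X 2 - ?X 1"
    unfolding u_def v_def idft_values using z by Groebner_Basis.algebra+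
  have B: "?B 1 = ?X 0 - ?X 2" "?B 2 = ?X 1 - ?X 3" "?B 3 = ?X 2 - ?X 4" "?B 4 = ?X 3 - ?X 0"
    unfolding u_def v_def idft_values using z by Groebner_Basis.algebra+
  have "vandermonde5 ?X = (\<Prod>j<5. ?A j) * (\<Prod>j<5. ?B j)"
    unfolding vandermonde5_def prod5 A0 B0 A B by Groebner_Basis.algebra
  also have "\<dots> = norm_form (u * a) (v * b) (- (v * c)) (- (u * d)) * norm_form (- (v * a)) (u * b) (- (u * c)) (v * d)"
    by (simp only: idft_prod)
  also have "norm_form (u * a) (v * b) (- (v * c)) (- (u * d)) = u^5 * norm_form a (r * b) (- (r * c)) (- d)"
    unfolding norm_form_scale[symmetric] vr by (simp add: algebra_simps)
  also have "norm_form (- (v * a)) (u * b) (- (u * c)) (v * d) = v^5 * norm_form (- a) ((1 + r) * b) (- ((1 + r) * c)) d"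
    unfolding norm_form_scale[symmetric] ur by (simp add: algebra_simps)
  finally have "s * vandermonde5 ?X = s * (u * v)^5 * norm_form a (r * b) (- (r * c)) (- d) * norm_form (- a) ((1 + r) * b) (- ((1 + r) * c)) d"
    by (simp add: power_mult_distrib)
  moreover have "s * s^5 = (s^2)^3" by Groebner_Basis.algebra
  then have "s * (u * v)^5 = 125" unfolding uv s2 by simp
  ultimately show ?thesis by (simp only: s_def)
qed

end

section \<open>Normal form of a point and the invariants in terms of \<open>p\<close>\<close>

definition bring_nf :: "complex \<Rightarrow> complex \<Rightarrow> bool" where
  "bring_nf p Y \<longleftrightarrow> p \<noteq> 0 \<and> p \<noteq> 1 \<and> p \<noteq> -1 \<and> Y \<noteq> 0 \<and> Y^5 * p^2 * (1 - p) = p + 1"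

lemma bring_nf_eq: "bring_nf p Y \<Longrightarrow> bring_eq (p * Y^3) (p * Y^2) (- Y) 1"
proof -
  assume "bring_nf p Y"
  then have h: "Y^5 * p^2 * (1 - p) = p + 1" by (simp add: bring_nf_def)
  have "p * Y^3 * 1 + p * Y^2 * - Y = 0" by Groebner_Basis.algebra
  moreover have "(p * Y^3)^2 * - Y + (p * Y^2)^2 * (p * Y^3) + p * Y^2 + (- Y)^2 = 0"
    using h by Groebner_Basis.algebra
  ultimately show ?thesis unfolding bring_eq_def by (simp only: power_one mult_1_left mult_1_right)
qed

lemma bring_eq_normal_form:
  assumes e: "bring_eq a b c d" and nz: "a * d \<noteq> 0"
  shows "\<exists>p Y. bring_nf p Y \<and> a = d * (p * Y^3) \<and> b = d * (p * Y^2) \<and> c = d * - Y"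
proof -
  have q: "a * d + b * c = 0" and C: "a^2 * c + b^2 * a + d^2 * b + c^2 * d = 0"
    using e by (simp_all add: bring_eq_def)
  have nz': "a \<noteq> 0" "b \<noteq> 0" "c \<noteq> 0" "d \<noteq> 0" using q nz by auto
  define Y where "Y = - c / d"
  define p where "p = b / (d * Y^2)"
  have Y: "c = d * - Y" "Y \<noteq> 0" using nz' by (simp_all add: Y_def)
  have b: "b = d * (p * Y^2)" and p0: "p \<noteq> 0" using nz' Y(2) by (simp_all add: p_def)
  have "d * (a - d * (p * Y^3)) = 0" using q unfolding Y(1) b by Groebner_Basis.algebra
  then have a: "a = d * (p * Y^3)" using nz' by simp
  have "d^3 * Y^2 * (p + 1 - Y^5 * p^2 * (1 - p)) = 0" using C unfolding a b Y(1) by Groebner_Basis.algebra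
  then have h: "Y^5 * p^2 * (1 - p) = p + 1" using nz' Y(2) by simp
  have "p \<noteq> 1" using h by auto
  moreover have "p \<noteq> -1" using h Y(2) by auto
  ultimately have "bring_nf p Y" using p0 Y(2) h by (simp add: bring_nf_def)
  then show ?thesis using a b Y(1) by blast
qed

text \<open>Rotations multiply \<open>Y\<close> by a fifth root of unity and leave the norm form
  unchanged, so only \<open>Y^5\<close> occurs in it, and the equation of the curve makes that
  rational in \<open>p\<close>. The worst denominators, from the first and the third power of
  \<open>Y^5\<close>, are cleared by \<open>p^2 * (1 - p)^3\<close>.\<close>

lemma norm_form_nf:
  assumes "Y^5 * p^2 * (1 - p) = p + 1"
  shows "norm_form (p * Y^3) (p * Y^2) (- Y) 1 * (p^2 * (1 - p)^3) =
    - 1 + 22 * p + 5 * p^2 + 5 * p^4 - 22 * p^5 - p^6"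
proof -
  define Q where "Q = Y^5"
  have h: "Q * p^2 * (1 - p) = p + 1" using assms by (simp add: Q_def)
  have "norm_form (p * Y^3) (p * Y^2) (- Y) 1 =
      1 + (- 1 + 10 * p - 10 * p^2) * Q + (10 * p^3 + 10 * p^4 + p^5) * Q^2 + p^5 * Q^3"
    unfolding norm_form_def Let_def Q_def power_one mult_1_left mult_1_right by Groebner_Basis.algebra
  then show ?thesis using h by Groebner_Basis.algebra
qed

lemma norm_form_nf_golden1:
  assumes "Y^5 * p^2 * (1 - p) = p + 1" and r: "r^2 = 1 - r"
  shows "norm_form (p * Y^3) (r * (p * Y^2)) (- (r * - Y)) (- 1) * (p^2 * (1 - p)^3) =
    (- 3 + 14 * p - 35 * p^2 - 20 * p^3 + 35 * p^4 + 14 * p^5 + 3 * p^6) +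
    r * (5 - 10 * p + 65 * p^2 + 20 * p^3 - 65 * p^4 - 10 * p^5 - 5 * p^6)"
proof -
  define Q where "Q = Y^5"
  have h: "Q * p^2 * (1 - p) = p + 1" using assms by (simp add: Q_def)
  have "norm_form (p * Y^3) (r * (p * Y^2)) (- (r * - Y)) (- 1) =
      - 1 + (- 3 + 15 * p - 5 * p^2 + r * (5 - 20 * p + 15 * p^2)) * Q
      + (- 5 * p^3 - 15 * p^4 - 3 * p^5 + r * (15 * p^3 + 20 * p^4 + 5 * p^5)) * Q^2 + p^5 * Q^3"
    unfolding norm_form_def Let_def Q_def power_one mult_1_left mult_1_right using r by Groebner_Basis.algebra
  then show ?thesis using h by Groebner_Basis.algebra
qed

lemma norm_form_nf_golden2:
  assumes "Y^5 * p^2 * (1 - p) = p + 1" and r: "r^2 = 1 - r"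
  shows "norm_form (- (p * Y^3)) ((1 + r) * (p * Y^2)) (- ((1 + r) * - Y)) 1 * (p^2 * (1 - p)^3) =
    (8 - 24 * p + 100 * p^2 + 40 * p^3 - 100 * p^4 - 24 * p^5 - 8 * p^6) +
    r * (5 - 10 * p + 65 * p^2 + 20 * p^3 - 65 * p^4 - 10 * p^5 - 5 * p^6)"
proof -
  define Q where "Q = Y^5"
  have h: "Q * p^2 * (1 - p) = p + 1" using assms by (simp add: Q_def)
  have "norm_form (- (p * Y^3)) ((1 + r) * (p * Y^2)) (- ((1 + r) * - Y)) 1 =
      1 + (8 - 35 * p + 20 * p^2 + r * (5 - 20 * p + 15 * p^2)) * Q
      + (20 * p^3 + 35 * p^4 + 8 * p^5 + r * (15 * p^3 + 20 * p^4 + 5 * p^5)) * Q^2 - p^5 * Q^3"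
    unfolding norm_form_def Let_def Q_def power_one mult_1_left mult_1_right using r by Groebner_Basis.algebra
  then show ?thesis using h by Groebner_Basis.algebra
qed

text \<open>Up to numerical factors \<open>M\<close> is \<open>s\<close> times the Vandermonde
  product and \<open>N\<close> the product of the coordinates. Both \<open>M\<close> and
  \<open>N^2\<close> are combinations of the same two terms with one sign changed, so sum and
  difference isolate the zeros and the poles of \<open>\<beta>\<close>. The fifth powers reflect the
  valency 5 of the vertices and of the faces of the icosahedron.\<close>

lemma norm_form_nf_golden_prod:
  assumes "Y^5 * p^2 * (1 - p) = p + 1" and r: "r^2 = 1 - r"
  defines "M \<equiv> norm_form (p * Y^3) (r * (p * Y^2)) (- (r * - Y)) (- 1)
      * norm_form (- (p * Y^3)) ((1 + r) * (p * Y^2)) (- ((1 + r) * - Y)) 1"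
    and "N \<equiv> norm_form (p * Y^3) (p * Y^2) (- Y) 1"
  shows "(M + N^2) * (p^2 * (1 - p)^3)^2 = 2 * (p^2 - 1) * (p^2 - 4 * p - 1)^5"
    and "(M - N^2) * (p^2 * (1 - p)^3)^2 = - 128 * p * (p^2 + p - 1)^5"
proof -
  define D where "D = p^2 * (1 - p)^3"
  have "M * D^2 = (norm_form (p * Y^3) (r * (p * Y^2)) (- (r * - Y)) (- 1) * D)
      * (norm_form (- (p * Y^3)) ((1 + r) * (p * Y^2)) (- ((1 + r) * - Y)) 1 * D)"
    unfolding M_def by Groebner_Basis.algebra
  also have "\<dots> = (p^2 - 1) * (p^2 - 4 * p - 1)^5 - 64 * p * (p^2 + p - 1)^5"
    unfolding D_def norm_form_nf_golden1[OF assms(1,2)] norm_form_nf_golden2[OF assms(1,2)]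
    using r by Groebner_Basis.algebra
  finally have M: "M * D^2 = (p^2 - 1) * (p^2 - 4 * p - 1)^5 - 64 * p * (p^2 + p - 1)^5" .
  have "N^2 * D^2 = (N * D)^2" by Groebner_Basis.algebra
  also have "\<dots> = (p^2 - 1) * (p^2 - 4 * p - 1)^5 + 64 * p * (p^2 + p - 1)^5"
    unfolding N_def D_def norm_form_nf[OF assms(1)] by Groebner_Basis.algebra
  finally have N: "N^2 * D^2 = (p^2 - 1) * (p^2 - 4 * p - 1)^5 + 64 * p * (p^2 + p - 1)^5" .
  show "(M + N^2) * (p^2 * (1 - p)^3)^2 = 2 * (p^2 - 1) * (p^2 - 4 * p - 1)^5"
    unfolding D_def[symmetric] distrib_right M N by Groebner_Basis.algebra
  show "(M - N^2) * (p^2 * (1 - p)^3)^2 = - 128 * p * (p^2 + p - 1)^5"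
    unfolding D_def[symmetric] left_diff_distrib M N by Groebner_Basis.algebra
qed

context
  fixes z p Y :: complex and X :: "nat \<Rightarrow> complex" and s :: complex
  assumes z: "1 + z + z^2 + z^3 + z^4 = 0" and nf: "bring_nf p Y"
  defines "X \<equiv> idft z (p * Y^3) (p * Y^2) (- Y) 1"
    and "s \<equiv> z + z^4 - z^2 - z^3"
begin

lemma nf_beta_num:
  "(s * vandermonde5 X + 125 * (\<Prod>j<5. X j)^2) * (p^2 * (1 - p)^3)^2 = 250 * (p^2 - 1) * (p^2 - 4 * p - 1)^5" (is ?A)
  and nf_beta_den:
  "(s * vandermonde5 X - 125 * (\<Prod>j<5. X j)^2) * (p^2 * (1 - p)^3)^2 = - 16000 * p * (p^2 + p - 1)^5" (is ?B)
proof -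
  have h: "Y^5 * p^2 * (1 - p) = p + 1" using nf by (simp add: bring_nf_def)
  define r where "r = - (1 + s) / 2"
  have "s^2 = 5" using z unfolding s_def by Groebner_Basis.algebra
  moreover have "s = - 1 - 2 * r" by (simp add: r_def field_simps)
  ultimately have "(- 1 - 2 * r)^2 = 5" by simp
  moreover have "(- 1 - 2 * r)^2 - 5 = 4 * (r^2 - (1 - r))" by Groebner_Basis.algebra
  ultimately have "4 * (r^2 - (1 - r)) = 0" by simp
  then have r: "r^2 = 1 - r" by (metis eq_iff_diff_eq_0 mult_eq_0_iff zero_neq_numeral)
  define M where "M = norm_form (p * Y^3) (r * (p * Y^2)) (- (r * - Y)) (- 1)
      * norm_form (- (p * Y^3)) ((1 + r) * (p * Y^2)) (- ((1 + r) * - Y)) 1"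
  define N where "N = norm_form (p * Y^3) (p * Y^2) (- Y) 1"
  have V: "s * vandermonde5 X = 125 * M"
    unfolding X_def s_def idft_vandermonde[OF z] M_def r_def by (simp only: mult.assoc)
  have P: "(\<Prod>j<5. X j) = N" unfolding X_def N_def by (rule idft_prod[OF z])
  note MN = norm_form_nf_golden_prod[OF h r, folded M_def N_def]
  have "(125 * M + 125 * N^2) * (p^2 * (1 - p)^3)^2 = 125 * ((M + N^2) * (p^2 * (1 - p)^3)^2)"
    and "(125 * M - 125 * N^2) * (p^2 * (1 - p)^3)^2 = 125 * ((M - N^2) * (p^2 * (1 - p)^3)^2)"
    by Groebner_Basis.algebra+
  then show ?A ?B unfolding V P MN by simp_all
qed

text \<open>\<open>e4\<close> has degree 4, so the normalisation of the last Fourier coordinate to 1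
  leaves a factor \<open>Y\<close> besides functions of \<open>Y^5\<close>. The two quadratic
  factors are those of \<open>nf_beta_num\<close> and \<open>nf_beta_den\<close>: \<open>a\<close>
  vanishes over the zeros and poles of \<open>\<beta>\<close>.\<close>

lemma nf_e4: "e4 X * (p * (1 - p)^2) = 5 * Y * (p^2 - 4 * p - 1) * (p^2 + p - 1)"
proof -
  have h: "Y^5 * p^2 * (1 - p) = p + 1" using nf by (simp add: bring_nf_def)
  show ?thesis unfolding X_def idft_e4[OF z] power_one mult_1_left mult_1_right using h by Groebner_Basis.algebra
qed

text \<open>Five times the discriminant formula \<open>V^2 = 256 * a^5 + 3125 * b^4\<close> of the
  quintic \<open>t^5 + a * t + b\<close>. Here it follows by multiplying \<open>nf_beta_num\<close>
  with \<open>nf_beta_den\<close> and comparing with the fifth power of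
  \<open>nf_e4\<close>.\<close>

lemma nf_discriminant: "(s * vandermonde5 X)^2 - (125 * (\<Prod>j<5. X j)^2)^2 = 1280 * e4 X ^ 5"
proof -
  have h: "Y^5 * p^2 * (1 - p) = p + 1" and nz: "p \<noteq> 0" "p \<noteq> 1" using nf by (simp_all add: bring_nf_def)
  define A where "A = s * vandermonde5 X"
  define B where "B = 125 * (\<Prod>j<5. X j)^2"
  define D where "D = p^2 * (1 - p)^3"
  define F where "F = (p^2 - 4 * p - 1) * (p^2 + p - 1)"
  have D0: "D \<noteq> 0" using nz by (simp add: D_def)
  have "(A^2 - B^2) * D^4 = ((A + B) * D^2) * ((A - B) * D^2)" by Groebner_Basis.algebra
  also have "\<dots> = - 4000000 * p * (p^2 - 1) * F^5"
    unfolding A_def B_def D_def nf_beta_num nf_beta_den F_def by Groebner_Basis.algebra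
  finally have 1: "(A^2 - B^2) * D^4 = - 4000000 * p * (p^2 - 1) * F^5" .
  have e: "e4 X * (p * (1 - p)^2) = 5 * Y * F" using nf_e4 by (simp add: F_def)
  have "1280 * e4 X ^ 5 * D^4 = 1280 * (e4 X * (p * (1 - p)^2))^5 * (p^3 * (1 - p)^2)"
    unfolding D_def by Groebner_Basis.algebra
  also have "\<dots> = 4000000 * (Y^5 * p^2 * (1 - p)) * p * (1 - p) * F^5"
    unfolding e by Groebner_Basis.algebra
  also have "\<dots> = - 4000000 * p * (p^2 - 1) * F^5" unfolding h by Groebner_Basis.algebra
  finally have "(A^2 - B^2) * D^4 = 1280 * e4 X ^ 5 * D^4" using 1 by simp
  then show ?thesis using D0 by (simp add: A_def B_def)
qed

end

section \<open>The coordinate on the dihedral quotient\<close>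

text \<open>In normal form the two factors are \<open>p * Y^4 * (p - 1)\<close> and
  \<open>Y^2 * (p + 1)\<close>, so the fraction is \<open>p - 1/p\<close>, written as a quotient of
  quartic forms that is visibly symmetric under reversal of the indices. On the curve
  \<open>a * d = 0\<close> leaves only the coordinate points; their values are the continuous
  ones.\<close>

definition wmap :: "complex \<Rightarrow> complex \<Rightarrow> complex \<Rightarrow> complex \<Rightarrow> cp1" where
  "wmap a b c d = (if a * d \<noteq> 0 then hc ((a * c + b^2) * (d * b + c^2)) ((a * d)^2)
     else if b = 0 \<and> c = 0 then fin 0 else infty)"

text \<open>At the four coordinate points the fraction in \<open>wmap\<close> is \<open>0/0\<close>. Near \<open>(1, 0, 0, 0)\<close> the quadric
  yields \<open>d\<close> and the cubic then yields \<open>c / b\<close>, which gives the following fraction for the same function;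
  the other three points follow from it by the symmetries \<open>wmap_swap\<close> and \<open>wmap_rot4\<close>.\<close>

definition patch_num :: "complex \<Rightarrow> complex \<Rightarrow> complex \<Rightarrow> complex \<Rightarrow> complex" where
  "patch_num a b c d = - ((a * c - b^2)^2 * (a^3 * b + b^2 * c^2))"

definition patch_den :: "complex \<Rightarrow> complex \<Rightarrow> complex \<Rightarrow> complex \<Rightarrow> complex" where
  "patch_den a b c d = a^5 * (a^3 - b * c^2)"

lemma wmap_scale:
  assumes "k \<noteq> 0"
  shows "wmap (k * a) (k * b) (k * c) (k * d) = wmap a b c d"
proof (cases "a * d = 0")
  case False
  have "(k * a * (k * c) + (k * b)^2) * (k * d * (k * b) + (k * c)^2) = k^4 * ((a * c + b^2) * (d * b + c^2))"
    and "(k * a * (k * d))^2 = k^4 * (a * d)^2"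
    by Groebner_Basis.algebra+
  then show ?thesis using False assms hc_scale[of "k^4"] by (simp add: wmap_def)
qed (use assms in \<open>auto simp: wmap_def\<close>)

lemma wmap_swap: "wmap d c b a = wmap a b c d"
  by (auto simp: wmap_def mult.commute)

lemma wmap_rotate:
  assumes t: "t^5 = 1"
  shows "wmap (t^4 * a) (t^3 * b) (t^2 * c) (t * d) = wmap a b c d"
proof -
  have t0: "t \<noteq> 0" using t by auto
  have "(t^4 * a * (t^2 * c) + (t^3 * b)^2) * (t * d * (t^3 * b) + (t^2 * c)^2) =
      (t^5)^2 * ((a * c + b^2) * (d * b + c^2))"
    and "(t^4 * a * (t * d))^2 = (t^5)^2 * (a * d)^2"
    by Groebner_Basis.algebra+
  then show ?thesis using t0 by (simp add: wmap_def t)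
qed

lemma wmap_nf:
  assumes "bring_nf p Y"
  shows "wmap (p * Y^3) (p * Y^2) (- Y) 1 = fin (p - 1 / p)"
proof -
  have nz: "p \<noteq> 0" "Y \<noteq> 0" using assms by (auto simp: bring_nf_def)
  have "(p * Y^3 * - Y + (p * Y^2)^2) * (p * Y^2 + (- Y)^2) = (p * Y^6) * (p^2 - 1)"
    and "(p * Y^3)^2 = (p * Y^6) * p" by Groebner_Basis.algebra+
  then have "wmap (p * Y^3) (p * Y^2) (- Y) 1 = hc (p^2 - 1) p"
    using nz hc_scale[of "p * Y^6"] by (simp add: wmap_def)
  also have "\<dots> = fin ((p^2 - 1) / p)" using nz by (simp add: hc_fin)
  also have "(p^2 - 1) / p = p - 1 / p" using nz by (simp add: field_simps power2_eq_square)
  finally show ?thesis .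
qed

lemma bring_eq_degenerate:
  assumes "bring_eq a b c d" "a * d = 0"
  shows "(b = 0 \<and> c = 0 \<and> d = 0) \<or> (a = 0 \<and> c = 0 \<and> d = 0) \<or>
    (a = 0 \<and> b = 0 \<and> d = 0) \<or> (a = 0 \<and> b = 0 \<and> c = 0)"
  using assms by (auto simp: bring_eq_def)

lemma bring_eq_cases:
  assumes "bring_eq a b c d" "\<not> (a = 0 \<and> b = 0 \<and> c = 0 \<and> d = 0)"
  obtains (generic) p Y where "bring_nf p Y" "a = d * (p * Y^3)" "b = d * (p * Y^2)" "c = d * - Y" "d \<noteq> 0"
    "wmap a b c d = fin (p - 1 / p)"
  | (a) "a \<noteq> 0" "b = 0" "c = 0" "d = 0" "wmap a b c d = fin 0"
  | (b) "b \<noteq> 0" "a = 0" "c = 0" "d = 0" "wmap a b c d = infty"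
  | (c) "c \<noteq> 0" "a = 0" "b = 0" "d = 0" "wmap a b c d = infty"
  | (d) "d \<noteq> 0" "a = 0" "b = 0" "c = 0" "wmap a b c d = fin 0"
proof (cases "a * d = 0")
  case True
  then show thesis using bring_eq_degenerate[OF assms(1) True] assms(2) that(2-5)
    by (auto simp: wmap_def)
next
  case False
  then have d0: "d \<noteq> 0" by simp
  obtain p Y where pY: "bring_nf p Y" "a = d * (p * Y^3)" "b = d * (p * Y^2)" "c = d * - Y"
    using bring_eq_normal_form[OF assms(1) False] by blast
  have "wmap a b c d = fin (p - 1 / p)"
    using wmap_scale[OF d0, of "p * Y^3" "p * Y^2" "- Y" 1] wmap_nf[OF pY(1)] pY by simp
  then show thesis using that(1) pY d0 by blast
qed

lemma wmap_patch:
  assumes e: "bring_eq a b c d" and nz: "patch_num a b c d \<noteq> 0 \<or> patch_den a b c d \<noteq> 0"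
  shows "wmap a b c d = hc (patch_num a b c d) (patch_den a b c d)"
proof -
  have q: "a * d + b * c = 0" and C: "a^2 * c + b^2 * a + d^2 * b + c^2 * d = 0"
    using e by (simp_all add: bring_eq_def)
  have a0: "a \<noteq> 0"
  proof
    assume "a = 0"
    moreover from this have "b * c = 0" using q by simp
    ultimately show False using nz by (auto simp: patch_num_def patch_den_def)
  qed
  \<comment> \<open>This is \<open>a^2\<close> times the cubic with \<open>a * d\<close> replaced by
    \<open>- (b * c)\<close>, so \<open>d\<close> has been eliminated.\<close>
  have C': "a^4 * c + a^3 * b^2 + b^3 * c^2 - a * b * c^3 = 0" using q C by Groebner_Basis.algebra
  show ?thesis
  proof (cases "a * d = 0")
    case True
    then have "d = 0" "b = 0" "c = 0" using a0 bring_eq_degenerate[OF e True] by auto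
    then show ?thesis using a0 hc_fin[of "a^8" 0]
      by (simp add: wmap_def patch_num_def patch_den_def hc_fin)
  next
    case False
    have 1: "a * (d * b + c^2) = c * (a * c - b^2)" and 2: "a * d = - (b * c)"
      using q by Groebner_Basis.algebra+
    \<comment> \<open>The cross-multiplied difference of the two fractions turns out to be a
      multiple of the eliminated cubic.\<close>
    have "(a * c + b^2) * (d * b + c^2) * patch_den a b c d - (a * d)^2 * patch_num a b c d =
        (a * c + b^2) * (a * (d * b + c^2)) * a^4 * (a^3 - b * c^2)
        + (a * d)^2 * (a * c - b^2)^2 * (a^3 * b + b^2 * c^2)"
      unfolding patch_num_def patch_den_def by Groebner_Basis.algebra
    also have "\<dots> = c * (a * c - b^2) * (b * c * (a * c - b^2) + a * (a^3 - b * c^2))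
        * (a^4 * c + a^3 * b^2 + b^3 * c^2 - a * b * c^3)"
      unfolding 1 2 by Groebner_Basis.algebra
    finally have "(a * c + b^2) * (d * b + c^2) * patch_den a b c d = (a * d)^2 * patch_num a b c d"
      unfolding C' by simp
    then show ?thesis using False nz by (simp add: wmap_def hc_eq_iff)
  qed
qed

text \<open>Doubling the indices normalises the dihedral group and therefore acts on the quotient
  coordinate, here as the involution \<open>w \<mapsto> -4 / w\<close>. It exchanges 0 and infinity,
  so one patch at a point with \<open>w = 0\<close> also serves the points with \<open>w\<close>
  infinite.\<close>

lemma wmap_rot4:
  assumes e: "bring_eq a b c d" and nz: "\<not> (a = 0 \<and> b = 0 \<and> c = 0 \<and> d = 0)"
  shows "wmap b d a c = moebius 0 (-4) 1 0 (wmap a b c d)"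
  using e nz
proof (cases rule: bring_eq_cases)
  case (generic p Y)
  have h: "Y^5 * p^2 * (1 - p) = p + 1" and nz: "p \<noteq> 0" "Y \<noteq> 0" "p \<noteq> 1" "p \<noteq> -1"
    using generic by (simp_all add: bring_nf_def)
  have "wmap b d a c = wmap (p * Y^2) 1 (p * Y^3) (- Y)"
    using wmap_scale[OF generic(5), of "p * Y^2" 1 "p * Y^3" "- Y"] generic by simp
  also have "\<dots> = hc ((p * Y^2 * (p * Y^3) + 1) * (- Y + (p * Y^3)^2)) ((p * Y^2 * - Y)^2)"
    using nz by (simp add: wmap_def)
  also have "\<dots> = hc (-4 * p) (p^2 - 1)"
  proof -
    have "(1 - p)^2 * ((p * Y^2 * (p * Y^3) + 1) * (- Y + (p * Y^3)^2)) = 4 * p * Y"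
      using h by Groebner_Basis.algebra
    moreover have "(1 - p) * (p * Y^2 * - Y)^2 = Y * (p + 1)"
      using h by Groebner_Basis.algebra
    ultimately have "(1 - p)^2 * (((p * Y^2 * (p * Y^3) + 1) * (- Y + (p * Y^3)^2)) * (p^2 - 1)) =
       (1 - p)^2 * ((p * Y^2 * - Y)^2 * (-4 * p))" by Groebner_Basis.algebra
    then have "((p * Y^2 * (p * Y^3) + 1) * (- Y + (p * Y^3)^2)) * (p^2 - 1) = (p * Y^2 * - Y)^2 * (-4 * p)"
      using nz by (metis mult_left_cancel power_not_zero right_minus_eq)
    then show ?thesis using nz by (simp add: hc_eq_iff)
  qed
  also have "\<dots> = moebius 0 (-4) 1 0 (hc (p^2 - 1) p)"
    using nz by (subst moebius_hc) auto
  also have "hc (p^2 - 1) p = fin (p - 1 / p)"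
    using nz by (simp add: hc_fin field_simps power2_eq_square)
  finally show ?thesis using generic by simp
next
  case a
  have "moebius 0 (-4) 1 0 (fin 0) = infty" unfolding fin_hc by (simp add: moebius_hc hc_infty)
  then show ?thesis using a by (simp add: wmap_def)
next
  case b
  have "moebius 0 (-4) 1 0 infty = fin 0" unfolding infty_hc by (simp add: moebius_hc hc_fin)
  then show ?thesis using b by (simp add: wmap_def)
next
  case c
  have "moebius 0 (-4) 1 0 infty = fin 0" unfolding infty_hc by (simp add: moebius_hc hc_fin)
  then show ?thesis using c by (simp add: wmap_def)
next
  case d
  have "moebius 0 (-4) 1 0 (fin 0) = infty" unfolding fin_hc by (simp add: moebius_hc hc_infty)
  then show ?thesis using d by (simp add: wmap_def)
qed

section \<open>Fibres, local sections and surjectivity of the coordinate\<close>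

lemma fifth_roots_of_unity_quotient:
  assumes "Y^5 = Y'^5" "Y \<noteq> (0::complex)"
  shows "\<exists>t. t^5 = 1 \<and> Y' = t * Y"
  using assms by (intro exI[of _ "Y' / Y"]) (auto simp: power_divide)

lemma bring_nf_w_neq_0:
  assumes "bring_nf p Y"
  shows "p - 1 / p \<noteq> 0"
proof -
  have "p \<noteq> 0" "p - 1 \<noteq> 0" "p + 1 \<noteq> 0" using assms by (auto simp: bring_nf_def add_eq_0_iff2)
  moreover from this have "p - 1 / p = (p - 1) * (p + 1) / p" by (simp add: field_simps)
  ultimately show ?thesis by simp
qed

lemma bring_nf_same_fibre:
  assumes n: "bring_nf p Y" "a = d * (p * Y^3)" "b = d * (p * Y^2)" "c = d * - Y" "d \<noteq> 0"
    and n': "bring_nf p Y'" "a' = d' * (p * Y'^3)" "b' = d' * (p * Y'^2)" "c' = d' * - Y'" "d' \<noteq> 0"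
  shows "\<exists>k t. k \<noteq> 0 \<and> t^5 = 1 \<and> a' = k * (t^4 * a) \<and> b' = k * (t^3 * b) \<and> c' = k * (t^2 * c) \<and> d' = k * (t * d)"
proof -
  have nz: "p \<noteq> 0" "1 - p \<noteq> 0" "Y \<noteq> 0" and h: "Y^5 * p^2 * (1 - p) = p + 1" "Y'^5 * p^2 * (1 - p) = p + 1"
    using n(1) n'(1) by (simp_all add: bring_nf_def)
  have "Y^5 * (p^2 * (1 - p)) = Y'^5 * (p^2 * (1 - p))" using h by (simp only: mult.assoc)
  then have "Y^5 = Y'^5" using nz by simp
  then obtain t where t: "t^5 = 1" "Y' = t * Y" using nz(3) fifth_roots_of_unity_quotient by blast
  have td: "t * d \<noteq> 0" using t(1) n(5) by auto
  define k where "k = d' / (t * d)"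
  have k: "k \<noteq> 0" "d' = k * (t * d)" using td n'(5) by (simp_all add: k_def)
  have "a' = k * (t^4 * a)" "b' = k * (t^3 * b)" "c' = k * (t^2 * c)"
    unfolding n'(2-4) n(2-4) t(2) k(2) by Groebner_Basis.algebra+
  then show ?thesis using k t(1) by blast
qed

text \<open>Equal values of \<open>p - 1/p\<close> mean equal parameters or parameters with product
  -1. Equal parameters leave a fifth root of unity in \<open>Y\<close>, a rotation; in the other
  case the reversed quadruple has the same parameter, and a reflection is added.\<close>

lemma wmap_fibre:
  assumes e: "bring_eq a b c d" "\<not> (a = 0 \<and> b = 0 \<and> c = 0 \<and> d = 0)"
    and e': "bring_eq a' b' c' d'" "\<not> (a' = 0 \<and> b' = 0 \<and> c' = 0 \<and> d' = 0)"
    and w: "wmap a b c d = wmap a' b' c' d'"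
  shows "\<exists>k t. k \<noteq> 0 \<and> t^5 = 1 \<and>
    ((a' = k * (t^4 * a) \<and> b' = k * (t^3 * b) \<and> c' = k * (t^2 * c) \<and> d' = k * (t * d)) \<or>
     (a' = k * (t^4 * d) \<and> b' = k * (t^3 * c) \<and> c' = k * (t^2 * b) \<and> d' = k * (t * a)))"
proof -
  note same = bring_nf_same_fibre
  show ?thesis
    using e
  proof (cases rule: bring_eq_cases)
    case (generic p Y)
    note g = this
    have pn: "p - 1 / p \<noteq> 0" by (rule bring_nf_w_neq_0[OF g(1)])
    show ?thesis
      using e'
    proof (cases rule: bring_eq_cases)
      case (generic p' Y')
      note g' = this
      have p0: "p \<noteq> 0" "p' \<noteq> 0" using g(1) g'(1) by (simp_all add: bring_nf_def)
      have "p - 1 / p = p' - 1 / p'" using w g(6) g'(6) by simp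
      then have "p * p' * (p - 1 / p) = p * p' * (p' - 1 / p')" by simp
      moreover have "p * p' * (p - 1 / p) = p * p * p' - p'" "p * p' * (p' - 1 / p') = p * p' * p' - p"
        using p0 by (simp_all add: right_diff_distrib)
      ultimately have "(p - p') * (p * p' + 1) = 0" by Groebner_Basis.algebra
      then consider "p' = p" | "p * p' = -1" by (metis add_eq_0_iff2 eq_iff_diff_eq_0 mult_eq_0_iff)
      then show ?thesis
      proof cases
        case 1
        obtain k t where kt: "k \<noteq> 0" "t^5 = 1" "a' = k * (t^4 * a)" "b' = k * (t^3 * b)" "c' = k * (t^2 * c)" "d' = k * (t * d)"
          using same[OF g(1-5) g'(1-5)[unfolded 1]] by (elim exE conjE)
        then show ?thesis by (intro exI[of _ k] exI[of _ t]) simp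
      next
        case 2
        have sw: "bring_eq d' c' b' a'" using e'(1) by (simp only: bring_eq_swap)
        have da: "d' * a' \<noteq> 0" using g' p0 by (auto simp: bring_nf_def)
        obtain p2 Y2 where n2: "bring_nf p2 Y2" "d' = a' * (p2 * Y2^3)" "c' = a' * (p2 * Y2^2)" "b' = a' * - Y2"
          using bring_eq_normal_form[OF sw da] by (elim exE conjE)
        have Y20: "Y2 \<noteq> 0" "a' \<noteq> 0" "p2 \<noteq> 0" using n2(1) da by (auto simp: bring_nf_def)
        have "p2 * (b'^2) = a' * c'" unfolding n2 by Groebner_Basis.algebra
        moreover have "a' * c' * p' = - (b'^2)" unfolding g' by Groebner_Basis.algebra
        ultimately have "b'^2 * (p2 * p' + 1) = 0" by Groebner_Basis.algebra
        then have "p2 * p' = -1" using n2(4) Y20 by (simp add: add_eq_0_iff2)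
        then have p2: "p2 = p" using 2 p0 by (metis mult_right_cancel)
        obtain k t where kt: "k \<noteq> 0" "t^5 = 1" "d' = k * (t^4 * a)" "c' = k * (t^3 * b)" "b' = k * (t^2 * c)" "a' = k * (t * d)"
          using same[OF g(1-5) n2[unfolded p2] Y20(2)] by (elim exE conjE)
        \<comment> \<open>The reversed quadruple carries the powers of \<open>t\<close> in the
          opposite order; passing to \<open>t^4\<close>, the inverse of \<open>t\<close>, restores
          the order of the claim.\<close>
        have "(t^4)^5 = (t^5)^4" by Groebner_Basis.algebra
        then have "(t^4)^5 = 1" using kt(2) by simp
        moreover have "(t^4)^4 = t" "(t^4)^3 = t^2" "(t^4)^2 = t^3"
          using kt(2) by Groebner_Basis.algebra+
        ultimately show ?thesis using kt by (intro exI[of _ k] exI[of _ "t^4"]) simp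
      qed
    qed (use w g(6) pn in simp_all)
  next
    case a
    note a = this
    show ?thesis
      using e'
    proof (cases rule: bring_eq_cases)
      case (generic p Y)
      have "p - 1 / p \<noteq> 0" by (rule bring_nf_w_neq_0[OF generic(1)])
      then show ?thesis using w a generic by simp
    next
      case a'': a
      show ?thesis by (intro exI[of _ "a' / a"] exI[of _ 1]) (use a a'' in simp)
    next
      case d'': d
      show ?thesis by (intro exI[of _ "d' / a"] exI[of _ 1]) (use a d'' in simp)
    qed (use w a in simp_all)
  next
    case b
    note b = this
    show ?thesis
      using e'
    proof (cases rule: bring_eq_cases)
      case b'': b
      show ?thesis by (intro exI[of _ "b' / b"] exI[of _ 1]) (use b b'' in simp)
    next
      case c'': c
      show ?thesis by (intro exI[of _ "c' / b"] exI[of _ 1]) (use b c'' in simp)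
    qed (use w b in simp_all)
  next
    case c
    note c = this
    show ?thesis
      using e'
    proof (cases rule: bring_eq_cases)
      case b'': b
      show ?thesis by (intro exI[of _ "b' / c"] exI[of _ 1]) (use c b'' in simp)
    next
      case c'': c
      show ?thesis by (intro exI[of _ "c' / c"] exI[of _ 1]) (use c c'' in simp)
    qed (use w c in simp_all)
  next
    case d
    note d = this
    show ?thesis
      using e'
    proof (cases rule: bring_eq_cases)
      case (generic p Y)
      have "p - 1 / p \<noteq> 0" by (rule bring_nf_w_neq_0[OF generic(1)])
      then show ?thesis using w d generic by simp
    next
      case a'': a
      show ?thesis by (intro exI[of _ "a' / d"] exI[of _ 1]) (use d a'' in simp)
    next
      case d'': d
      show ?thesis by (intro exI[of _ "d' / d"] exI[of _ 1]) (use d d'' in simp)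
    qed (use w d in simp_all)
  qed
qed

text \<open>A disc is contractible, so a holomorphic function without zeros has a logarithm on
  it.\<close>

lemma holomorphic_nth_root_on_ball:
  assumes "f holomorphic_on ball w r" "\<And>x. x \<in> ball w r \<Longrightarrow> f x \<noteq> 0" "n > 0"
  obtains g where "g holomorphic_on ball w r" "\<And>x. x \<in> ball w r \<Longrightarrow> g x ^ n = f x"
proof -
  obtain l where l: "l holomorphic_on ball w r" "\<And>x. x \<in> ball w r \<Longrightarrow> f x = exp (l x)"
    using contractible_imp_holomorphic_log[OF assms(1) convex_imp_contractible[OF convex_ball] assms(2)]
    by metis
  have "(\<lambda>x. exp (l x / of_nat n)) holomorphic_on ball w r"
    using assms(3) by (intro holomorphic_intros l) auto
  moreover have "exp (l x / of_nat n) ^ n = f x" if "x \<in> ball w r" for x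
    using l(2)[OF that] assms(3) by (simp add: exp_of_nat_mult[symmetric])
  ultimately show thesis using that by blast
qed

text \<open>The excluded values are the branch points of the two roots to be extracted:
  \<open>\<plusminus> 2 * \<i>\<close> are the zeros of the discriminant \<open>w^2 + 4\<close> of
  \<open>p^2 - w * p - 1\<close>, and over \<open>w = 0\<close> the parameter is
  \<open>\<plusminus> 1\<close>, a zero or pole of \<open>Y^5\<close>.\<close>

lemma bring_nf_section:
  assumes "w0 \<noteq> 0" "w0 \<noteq> 2 * \<i>" "w0 \<noteq> - (2 * \<i>)"
  obtains r p Y where "r > 0" "p holomorphic_on ball w0 r" "Y holomorphic_on ball w0 r"
    "\<And>w. w \<in> ball w0 r \<Longrightarrow> bring_nf (p w) (Y w) \<and> p w - 1 / p w = w"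
proof -
  have "open (- {0, 2 * \<i>, - (2 * \<i>)})" by (intro open_Compl finite_imp_closed) simp
  then obtain r where r: "r > 0" "ball w0 r \<subseteq> - {0, 2 * \<i>, - (2 * \<i>)}"
    using assms open_contains_ball_eq[of "- {0, 2 * \<i>, - (2 * \<i>)}"] by auto
  have f0: "w^2 + 4 \<noteq> 0" if "w \<in> ball w0 r" for w
  proof -
    have "w^2 + 4 = (w - 2 * \<i>) * (w + 2 * \<i>)" by (simp add: algebra_simps power2_eq_square)
    moreover have "w - 2 * \<i> \<noteq> 0" "w + 2 * \<i> \<noteq> 0" using r that by (auto simp: add_eq_0_iff2)
    ultimately show ?thesis by simp
  qed
  obtain g where g: "g holomorphic_on ball w0 r" "\<And>w. w \<in> ball w0 r \<Longrightarrow> g w ^ 2 = w^2 + 4"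
    by (rule holomorphic_nth_root_on_ball[of "\<lambda>w. w^2 + 4" w0 r 2]) (use f0 in \<open>auto intro!: holomorphic_intros\<close>)
  define p where "p = (\<lambda>w. (w + g w) / 2)"
  have ph: "p holomorphic_on ball w0 r" unfolding p_def by (intro holomorphic_intros g) auto
  have pq: "p w ^ 2 = w * p w + 1" if "w \<in> ball w0 r" for w
  proof -
    have "4 * (p w ^ 2) = (w + g w)^2" by (simp add: p_def power_divide)
    also have "\<dots> = 4 * (w * p w + 1) + (g w ^ 2 - (w^2 + 4))"
      by (simp add: p_def power2_eq_square algebra_simps)
    finally have "4 * (p w ^ 2) = 4 * (w * p w + 1)" using g(2)[OF that] by simp
    then show ?thesis by (metis mult_left_cancel zero_neq_numeral)
  qed
  have pnz: "p w \<noteq> 0 \<and> p w \<noteq> 1 \<and> p w \<noteq> -1" if "w \<in> ball w0 r" for w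
  proof -
    have "w \<noteq> 0" using r(2) that by blast
    then show ?thesis using pq[OF that] by auto
  qed
  obtain Y where Y: "Y holomorphic_on ball w0 r"
     "\<And>w. w \<in> ball w0 r \<Longrightarrow> Y w ^ 5 = (p w + 1) / (p w ^ 2 * (1 - p w))"
    by (rule holomorphic_nth_root_on_ball[of "\<lambda>w. (p w + 1) / (p w ^ 2 * (1 - p w))" w0 r 5])
      (use pnz in \<open>auto intro!: holomorphic_intros ph simp: add_eq_0_iff2\<close>)
  have "bring_nf (p w) (Y w) \<and> p w - 1 / p w = w" if w: "w \<in> ball w0 r" for w
  proof
    have e: "Y w ^ 5 * p w ^ 2 * (1 - p w) = p w + 1" using Y(2)[OF w] pnz[OF w] by simp
    moreover have "Y w \<noteq> 0" using e pnz[OF w] by (auto simp: add_eq_0_iff2)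
    ultimately show "bring_nf (p w) (Y w)" using pnz[OF w] by (simp add: bring_nf_def)
    show "p w - 1 / p w = w" using pq[OF w] pnz[OF w] by (simp add: field_simps power2_eq_square)
  qed
  then show thesis using that r(1) ph Y(1) by blast
qed

lemma wmap_surj:
  assumes "P \<in> points CP1"
  shows "\<exists>a b c d. bring_eq a b c d \<and> \<not> (a = 0 \<and> b = 0 \<and> c = 0 \<and> d = 0) \<and> wmap a b c d = P"
  using assms
proof (cases rule: CP1_cases)
  case (1 w)
  show ?thesis
  proof (cases "w = 0")
    case True
    then show ?thesis using 1 by (intro exI[of _ 1] exI[of _ 0]) (simp add: bring_eq_def wmap_def)
  next
    case False
    define p where "p = (w + csqrt (w^2 + 4)) / 2"
    have "4 * (p ^ 2) = (w + csqrt (w^2 + 4))^2" by (simp add: p_def power_divide)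
    also have "\<dots> = 4 * (w * p + 1) + (csqrt (w^2 + 4) ^ 2 - (w^2 + 4))"
      by (simp add: p_def power2_eq_square algebra_simps)
    finally have "4 * p^2 = 4 * (w * p + 1)" by simp
    then have pq: "p^2 = w * p + 1" by (metis mult_left_cancel zero_neq_numeral)
    have pnz: "p \<noteq> 0" "p \<noteq> 1" "p \<noteq> -1" using pq False by auto
    define q where "q = (p + 1) / (p^2 * (1 - p))"
    have q0: "q \<noteq> 0" using pnz by (simp add: q_def add_eq_0_iff2)
    define Y where "Y = exp (Ln q / 5)"
    have "Y^5 = q" using q0 exp_of_nat_mult[of 5 "Ln q / 5"] by (simp add: Y_def)
    then have "bring_nf p Y" using pnz q0 by (auto simp: bring_nf_def q_def Y_def)
    moreover have "p - 1 / p = w" using pq pnz by (simp add: field_simps power2_eq_square)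
    ultimately show ?thesis using bring_nf_eq wmap_nf 1 by (metis zero_neq_one)
  qed
next
  case 2
  then show ?thesis by (intro exI[of _ 0] exI[of _ 1] exI[of _ 0]) (simp add: bring_eq_def wmap_def)
qed

section \<open>Quotients of projective curves that are projective lines\<close>

lemma holo_map_quotient_map:
  "holo_map X (cquotient X q) q"
  unfolding holo_map_def
proof (intro conjI allI impI ballI)
  show "continuous_map (ctop X) (ctop (cquotient X q)) q"
    by (auto simp: continuous_map_def openin_cquotient)
  fix V h assume "openin (ctop (cquotient X q)) V" "h \<in> hol (cquotient X q) V"
  then show "h \<circ> q \<in> hol X {p \<in> points X. q p \<in> V}" by (simp add: hol_cquotient)
qed

lemma openin_preimage_hol:
  assumes U: "openin (ctop (csubspace proj_space S)) U" and h: "h \<in> hol (csubspace proj_space S) U"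
    and A: "open A"
  shows "openin (ctop (csubspace proj_space S)) {p \<in> U. h p \<in> A}"
proof (subst openin_subopen, intro ballI)
  fix p assume "p \<in> {p \<in> U. h p \<in> A}"
  then have p: "p \<in> U" "h p \<in> A" by auto
  obtain V k where V: "openin (ctop proj_space) V" "p \<in> V" "k \<in> hol proj_space V" "\<forall>q\<in>U \<inter> V. h q = k q"
    using hol_csubspaceD[OF h p(1)] by (elim exE conjE)
  have oV: "open {x. x \<noteq> 0 \<and> line x \<in> V}" using V(1) by (simp add: openin_proj_space)
  have "continuous_on {x. x \<noteq> 0 \<and> line x \<in> V} (\<lambda>x. k (line x))"
    by (rule chol_continuous_on) (use V(3) hol_proj_space[OF V(1)] in blast)
  then have "open ((\<lambda>x. k (line x)) -` A \<inter> {x. x \<noteq> 0 \<and> line x \<in> V})"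
    using continuous_on_open_vimage[OF oV] A by blast
  moreover have "(\<lambda>x. k (line x)) -` A \<inter> {x. x \<noteq> 0 \<and> line x \<in> V} = {x. x \<noteq> 0 \<and> line x \<in> {q \<in> V. k q \<in> A}}"
    by auto
  moreover have "{q \<in> V. k q \<in> A} \<subseteq> line ` (- {0})" using V(1) by (auto simp: openin_proj_space)
  ultimately have "openin (ctop proj_space) {q \<in> V. k q \<in> A}" by (simp add: openin_proj_space)
  then have o: "openin (ctop (csubspace proj_space S)) ({q \<in> V. k q \<in> A} \<inter> S)"
    by (auto simp: openin_subtopology)
  have US: "U \<subseteq> S" using openin_subset[OF U] by simp
  have "openin (ctop (csubspace proj_space S)) (U \<inter> ({q \<in> V. k q \<in> A} \<inter> S))" using U o by blast
  moreover have "p \<in> U \<inter> ({q \<in> V. k q \<in> A} \<inter> S)" using p V US by auto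
  moreover have "U \<inter> ({q \<in> V. k q \<in> A} \<inter> S) \<subseteq> {p \<in> U. h p \<in> A}" using V(4) by auto
  ultimately show "\<exists>T. openin (ctop (csubspace proj_space S)) T \<and> p \<in> T \<and> T \<subseteq> {p \<in> U. h p \<in> A}"
    by blast
qed

text \<open>Sections are requested only off a finite set because over branch points none need exist;
  every point of \<open>F\<close> is treated as a removable singularity.\<close>

theorem quotient_biholomorphic_CP1:
  fixes S :: "(complex ^ 'n) set" and q :: "(complex ^ 'n) set \<Rightarrow> 'b"
  defines "X \<equiv> csubspace proj_space (line ` S)"
  assumes S: "0 \<notin> S" and compact: "compact_space (ctop X)"
    and f: "holo_map X CP1 f" and surj: "f ` points X = points CP1"
    and fibres: "\<And>P P'. P \<in> points X \<Longrightarrow> P' \<in> points X \<Longrightarrow> f P = f P' \<longleftrightarrow> q P = q P'"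
    and F: "finite F"
    and sections: "\<And>w. w \<notin> F \<Longrightarrow> \<exists>N \<gamma>. open N \<and> w \<in> N \<and>
       (\<forall>t\<in>N. \<gamma> t \<in> S \<and> f (line (\<gamma> t)) = fin t \<and> (\<forall>i. (\<lambda>t. \<gamma> t $ i) field_differentiable (at t)))"
  shows "\<exists>\<Psi>. biholomorphic (cquotient X q) CP1 \<Psi> \<and> (\<forall>P\<in>points X. \<Psi> (q P) = f P)"
proof -
  let ?Q = "cquotient X q"
  have lX: "local_hol X" unfolding X_def by (intro local_hol_csubspace local_hol_proj_space)
  define \<Psi> where "\<Psi> = (\<lambda>Q. f (SOME P. P \<in> points X \<and> q P = Q))"
  have Psi: "\<Psi> (q P) = f P" if P: "P \<in> points X" for P
  proof -
    have "(SOME P'. P' \<in> points X \<and> q P' = q P) \<in> points X \<and> q (SOME P'. P' \<in> points X \<and> q P' = q P) = q P"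
      by (rule someI[of _ P]) (simp add: P)
    then show ?thesis using fibres[OF _ P] unfolding \<Psi>_def by blast
  qed
  have pre: "{p \<in> points X. q p \<in> {Q \<in> points ?Q. \<Psi> Q \<in> W}} = {p \<in> points X. f p \<in> W}" for W
  proof (rule Collect_cong)
    fix p
    show "p \<in> points X \<and> q p \<in> {Q \<in> points ?Q. \<Psi> Q \<in> W} \<longleftrightarrow> p \<in> points X \<and> f p \<in> W"
      using Psi[of p] by auto
  qed
  have oPsi: "openin (ctop ?Q) {Q \<in> points ?Q. \<Psi> Q \<in> W}" if "openin (ctop CP1) W" for W
    unfolding openin_cquotient pre using holo_map_openin[OF f that] by auto
  have cPsi: "continuous_map (ctop ?Q) (ctop CP1) \<Psi>"
    unfolding continuous_map_def
  proof (intro conjI allI impI oPsi)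
    show "\<Psi> \<in> points ?Q \<rightarrow> points CP1" using Psi holo_map_in[OF f] by auto
  qed
  have hPsi: "holo_map ?Q CP1 \<Psi>"
    unfolding holo_map_def
  proof (intro conjI allI impI ballI cPsi)
    fix W h assume W: "openin (ctop CP1) W" "h \<in> hol CP1 W"
    have "h \<circ> \<Psi> \<circ> q \<in> hol X {p \<in> points X. f p \<in> W}"
      by (rule hol_cong[OF lX holo_map_openin[OF f W(1)] _ holo_mapD[OF f W]]) (simp add: Psi)
    then show "h \<circ> \<Psi> \<in> hol ?Q {Q \<in> points ?Q. \<Psi> Q \<in> W}"
      unfolding hol_cquotient pre .
  qed
  have "compact_space (ctop ?Q)"
    using image_compactin[OF compact[unfolded compact_space_def] holo_map_continuous[OF holo_map_quotient_map[of X q]]]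
    by (simp add: compact_space_def)
  moreover have "\<Psi> ` points ?Q = f ` points X"
    unfolding points_cquotient image_image by (rule image_cong[OF refl Psi])
  then have "\<Psi> ` points ?Q = points CP1" using surj by (rule trans)
  moreover have "inj_on \<Psi> (points ?Q)"
  proof (rule inj_onI)
    fix A B assume "A \<in> points ?Q" "B \<in> points ?Q" and e: "\<Psi> A = \<Psi> B"
    then obtain P P' where P: "P \<in> points X" "P' \<in> points X" "A = q P" "B = q P'" by auto
    then have "f P = f P'" using e Psi by simp
    then show "A = B" using fibres[OF P(1,2)] P by simp
  qed
  ultimately have "homeomorphic_map (ctop ?Q) (ctop CP1) \<Psi>"
    using continuous_imp_homeomorphic_map Hausdorff_space_CP1 cPsi by blast
  then obtain g where g: "homeomorphic_maps (ctop ?Q) (ctop CP1) \<Psi> g"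
    using homeomorphic_map_maps by blast
  then have cg: "continuous_map (ctop CP1) (ctop ?Q) g" and gPsi: "\<And>Q. Q \<in> points ?Q \<Longrightarrow> g (\<Psi> Q) = Q"
    by (auto simp: homeomorphic_maps_def)
  have gf: "g (f P) = q P" if "P \<in> points X" for P
    using gPsi[of "q P"] Psi[OF that] that by simp
  have "holo_map CP1 ?Q g"
    unfolding holo_map_def
  proof (intro conjI allI impI ballI cg)
    fix V h assume V: "openin (ctop ?Q) V" and h: "h \<in> hol ?Q V"
    define W where "W = {P \<in> points CP1. g P \<in> V}"
    have W: "openin (ctop CP1) W" using cg V by (auto simp: W_def continuous_map_def)
    define U where "U = {p \<in> points X. q p \<in> V}"
    have U: "openin (ctop X) U" using V by (simp add: U_def openin_cquotient)
    have hU: "h \<circ> q \<in> hol X U" using h by (simp add: U_def hol_cquotient)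
    \<comment> \<open>Continuity of \<open>h \<circ> g\<close> on all of \<open>W\<close>,
      exceptional points included: the preimage is open on the curve, hence in the quotient, hence
      on \<open>CP1\<close>.\<close>
    have oA: "openin (ctop CP1) {P \<in> W. h (g P) \<in> A}" if "open A" for A
    proof -
      have "openin (ctop X) {p \<in> U. (h \<circ> q) p \<in> A}"
        using openin_preimage_hol[of "line ` S" U "h \<circ> q" A] U hU that unfolding X_def by blast
      moreover have "{p \<in> points X. q p \<in> {Q \<in> V. h Q \<in> A}} = {p \<in> U. (h \<circ> q) p \<in> A}"
        by (auto simp: U_def)
      ultimately have "openin (ctop ?Q) {Q \<in> V. h Q \<in> A}"
        using V unfolding openin_cquotient by auto
      then have "openin (ctop CP1) {P \<in> points CP1. g P \<in> {Q \<in> V. h Q \<in> A}}"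
        using cg unfolding continuous_map_def by blast
      moreover have "{P \<in> points CP1. g P \<in> {Q \<in> V. h Q \<in> A}} = {P \<in> W. h (g P) \<in> A}"
        by (auto simp: W_def)
      ultimately show ?thesis by simp
    qed
    define A1 where "A1 = {z. fin z \<in> W}"
    define A2 where "A2 = {z. hc 1 z \<in> W}"
    have o1: "open A1" and o2: "open A2"
      unfolding A1_def A2_def by (intro openin_CP1_fin openin_CP1_infty W)+
    have c1: "continuous_on A1 (\<lambda>z. h (g (fin z)))"
      unfolding continuous_on_open_vimage[OF o1]
    proof (intro allI impI)
      fix B :: "complex set" assume B: "open B"
      have "(\<lambda>z. h (g (fin z))) -` B \<inter> A1 = {z. fin z \<in> {P \<in> W. h (g P) \<in> B}}" by (auto simp: A1_def)
      then show "open ((\<lambda>z. h (g (fin z))) -` B \<inter> A1)" using openin_CP1_fin[OF oA[OF B]] by simp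
    qed
    have c2: "continuous_on A2 (\<lambda>z. h (g (hc 1 z)))"
      unfolding continuous_on_open_vimage[OF o2]
    proof (intro allI impI)
      fix B :: "complex set" assume B: "open B"
      have "(\<lambda>z. h (g (hc 1 z))) -` B \<inter> A2 = {z. hc 1 z \<in> {P \<in> W. h (g P) \<in> B}}" by (auto simp: A2_def)
      then show "open ((\<lambda>z. h (g (hc 1 z))) -` B \<inter> A2)" using openin_CP1_infty[OF oA[OF B]] by simp
    qed
    \<comment> \<open>A section lifts the affine coordinate to the curve, where
      \<open>h \<circ> q\<close> is holomorphic by definition of the quotient; along the section it
      equals \<open>h \<circ> g\<close>.\<close>
    have d1: "(\<lambda>z. h (g (fin z))) field_differentiable (at w)" if w: "w \<in> A1" "w \<notin> F" for w
    proof -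
      obtain N \<gamma> where N: "open N" "w \<in> N"
        "\<forall>t\<in>N. \<gamma> t \<in> S \<and> f (line (\<gamma> t)) = fin t \<and> (\<forall>i. (\<lambda>t. \<gamma> t $ i) field_differentiable (at t))"
        using sections[OF w(2)] by (elim exE conjE)
      have pt: "line (\<gamma> t) \<in> points X" if "t \<in> N" for t
      proof -
        have "\<gamma> t \<in> S" using N(3) that by blast
        moreover from this have "\<gamma> t \<in> - {0}" using S by auto
        ultimately show ?thesis unfolding X_def points_csubspace points_proj_space by blast
      qed
      have gq: "g (fin t) = q (line (\<gamma> t))" if "t \<in> N" for t
        using gf[OF pt[OF that]] N(3) that by simp
      have "line (\<gamma> w) \<in> U" using gq[OF N(2)] pt[OF N(2)] w(1) by (simp add: U_def A1_def W_def)
      then have "(\<lambda>t. (h \<circ> q) (line (\<gamma> t))) field_differentiable (at w)"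
        using U hU N unfolding X_def by (intro hol_along_curve[OF S, of U "h \<circ> q" N w \<gamma>]) auto
      then show ?thesis
        by (rule field_differentiable_transform_open[OF _ N(1,2)]) (simp add: gq)
    qed
    have hol1: "(\<lambda>z. h (g (fin z))) holomorphic_on A1"
    proof (rule no_isolated_singularity[OF c1 _ o1 F])
      show "(\<lambda>z. h (g (fin z))) holomorphic_on A1 - F"
        unfolding holomorphic_on_def using d1 field_differentiable_at_within by blast
    qed
    \<comment> \<open>Off 0 the second chart is the first one after inversion, so infinity is the
      only point left to remove.\<close>
    have hol2: "(\<lambda>z. h (g (hc 1 z))) holomorphic_on A2"
    proof (rule no_isolated_singularity[OF c2 _ o2, of "{0}"])
      have "(\<lambda>z. h (g (hc 1 z))) field_differentiable (at w)" if w: "w \<in> A2" "w \<noteq> 0" for w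
      proof -
        have "1 / w \<in> A1" using w by (simp add: A1_def A2_def hc_fin)
        then have "(\<lambda>z. h (g (fin z))) field_differentiable (at (1 / w))"
          using hol1 o1 holomorphic_on_imp_differentiable_at by blast
        moreover have "(\<lambda>z. 1 / z) field_differentiable (at w)"
          using w by (intro derivative_intros field_differentiable_divide) auto
        ultimately have "((\<lambda>z. h (g (fin z))) \<circ> (\<lambda>z. 1 / z)) field_differentiable (at w)"
          by (intro field_differentiable_compose)
        then show ?thesis
          by (rule field_differentiable_transform_open[of _ _ "- {0}"]) (use w in \<open>auto simp: hc_fin\<close>)
      qed
      then show "(\<lambda>z. h (g (hc 1 z))) holomorphic_on A2 - {0}"
        unfolding holomorphic_on_def using field_differentiable_at_within by blast
    qed simp
    have "h \<circ> g \<in> hol CP1 W"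
      unfolding hol_CP1[OF W] comp_def
    proof (intro conjI allI impI)
      fix z assume "fin z \<in> W"
      then show "(\<lambda>z. h (g (fin z))) field_differentiable (at z)"
        using hol1 o1 holomorphic_on_imp_differentiable_at by (auto simp: A1_def)
    next
      fix z assume "hc 1 z \<in> W"
      then show "(\<lambda>z. h (g (hc 1 z))) field_differentiable (at z)"
        using hol2 o2 holomorphic_on_imp_differentiable_at by (auto simp: A2_def)
    qed
    then show "h \<circ> g \<in> hol CP1 {P \<in> points CP1. g P \<in> V}" by (simp add: W_def)
  qed
  then have "biholomorphic ?Q CP1 \<Psi>" unfolding biholomorphic_def using g hPsi by blast
  then show ?thesis using Psi by blast
qed

section \<open>Belyi pairs and their transport\<close>

definition unramified_off :: "'a cspace \<Rightarrow> ('a \<Rightarrow> cp1) \<Rightarrow> bool" where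
  "unramified_off X \<beta> \<longleftrightarrow> (\<forall>p\<in>points X. \<beta> p \<notin> {fin 0, fin 1, infty} \<longrightarrow>
     (\<exists>N. openin (ctop X) N \<and> p \<in> N \<and> inj_on \<beta> N))"

text \<open>Local injectivity replaces the condition on critical points because it mentions no
  charts and passes through any homeomorphism.\<close>

lemma belyi_pairI:
  assumes "riemann_surface X" "compact_space (ctop X)" "holo_map X CP1 \<beta>"
    "\<not> \<beta> constant_on points X" "unramified_off X \<beta>"
  shows "belyi_pair X \<beta>"
proof -
  have lX: "local_hol X" using assms(1) unfolding riemann_surface_def local_hol_def by blast
  have "\<beta> p \<in> {fin 0, fin 1, infty}" if p: "p \<in> points X" "critical_point X CP1 \<beta> p" for p
  proof (rule ccontr)
    assume "\<beta> p \<notin> {fin 0, fin 1, infty}"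
    then obtain N where "openin (ctop X) N" "p \<in> N" "inj_on \<beta> N"
      using assms(5) p(1) unfolding unramified_off_def by blast
    from locally_injective_not_critical[OF lX local_hol_CP1 assms(3) this] p(2) show False by contradiction
  qed
  then show ?thesis using assms unfolding belyi_pair_def by blast
qed

text \<open>Serves twice: for the quotient, with \<open>f\<close> its coordinate, and for
  \<open>beta_D10\<close>, with \<open>f\<close> the identity of \<open>CP1\<close>.\<close>

lemma belyi_pair_pullback:
  assumes X: "local_hol X" and f: "biholomorphic X CP1 f"
    and g: "holo_map CP1 CP1 \<gamma>" "\<not> \<gamma> constant_on points CP1" "unramified_off CP1 \<gamma>"
    and b: "\<And>p. p \<in> points X \<Longrightarrow> \<beta> p = \<gamma> (f p)"
  shows "belyi_pair X \<beta>"
proof -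
  obtain k where k: "homeomorphic_maps (ctop X) (ctop CP1) f k" and hf: "holo_map X CP1 f"
    using f unfolding biholomorphic_def by (elim exE conjE)
  have kf: "k (f p) = p" if "p \<in> points X" for p
    using k that by (simp add: homeomorphic_maps_def)
  have fk: "f (k P) = P" "k P \<in> points X" if "P \<in> points CP1" for P
    using k that by (auto simp: homeomorphic_maps_def continuous_map_def)
  show ?thesis
  proof (rule belyi_pairI)
    show "riemann_surface X" by (rule riemann_surface_pullback[OF X riemann_surface_CP1 f])
    have "ctop X homeomorphic_space ctop CP1" using k homeomorphic_space_def by blast
    then show "compact_space (ctop X)" using homeomorphic_compact_space compact_space_CP1 by blast
    show "holo_map X CP1 \<beta>"
      by (rule holo_map_cong[OF X holo_map_compose[OF X hf g(1)]]) (simp add: b)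
    show "\<not> \<beta> constant_on points X"
    proof
      assume "\<beta> constant_on points X"
      then obtain c where c: "\<And>p. p \<in> points X \<Longrightarrow> \<beta> p = c" unfolding constant_on_def by blast
      have "\<gamma> P = c" if "P \<in> points CP1" for P using fk[OF that] b[of "k P"] c[of "k P"] by simp
      then have "\<gamma> constant_on points CP1" unfolding constant_on_def by (intro exI[of _ c]) simp
      then show False using g(2) by contradiction
    qed
    show "unramified_off X \<beta>"
      unfolding unramified_off_def
    proof (intro ballI impI)
      fix p assume p: "p \<in> points X" "\<beta> p \<notin> {fin 0, fin 1, infty}"
      then have "f p \<in> points CP1" "\<gamma> (f p) \<notin> {fin 0, fin 1, infty}" using b holo_map_in[OF hf] by auto
      then obtain N where N: "openin (ctop CP1) N" "f p \<in> N" "inj_on \<gamma> N"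
        using g(3) unfolding unramified_off_def by blast
      have "inj_on \<beta> {p \<in> points X. f p \<in> N}"
      proof (rule inj_onI)
        fix x y assume xy: "x \<in> {p \<in> points X. f p \<in> N}" "y \<in> {p \<in> points X. f p \<in> N}" "\<beta> x = \<beta> y"
        then have x: "x \<in> points X" "f x \<in> N" and y: "y \<in> points X" "f y \<in> N" by blast+
        have "\<gamma> (f x) = \<gamma> (f y)"
          using xy(3) unfolding b[OF x(1)] b[OF y(1)] .
        then have "f x = f y" by (rule inj_onD[OF N(3) _ x(2) y(2)])
        then have "k (f x) = k (f y)" by (rule arg_cong)
        then show "x = y" unfolding kf[OF x(1)] kf[OF y(1)] .
      qed
      then show "\<exists>N. openin (ctop X) N \<and> p \<in> N \<and> inj_on \<beta> N"
        using holo_map_openin[OF hf N(1)] p(1) N(2)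
        by (intro exI[of _ "{p \<in> points X. f p \<in> N}"]) simp
    qed
  qed
qed

section \<open>The rational function of degree six and its ramification\<close>

definition D10_num :: "complex \<Rightarrow> complex \<Rightarrow> complex" where
  "D10_num u v = (u - v)^5 * ((2 + \<i>) * u + (2 - \<i>) * v)"

definition D10_den :: "complex \<Rightarrow> complex \<Rightarrow> complex" where
  "D10_den u v = (u + v)^5 * ((2 + \<i>) * u - (2 - \<i>) * v)"

lemma D10_scale:
  "D10_num (c * u) (c * v) = c^6 * D10_num u v" "D10_den (c * u) (c * v) = c^6 * D10_den u v"
  unfolding D10_num_def D10_den_def by Groebner_Basis.algebra+

lemma two_plus_i: "(2 + \<i>) \<noteq> 0" "(2 - \<i>) \<noteq> 0"
  by (simp_all add: complex_eq_iff)

lemma D10_nonzero: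
  assumes "u \<noteq> 0 \<or> v \<noteq> 0"
  shows "D10_num u v \<noteq> 0 \<or> D10_den u v \<noteq> 0"
proof (rule ccontr)
  assume "\<not> ?thesis"
  then have "u - v = 0 \<or> (2 + \<i>) * u + (2 - \<i>) * v = 0" "u + v = 0 \<or> (2 + \<i>) * u - (2 - \<i>) * v = 0"
    by (auto simp: D10_num_def D10_den_def)
  moreover have False if "u = v" "(2 + \<i>) * u - (2 - \<i>) * v = 0"
    using that assms by (auto simp: algebra_simps)
  moreover have False if "u + v = 0" "(2 + \<i>) * u + (2 - \<i>) * v = 0"
    using that assms by (auto simp: algebra_simps add_eq_0_iff2)
  moreover have False if "(2 + \<i>) * u + (2 - \<i>) * v = 0" "(2 + \<i>) * u - (2 - \<i>) * v = 0"
  proof -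
    have "2 * ((2 + \<i>) * u) = 0" "2 * ((2 - \<i>) * v) = 0" using that by Groebner_Basis.algebra+
    then show False using two_plus_i assms by simp
  qed
  ultimately show False using assms by auto
qed

definition D10_map :: "cp1 \<Rightarrow> cp1" where
  "D10_map = lift (\<lambda>x. hc (D10_num (x $ 1) (x $ 2)) (D10_den (x $ 1) (x $ 2)))"

lemma D10_map_line:
  assumes "x \<noteq> 0"
  shows "D10_map (line x) = hc (D10_num (x $ 1) (x $ 2)) (D10_den (x $ 1) (x $ 2))"
proof -
  have "hc (D10_num (c * y $ 1) (c * y $ 2)) (D10_den (c * y $ 1) (c * y $ 2)) =
      hc (D10_num (y $ 1) (y $ 2)) (D10_den (y $ 1) (y $ 2))" if "c \<noteq> 0" for c and y :: "complex ^ 2"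
    unfolding D10_scale by (rule hc_scale) (simp add: that)
  then show ?thesis unfolding D10_map_def using assms by (subst lift_line) auto
qed

lemma D10_map_hc: "u \<noteq> 0 \<or> v \<noteq> 0 \<Longrightarrow> D10_map (hc u v) = hc (D10_num u v) (D10_den u v)"
  using D10_map_line[of "vector [u, v]"] by (simp add: hc_def)

lemma holo_map_D10_map: "holo_map CP1 CP1 D10_map"
proof (rule holo_map_CP1_hom_pair)
  show "hom_pair 6 (\<lambda>x :: complex ^ 2. D10_num (x $ 1) (x $ 2)) (\<lambda>x. D10_den (x $ 1) (x $ 2))"
    unfolding hom_pair_def
    by (auto simp: D10_scale) (auto simp: D10_num_def D10_den_def intro!: chol_mult chol_power chol_add chol_diff)
  fix x :: "complex ^ 2" assume x: "x \<noteq> 0"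
  then have "x $ 1 \<noteq> 0 \<or> x $ 2 \<noteq> 0" by (auto simp: vec_eq_iff forall_2)
  then show "D10_num (x $ 1) (x $ 2) \<noteq> 0 \<or> D10_den (x $ 1) (x $ 2) \<noteq> 0" by (rule D10_nonzero)
  show "D10_map (line x) = hc (D10_num (x $ 1) (x $ 2)) (D10_den (x $ 1) (x $ 2))"
    by (rule D10_map_line[OF x])
qed

lemma finite_D10_den: "finite {x. D10_den x 1 = 0}"
proof -
  have "{x. D10_den x 1 = 0} \<subseteq> {-1, (2 - \<i>) / (2 + \<i>)}"
  proof
    fix x assume "x \<in> {x. D10_den x 1 = 0}"
    then consider "x + 1 = 0" | "(2 + \<i>) * x = 2 - \<i>" by (auto simp: D10_den_def)
    then show "x \<in> {-1, (2 - \<i>) / (2 + \<i>)}"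
      using two_plus_i by cases (auto simp: add_eq_0_iff2 eq_divide_eq mult.commute)
  qed
  then show ?thesis by (rule finite_subset) simp
qed

lemma beta_D10_eq:
  assumes "P \<in> points CP1"
  shows "beta_D10 P = D10_map P"
proof -
  let ?R = "{(fin x, ((x - 1)^5 * ((2 + \<i>) * x + (2 - \<i>))) / ((x + 1)^5 * ((2 + \<i>) * x - (2 - \<i>))))
      | x. (x + 1)^5 * ((2 + \<i>) * x - (2 - \<i>)) \<noteq> 0}"
  have "beta_D10 = restrict D10_map (points CP1)"
    unfolding beta_D10_def
  proof (rule meromorphic_given_by_eqI)
    show "restrict D10_map (points CP1) \<in> extensional (points CP1)" by simp
    show "holo_map CP1 CP1 (restrict D10_map (points CP1))"
      by (rule holo_map_cong[OF local_hol_CP1 holo_map_D10_map]) simp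
    show "\<forall>(p, w) \<in> ?R. restrict D10_map (points CP1) p = fin w"
    proof clarify
      fix x assume nz: "(x + 1)^5 * ((2 + \<i>) * x - (2 - \<i>)) \<noteq> 0"
      have "D10_map (fin x) = hc (D10_num x 1) (D10_den x 1)" unfolding fin_hc by (rule D10_map_hc) simp
      also have "\<dots> = fin (D10_num x 1 / D10_den x 1)" by (rule hc_fin) (use nz in \<open>simp add: D10_den_def\<close>)
      finally show "restrict D10_map (points CP1) (fin x) =
          fin (((x - 1)^5 * ((2 + \<i>) * x + (2 - \<i>))) / ((x + 1)^5 * ((2 + \<i>) * x - (2 - \<i>))))"
        by (simp add: D10_num_def D10_den_def)
    qed
    fix U assume U: "openin (ctop CP1) U" "U \<noteq> {}"
    show "\<exists>p\<in>U. p \<in> fst ` ?R"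
    proof (rule ccontr)
      assume n: "\<not> ?thesis"
      have "U \<subseteq> insert infty (fin ` {x. D10_den x 1 = 0})"
      proof
        fix P assume P: "P \<in> U"
        then have "P \<in> points CP1" using openin_subset[OF U(1)] by blast
        then show "P \<in> insert infty (fin ` {x. D10_den x 1 = 0})"
        proof (cases rule: CP1_cases)
          case (1 z)
          have "D10_den z 1 = 0"
          proof (rule ccontr)
            assume "D10_den z 1 \<noteq> 0"
            then have "P \<in> fst ` ?R" unfolding 1 by (force simp: D10_den_def)
            then show False using n P by blast
          qed
          then show ?thesis using 1 by blast
        qed simp
      qed
      then have "finite U" by (rule finite_subset) (simp add: finite_D10_den)
      then show False using openin_CP1_infinite[OF U] by contradiction
    qed
  qed
  then have "beta_D10 P = restrict D10_map (points CP1) P" by (rule fun_cong)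
  also have "\<dots> = D10_map P" by (rule restrict_apply'[OF assms])
  finally show ?thesis .
qed

text \<open>The numerator of the derivative of the quotient. The factor \<open>(x^2 - 1)^4\<close>
  comes from the quintuple zero at 1 and the quintuple pole at -1; the quadratic factor vanishes
  only over the value 1, by \<open>D10_minus\<close>.\<close>

lemma D10_wronskian:
  assumes "(N has_field_derivative N') (at x)" "(E has_field_derivative E') (at x)"
    and "N = (\<lambda>x. D10_num x 1)" "E = (\<lambda>x. D10_den x 1)"
  shows "N' * E x - N x * E' = 20 * \<i> * (x^2 - 1)^4 * ((2 - \<i>) * x^2 + (2 + \<i>))"
proof -
  have "(N has_field_derivative 5 * (x - 1)^4 * ((2 + \<i>) * x + (2 - \<i>)) + (x - 1)^5 * (2 + \<i>)) (at x)"
    unfolding assms(3) D10_num_def by (auto intro!: derivative_eq_intros)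
  then have N': "N' = 5 * (x - 1)^4 * ((2 + \<i>) * x + (2 - \<i>)) + (x - 1)^5 * (2 + \<i>)"
    using assms(1) DERIV_unique by blast
  have "(E has_field_derivative 5 * (x + 1)^4 * ((2 + \<i>) * x - (2 - \<i>)) + (x + 1)^5 * (2 + \<i>)) (at x)"
    unfolding assms(4) D10_den_def by (auto intro!: derivative_eq_intros)
  then have E': "E' = 5 * (x + 1)^4 * ((2 + \<i>) * x - (2 - \<i>)) + (x + 1)^5 * (2 + \<i>)"
    using assms(2) DERIV_unique by blast
  have i: "\<i>^2 + 1 = 0" by simp
  show ?thesis unfolding N' E' assms(3,4) D10_num_def D10_den_def mult_1_right using i by Groebner_Basis.algebra
qed

text \<open>The fibre over 1: two double points at the roots of the quadratic, a simple point at 0,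
  and another at infinity, seen in the drop of the degree from six to five.\<close>

lemma D10_minus: "D10_num x 1 - D10_den x 1 = - 4 * \<i> * x * ((2 - \<i>) * x^2 + (2 + \<i>))^2"
proof -
  have i: "\<i>^2 + 1 = 0" by simp
  show ?thesis unfolding D10_num_def D10_den_def mult_1_right using i by Groebner_Basis.algebra
qed

lemma openin_fin_image:
  assumes "open V"
  shows "openin (ctop CP1) (fin ` V)"
proof -
  have "openin (ctop (csubspace CP1 (range fin))) {p \<in> points (csubspace CP1 (range fin)). inv_into UNIV fin p \<in> V}"
    by (rule holo_map_openin[OF holo_map_inv_fin]) (simp add: complex_plane_def assms)
  moreover have "{p \<in> points (csubspace CP1 (range fin)). inv_into UNIV fin p \<in> V} = fin ` V"
    using fin_in_CP1 by (auto simp: inj_def)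
  ultimately show ?thesis using openin_range_fin by (auto simp: openin_open_subtopology)
qed

lemma unramified_D10_map: "unramified_off CP1 D10_map"
  unfolding unramified_off_def
proof (intro ballI impI)
  fix P assume "P \<in> points CP1" and nP: "D10_map P \<notin> {fin 0, fin 1, infty}"
  then show "\<exists>N. openin (ctop CP1) N \<and> P \<in> N \<and> inj_on D10_map N"
  proof (cases rule: CP1_cases)
    case 2
    \<comment> \<open>Numerator and denominator have the same leading coefficient, so infinity lies
      over 1.\<close>
    have "D10_map infty = hc (D10_num 1 0) (D10_den 1 0)" unfolding infty_hc by (rule D10_map_hc) simp
    also have "\<dots> = fin 1" using two_plus_i by (simp add: D10_num_def D10_den_def hc_fin)
    finally show ?thesis using nP 2 by simp
  next
    case (1 x)
    define R where "R = (\<lambda>x. D10_num x 1 / D10_den x 1)"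
    define A where "A = {x. D10_den x 1 \<noteq> 0}"
    have Rm: "D10_map (fin y) = fin (R y)" if "y \<in> A" for y
      unfolding fin_hc using that D10_map_hc[of y 1] hc_fin[of "D10_den y 1"] by (simp add: R_def A_def fin_hc)
    have oA: "open A" unfolding A_def D10_den_def by (intro open_Collect_neq continuous_intros)
    have x: "x \<in> A"
    proof (rule ccontr)
      assume "x \<notin> A"
      then have "D10_den x 1 = 0" "D10_num x 1 \<noteq> 0" using D10_nonzero[of x 1] by (auto simp: A_def)
      then have "D10_map P = infty" unfolding 1 fin_hc by (subst D10_map_hc) (auto simp: hc_infty)
      then show False using nP by simp
    qed
    have hN: "(\<lambda>x. D10_num x 1) holomorphic_on UNIV" and hD: "(\<lambda>x. D10_den x 1) holomorphic_on UNIV"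
      unfolding D10_num_def D10_den_def by (intro holomorphic_intros)+
    have hR: "R holomorphic_on A" unfolding R_def A_def
      by (intro holomorphic_on_divide holomorphic_on_subset[OF hN] holomorphic_on_subset[OF hD]) auto
    obtain N' where N': "((\<lambda>x. D10_num x 1) has_field_derivative N') (at x)"
      using hN by (auto simp: holomorphic_on_def field_differentiable_def)
    obtain E' where E': "((\<lambda>x. D10_den x 1) has_field_derivative E') (at x)"
      using hD by (auto simp: holomorphic_on_def field_differentiable_def)
    have nz: "D10_den x 1 \<noteq> 0" using x by (simp add: A_def)
    have "(R has_field_derivative (N' * D10_den x 1 - D10_num x 1 * E') / (D10_den x 1 * D10_den x 1)) (at x)"
      unfolding R_def by (rule DERIV_divide[OF N' E' nz])
    then have dR: "deriv R x = 20 * \<i> * (x^2 - 1)^4 * ((2 - \<i>) * x^2 + (2 + \<i>)) / (D10_den x 1 * D10_den x 1)"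
      using D10_wronskian[OF N' E' refl refl] by (simp add: DERIV_imp_deriv)
    have "x^2 - 1 \<noteq> 0"
    proof
      assume "x^2 - 1 = 0"
      then have "x = 1 \<or> x = -1" by (auto simp: power2_eq_1_iff)
      moreover have "x \<noteq> -1" using nz by (auto simp: D10_den_def)
      ultimately have "R x = 0" by (auto simp: R_def D10_num_def)
      then show False using nP Rm[OF x] 1 by simp
    qed
    moreover have "(2 - \<i>) * x^2 + (2 + \<i>) \<noteq> 0"
    proof
      assume "(2 - \<i>) * x^2 + (2 + \<i>) = 0"
      then have "D10_num x 1 = D10_den x 1" using D10_minus[of x] by simp
      then have "R x = 1" using nz by (simp add: R_def)
      then show False using nP Rm[OF x] 1 by simp
    qed
    ultimately have "deriv R x \<noteq> 0" unfolding dR using nz by simp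
    then obtain r where r: "r > 0" "ball x r \<subseteq> A" "inj_on R (ball x r)"
      using has_complex_derivative_locally_injective[OF hR x oA] by metis
    have "inj_on D10_map (fin ` ball x r)"
    proof (rule inj_onI)
      fix a b assume "a \<in> fin ` ball x r" "b \<in> fin ` ball x r" and e: "D10_map a = D10_map b"
      then obtain s t where st: "a = fin s" "b = fin t" "s \<in> ball x r" "t \<in> ball x r" by blast
      then have "R s = R t" using e Rm r(2) by (metis fin_inject subsetD)
      then show "a = b" using r(3) st by (auto dest: inj_onD)
    qed
    then show ?thesis using openin_fin_image[of "ball x r"] r(1) 1
      by (intro exI[of _ "fin ` ball x r"]) simp
  qed
qed

lemma D10_map_nonconstant: "\<not> D10_map constant_on points CP1"
proof
  assume "D10_map constant_on points CP1"
  then have "D10_map (fin 1) = D10_map (fin (-1))" unfolding constant_on_def by (metis fin_in_CP1)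
  moreover have "D10_map (fin 1) = fin 0"
    unfolding fin_hc by (subst D10_map_hc) (auto simp: D10_num_def D10_den_def hc_fin fin_hc[symmetric])
  moreover have "D10_map (fin (-1)) = infty"
    unfolding fin_hc by (subst D10_map_hc) (auto simp: D10_num_def D10_den_def hc_infty complex_eq_iff)
  ultimately show False by simp
qed

text \<open>The Moebius map turns the coordinate of \<open>wmap\<close> into that of \<open>beta_D10\<close>.\<close>

definition D10_coord :: "cp1 \<Rightarrow> cp1" where
  "D10_coord = moebius (2 - \<i>) (2 * \<i> * (2 - \<i>)) (2 + \<i>) (- (2 * \<i> * (2 + \<i>)))"

lemma biholomorphic_D10_coord: "biholomorphic CP1 CP1 D10_coord"
  unfolding D10_coord_def by (rule biholomorphic_moebius) (simp add: complex_eq_iff)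

text \<open>\<open>D10_coord\<close> is the Moebius map with -2i, 2i, 4 going to 0, infinity, 1. It
  then sends -1 to -1, so the quintuple zero and pole match, and 0 and infinity to the simple zero
  and the simple pole. The values \<open>\<plusminus> 2 * \<i>\<close>, fixed by
  \<open>w \<mapsto> -4 / w\<close>, become the two simple points over 1.\<close>

lemma D10_map_coord:
  "D10_map (D10_coord (fin w)) = hc (- w * (w - 4)^5) (64 * (w + 1)^5)"
proof -
  let ?u = "(2 - \<i>) * (w + 2 * \<i>)" and ?v = "(2 + \<i>) * (w - 2 * \<i>)"
  have nz: "?u \<noteq> 0 \<or> ?v \<noteq> 0" using two_plus_i by (auto simp: complex_eq_iff)
  have "D10_coord (fin w) = hc ?u ?v"
    unfolding fin_hc D10_coord_def by (subst moebius_hc) (auto simp: algebra_simps)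
  then have "D10_map (D10_coord (fin w)) = hc (D10_num ?u ?v) (D10_den ?u ?v)"
    using D10_map_hc[OF nz] by simp
  moreover have i: "\<i>^2 + 1 = 0" by simp
  have "D10_num ?u ?v = (320 * \<i>) * (- w * (w - 4)^5)" "D10_den ?u ?v = (320 * \<i>) * (64 * (w + 1)^5)"
    unfolding D10_num_def D10_den_def using i by Groebner_Basis.algebra+
  ultimately show ?thesis by (simp only:) (rule hc_scale, simp)
qed

section \<open>Labellings by a dihedral group\<close>

lemma UNIV_5: "(UNIV :: 5 set) = {0, 1, 2, 3, 4}"
proof -
  have "{0, 1, 2, 3, 4 :: 5} = UNIV" by (rule card_subset_eq) simp_all
  then show ?thesis ..
qed

lemma exhaust_5: "(i :: 5) = 0 \<or> i = 1 \<or> i = 2 \<or> i = 3 \<or> i = 4"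
  using UNIV_5 by blast

lemma sum_5: "(\<Sum>i\<in>(UNIV :: 5 set). f i) = f 0 + f 1 + f 2 + f 3 + f 4" for f :: "5 \<Rightarrow> complex"
  unfolding UNIV_5 by (simp add: add.assoc)

lemma Rep_5:
  "Rep_bit1 (0 :: 5) = 0" "Rep_bit1 (1 :: 5) = 1" "Rep_bit1 (2 :: 5) = 2"
  "Rep_bit1 (3 :: 5) = 3" "Rep_bit1 (4 :: 5) = 4"
  by (simp_all add: bit1.Rep_0 bit1.Rep_1 bit1.Rep_numeral)

lemma less_5: "(i :: 5) < j \<longleftrightarrow> (i, j) \<in> {(0, 1), (0, 2), (0, 3), (0, 4), (1, 2), (1, 3), (1, 4), (2, 3), (2, 4), (3, 4)}"
  using exhaust_5[of i] exhaust_5[of j] by (elim disjE) (simp_all add: less_bit1_def Rep_5)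

lemma vandermonde_explicit: "vandermonde x = vandermonde5 (\<lambda>j. x $ of_nat j)"
proof -
  have "{(i, j). (i :: 5) < j} = {(0, 1), (0, 2), (0, 3), (0, 4), (1, 2), (1, 3), (1, 4), (2, 3), (2, 4), (3, 4)}"
    unfolding less_5 by auto
  then show ?thesis by (simp add: vandermonde_def vandermonde5_def mult.assoc)
qed

lemma coeff_a_explicit: "coeff_a x = e4 (\<lambda>j. x $ of_nat j)"
proof -
  have "{(i, j, k, s). (i :: 5) < j \<and> j < k \<and> k < s} =
      {(0, 1, 2, 3), (0, 1, 2, 4), (0, 1, 3, 4), (0, 2, 3, 4), (1, 2, 3, 4)}"
  proof -
    have l: "(0 :: 5) < j \<longleftrightarrow> j = 1 \<or> j = 2 \<or> j = 3 \<or> j = 4" "(1 :: 5) < j \<longleftrightarrow> j = 2 \<or> j = 3 \<or> j = 4"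
      "(2 :: 5) < j \<longleftrightarrow> j = 3 \<or> j = 4" "(3 :: 5) < j \<longleftrightarrow> j = 4" "\<not> (4 :: 5) < j" for j
      unfolding less_5 by simp_all
    have *: "i < j \<and> j < k \<and> k < s \<longleftrightarrow>
        (i, j, k, s) \<in> {(0, 1, 2, 3), (0, 1, 2, 4), (0, 1, 3, 4), (0, 2, 3, 4), (1, 2, 3, 4)}" for i j k s :: 5
      using exhaust_5[of i] by (elim disjE; auto simp: l)
    show ?thesis
    proof (rule Set.set_eqI)
      fix q :: "5 \<times> 5 \<times> 5 \<times> 5"
      obtain i j k s where q: "q = (i, j, k, s)" by (cases q)
      show "q \<in> {(i, j, k, s). i < j \<and> j < k \<and> k < s} \<longleftrightarrow>
          q \<in> {(0, 1, 2, 3), (0, 1, 2, 4), (0, 1, 3, 4), (0, 2, 3, 4), (1, 2, 3, 4)}"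
        unfolding q mem_Collect_eq case_prod_conv by (rule *)
    qed
  qed
  then show ?thesis by (simp add: coeff_a_def e4_def)
qed

section \<open>The sign of a labelling and the choice of the root of unity\<close>

lemma vandermonde_transpose:
  assumes "a \<noteq> b"
  shows "vandermonde (\<chi> i. x $ Transposition.transpose a b i) = - vandermonde x"
proof -
  \<comment> \<open>With names for the differences, each transposition only reorders ten atoms and
    changes signs, and the product is never expanded.\<close>
  define d01 d02 d03 d04 d12 d13 d14 d23 d24 d34 where
    "d01 = x $ 0 - x $ 1" and "d02 = x $ 0 - x $ 2" and "d03 = x $ 0 - x $ 3" and "d04 = x $ 0 - x $ 4"
    and "d12 = x $ 1 - x $ 2" and "d13 = x $ 1 - x $ 3" and "d14 = x $ 1 - x $ 4"
    and "d23 = x $ 2 - x $ 3" and "d24 = x $ 2 - x $ 4" and "d34 = x $ 3 - x $ 4"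
  note d = this
  have e: "x $ 0 - x $ 1 = d01" "x $ 0 - x $ 2 = d02" "x $ 0 - x $ 3 = d03" "x $ 0 - x $ 4 = d04"
    "x $ 1 - x $ 2 = d12" "x $ 1 - x $ 3 = d13" "x $ 1 - x $ 4 = d14"
    "x $ 2 - x $ 3 = d23" "x $ 2 - x $ 4 = d24" "x $ 3 - x $ 4 = d34"
    "x $ 1 - x $ 0 = - d01" "x $ 2 - x $ 0 = - d02" "x $ 3 - x $ 0 = - d03" "x $ 4 - x $ 0 = - d04"
    "x $ 2 - x $ 1 = - d12" "x $ 3 - x $ 1 = - d13" "x $ 4 - x $ 1 = - d14"
    "x $ 3 - x $ 2 = - d23" "x $ 4 - x $ 2 = - d24" "x $ 4 - x $ 3 = - d34"
    by (simp_all add: d)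
  show ?thesis
    using assms exhaust_5[of a] exhaust_5[of b]
    by (elim disjE; simp add: vandermonde_explicit vandermonde5_def Transposition.transpose_def e mult_ac)
qed

lemma vandermonde_permutes:
  assumes "g permutes UNIV"
  shows "vandermonde (\<chi> i. x $ g i) = of_int (sign g) * vandermonde x"
proof -
  have "\<forall>x. vandermonde (\<chi> i. x $ g i) = of_int (sign g) * vandermonde x"
    using assms finite_class.finite_UNIV
  proof (induction rule: permutes_induct)
    case id
    show ?case by (simp add: sign_id)
  next
    case (swap a b p)
    show ?case
    proof
      fix x :: "complex ^ 5"
      let ?x = "\<chi> i. x $ Transposition.transpose a b i"
      have "permutation p" unfolding permutation_permutes
        by (intro exI[of _ UNIV] conjI swap.hyps) simp
      then have "sign (Transposition.transpose a b \<circ> p) = sign (Transposition.transpose a b) * sign p"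
        by (intro sign_compose permutation_swap_id)
      also have "\<dots> = - sign p" using swap by (simp add: sign_swap_id)
      finally have s: "sign (Transposition.transpose a b \<circ> p) = - sign p" .
      have "vandermonde (\<chi> i. x $ (Transposition.transpose a b \<circ> p) i) = vandermonde (\<chi> i. ?x $ p i)" by simp
      also have "\<dots> = of_int (sign p) * vandermonde ?x" by (rule spec[OF swap.IH])
      also have "vandermonde ?x = - vandermonde x" by (rule vandermonde_transpose) (rule swap.hyps)
      finally show "vandermonde (\<chi> i. x $ (Transposition.transpose a b \<circ> p) i) =
          of_int (sign (Transposition.transpose a b \<circ> p)) * vandermonde x"
        unfolding s by simp
    qed
  qed
  then show ?thesis by blast
qed

lemma bij_lessThan_5: "bij_betw (of_nat :: nat \<Rightarrow> 5) {..<5} UNIV"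
proof -
  have "{..<5 :: nat} = {0, 1, 2, 3, 4}" by auto
  then show ?thesis unfolding UNIV_5 bij_betw_def inj_on_def by simp
qed

lemma vandermonde_labelling:
  assumes "bij_betw lab {..<5} (UNIV :: 5 set)"
  obtains \<epsilon> :: complex where "\<epsilon> = 1 \<or> \<epsilon> = -1"
    "\<And>x. vandermonde5 (\<lambda>j. x $ lab j) = \<epsilon> * vandermonde x"
proof -
  define g where "g = lab \<circ> inv_into {..<5} (of_nat :: nat \<Rightarrow> 5)"
  have "bij_betw g UNIV UNIV"
    unfolding g_def by (rule bij_betw_trans[OF bij_betw_inv_into[OF bij_lessThan_5] assms])
  then have g: "g permutes UNIV" by (rule bij_imp_permutes) simp
  have gl: "g (of_nat j) = lab j" if "j < 5" for j
    using bij_betw_inv_into_left[OF bij_lessThan_5, of j] that by (simp add: g_def)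
  have gl': "g 0 = lab 0" "g 1 = lab 1" "g 2 = lab 2" "g 3 = lab 3" "g 4 = lab 4"
    using gl[of 0] gl[of 1] gl[of 2] gl[of 3] gl[of 4] by simp_all
  have "vandermonde5 (\<lambda>j. x $ lab j) = vandermonde (\<chi> i. x $ g i)" for x
    unfolding vandermonde_explicit by (simp add: vandermonde5_def gl'[simplified])
  then have "vandermonde5 (\<lambda>j. x $ lab j) = of_int (sign g) * vandermonde x" for x
    using vandermonde_permutes[OF g] by simp
  moreover have "of_int (sign g) = (1 :: complex) \<or> of_int (sign g) = (-1 :: complex)"
    by (simp add: sign_def)
  ultimately show thesis by (rule that[rotated])
qed

text \<open>The Gauss sum of a primitive fifth root squares to 5, and replacing \<open>z\<close> by
  \<open>z^2\<close> changes its sign. So either sign can be prescribed.\<close>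

lemma primitive_fifth_root:
  assumes "\<epsilon> = 1 \<or> \<epsilon> = (-1 :: complex)"
  shows "\<exists>z. 1 + z + z^2 + z^3 + z^4 = 0 \<and> z + z^4 - z^2 - z^3 = \<epsilon> * of_real (sqrt 5)"
proof -
  have "card {z :: complex. z^5 = 1} = 5" by (rule card_roots_unity_eq) simp
  then have "{z :: complex. z^5 = 1} \<noteq> {1}" by auto
  then obtain z :: complex where z: "z^5 = 1" "z \<noteq> 1" by force
  have "(z - 1) * (1 + z + z^2 + z^3 + z^4) = z^5 - 1" by Groebner_Basis.algebra
  then have p: "1 + z + z^2 + z^3 + z^4 = 0" using z by simp
  define s where "s = z + z^4 - z^2 - z^3"
  have "s^2 = 5" unfolding s_def using p by Groebner_Basis.algebra
  moreover have "(of_real (sqrt 5) :: complex)^2 = 5" by (simp flip: of_real_power)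
  ultimately have "s = of_real (sqrt 5) \<or> s = - of_real (sqrt 5)" by (metis power2_eq_iff)
  then have "s = \<epsilon> * of_real (sqrt 5) \<or> - s = \<epsilon> * of_real (sqrt 5)" using assms by auto
  then show ?thesis
  proof
    assume "s = \<epsilon> * of_real (sqrt 5)"
    then show ?thesis unfolding s_def using p by (intro exI[of _ z] conjI)
  next
    assume s: "- s = \<epsilon> * of_real (sqrt 5)"
    have "1 + z^2 + (z^2)^2 + (z^2)^3 + (z^2)^4 = 0" "z^2 + (z^2)^4 - (z^2)^2 - (z^2)^3 = - s"
      unfolding s_def using p by Groebner_Basis.algebra+
    then show ?thesis unfolding s[symmetric] by (intro exI[of _ "z^2"] conjI)
  qed
qed

text \<open>A nontrivial permutation of five points with fifth power the identity is a 5-cycle, so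
  following \<open>r\<close> from a moved point reaches everything. Starting at a fixed point of
  \<open>s\<close> turns \<open>s\<close> into negation of the labels modulo 5.\<close>

lemma dihedral_D10_labelling:
  fixes r s :: "5 \<Rightarrow> 5"
  assumes r5: "r \<circ> r \<circ> r \<circ> r \<circ> r = id" and r: "r \<noteq> id" and ss: "s \<circ> s = id"
    and srs: "s \<circ> r \<circ> s \<circ> r = id"
  obtains lab :: "nat \<Rightarrow> 5" where "bij_betw lab {..<5} UNIV" "\<And>j. j < 5 \<Longrightarrow> r (lab j) = lab ((j + 1) mod 5)"
    "\<And>j. j < 5 \<Longrightarrow> s (lab j) = lab ((5 - j) mod 5)"
proof -
  have r5': "(r ^^ 5) = id" using r5 by (simp add: eval_nat_numeral fun_eq_iff)
  have rmod: "(r ^^ n) = (r ^^ (n mod 5))" for n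
    by (rule ext) (metis funpow_mod_eq r5' id_apply)
  have bij: "bij r" by (rule o_bij[of "r \<circ> r \<circ> r \<circ> r"]) (use r5 in \<open>auto simp: fun_eq_iff\<close>)
  have sr: "s (r x) = (r ^^ 4) (s x)" for x
  proof -
    have "s (r (s (r x))) = x" using srs by (simp add: fun_eq_iff)
    then have "r (s (r x)) = s x" using ss by (metis comp_apply id_apply)
    then have "(r ^^ 4) (r (s (r x))) = (r ^^ 4) (s x)" by (rule arg_cong)
    moreover have "(r ^^ 4) (r y) = y" for y using fun_cong[OF r5, of y] by (simp add: eval_nat_numeral)
    ultimately show ?thesis by simp
  qed
  have srj: "s ((r ^^ j) x) = (r ^^ (4 * j)) (s x)" for j x
  proof (induction j)
    case (Suc j)
    have "s ((r ^^ Suc j) x) = s (r ((r ^^ j) x))" by simp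
    also have "\<dots> = (r ^^ 4) ((r ^^ (4 * j)) (s x))" unfolding sr Suc ..
    also have "\<dots> = (r ^^ (4 * Suc j)) (s x)" unfolding mult_Suc_right funpow_add comp_apply ..
    finally show ?case .
  qed simp
  \<comment> \<open>Such a \<open>d\<close> is invertible modulo 5, so a power of
    \<open>r ^^ d\<close> is \<open>r\<close> itself.\<close>
  have period: "r x = x" if "(r ^^ d) x = x" "0 < d" "d < 5" for d x
  proof -
    have it: "(r ^^ (d * e)) x = x" for e
    proof (induction e)
      case (Suc e)
      have "(r ^^ (d * Suc e)) x = (r ^^ d) ((r ^^ (d * e)) x)" unfolding mult_Suc_right funpow_add comp_apply ..
      then show ?case unfolding Suc that(1) .
    qed simp
    have "d = 1 \<or> d = 2 \<or> d = 3 \<or> d = 4" using that by linarith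
    then have "\<exists>e. (d * e) mod 5 = 1"
    proof (elim disjE)
      assume "d = 1" then show ?thesis by (intro exI[of _ 1]) simp
    next
      assume "d = 2" then show ?thesis by (intro exI[of _ 3]) simp
    next
      assume "d = 3" then show ?thesis by (intro exI[of _ 2]) simp
    next
      assume "d = 4" then show ?thesis by (intro exI[of _ 4]) simp
    qed
    then obtain e where "(d * e) mod 5 = 1" ..
    then have "(r ^^ (d * e)) = r" using rmod[of "d * e"] by simp
    then show ?thesis using it[of e] by simp
  qed
  have inj: "inj_on (\<lambda>j. (r ^^ j) a) {..<5}" if "r a \<noteq> a" for a
  proof -
    have *: False if "i < j" "j < 5" "(r ^^ i) a = (r ^^ j) a" for i j
    proof -
      have "(r ^^ i) a = (r ^^ i) ((r ^^ (j - i)) a)"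
        using that by (metis comp_apply funpow_add le_add_diff_inverse less_imp_le)
      moreover have "inj (r ^^ i)" using bij bij_is_inj inj_fn by blast
      ultimately have "(r ^^ (j - i)) a = a" by (metis injD)
      moreover have "0 < j - i" "j - i < 5" using that by linarith+
      ultimately show False using period[of "j - i" a] \<open>r a \<noteq> a\<close> by blast
    qed
    show ?thesis by (rule inj_onI) (metis * lessThan_iff linorder_neqE_nat)
  qed
  have bijlab: "bij_betw (\<lambda>j. (r ^^ j) a) {..<5} UNIV" if "r a \<noteq> a" for a
  proof -
    have "card ((\<lambda>j. (r ^^ j) a) ` {..<5}) = 5" using card_image[OF inj[OF that]] by simp
    then have "(\<lambda>j. (r ^^ j) a) ` {..<5} = UNIV" by (intro card_subset_eq) simp_all
    then show ?thesis using inj[OF that] by (simp add: bij_betw_def)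
  qed
  obtain a0 where a0: "r a0 \<noteq> a0" using r by (auto simp: fun_eq_iff)
  have "s a0 \<in> (\<lambda>j. (r ^^ j) a0) ` {..<5}" using bijlab[OF a0] by (simp add: bij_betw_def)
  then obtain c where c: "s a0 = (r ^^ c) a0" by blast
  \<comment> \<open>The point \<open>(r ^^ m) a0\<close> is fixed by \<open>s\<close> when
    \<open>2 * m = c\<close> modulo 5, and 3 is the inverse of 2.\<close>
  define a where "a = (r ^^ (3 * c)) a0"
  have "s a = (r ^^ (4 * (3 * c))) ((r ^^ c) a0)" unfolding a_def srj c ..
  also have "\<dots> = (r ^^ (4 * (3 * c) + c)) a0" by (simp only: funpow_add comp_apply)
  also have "\<dots> = (r ^^ ((4 * (3 * c) + c) mod 5)) a0" by (rule fun_cong[OF rmod])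
  also have "(4 * (3 * c) + c) mod 5 = (3 * c) mod 5" by presburger
  also have "(r ^^ ((3 * c) mod 5)) a0 = a" unfolding a_def by (rule fun_cong[OF rmod[symmetric]])
  finally have sa: "s a = a" .
  have ra: "r a \<noteq> a"
  proof
    assume "r a = a"
    then have "(r ^^ (3 * c)) (r a0) = (r ^^ (3 * c)) a0" unfolding a_def by (simp add: funpow_swap1)
    moreover have "inj (r ^^ (3 * c))" using bij bij_is_inj inj_fn by blast
    ultimately show False using a0 by (metis injD)
  qed
  show thesis
  proof (rule that[of "\<lambda>j. (r ^^ j) a"])
    show "bij_betw (\<lambda>j. (r ^^ j) a) {..<5} UNIV" by (rule bijlab[OF ra])
    fix j :: nat assume "j < 5"
    have "r ((r ^^ j) a) = (r ^^ (j + 1)) a" by simp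
    also have "\<dots> = (r ^^ ((j + 1) mod 5)) a" by (rule fun_cong[OF rmod])
    finally show "r ((r ^^ j) a) = (r ^^ ((j + 1) mod 5)) a" .
    have "s ((r ^^ j) a) = (r ^^ (4 * j)) a" unfolding srj sa ..
    also have "\<dots> = (r ^^ ((4 * j) mod 5)) a" by (rule fun_cong[OF rmod])
    also have "(4 * j) mod 5 = (5 - j) mod 5"
    proof -
      have "j = 0 \<or> j = 1 \<or> j = 2 \<or> j = 3 \<or> j = 4" using \<open>j < 5\<close> by linarith
      then show ?thesis by (elim disjE) simp_all
    qed
    finally show "s ((r ^^ j) a) = (r ^^ ((5 - j) mod 5)) a" .
  qed
qed

section \<open>Bring's curve in Fourier coordinates\<close>

text \<open>Newton's identity for vanishing first and second power sums. A sum of fourth powers does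
  not depend on the order of the coordinates, so \<open>e4\<close> may be evaluated in the order of
  any labelling.\<close>

lemma e4_power_sum:
  assumes "f 0 + f 1 + f 2 + f 3 + f 4 = 0" "f 0 ^ 2 + f 1 ^ 2 + f 2 ^ 2 + f 3 ^ 2 + f 4 ^ 2 = 0"
  shows "- 4 * e4 f = f 0 ^ 4 + f 1 ^ 4 + f 2 ^ 4 + f 3 ^ 4 + f 4 ^ 4"
proof -
  define a b c d where "a = f 1" and "b = f 2" and "c = f 3" and "d = f 4"
  have f: "f 1 = a" "f 2 = b" "f 3 = c" "f 4 = d" "f 0 = - (a + b + c + d)"
    using assms(1) by (simp_all only: a_def b_def c_def d_def eq_neg_iff_add_eq_0 add.assoc[symmetric])
  have h: "(- (a + b + c + d)) ^ 2 + a ^ 2 + b ^ 2 + c ^ 2 + d ^ 2 = 0"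
    using assms(2) unfolding f .
  let ?T = "(- (a + b + c + d)) ^ 4 + a ^ 4 + b ^ 4 + c ^ 4 + d ^ 4 + 4 *
      (- (a + b + c + d) * a * b * c + - (a + b + c + d) * a * b * d + - (a + b + c + d) * a * c * d
       + - (a + b + c + d) * b * c * d + a * b * c * d)"
  have "2 * ?T = ((- (a + b + c + d)) ^ 2 + a ^ 2 + b ^ 2 + c ^ 2 + d ^ 2) ^ 2"
    by Groebner_Basis.algebra
  also have "\<dots> = 0" unfolding h by simp
  finally have "?T = 0" by (metis mult_eq_0_iff zero_neq_numeral)
  then show ?thesis unfolding e4_def f by Groebner_Basis.algebra
qed

definition linear_form :: "(complex ^ 'n \<Rightarrow> complex) \<Rightarrow> bool" where
  "linear_form a \<longleftrightarrow> (\<forall>x. chol a x) \<and> (\<forall>c x. a (c *s x) = c * a x)"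

lemma hom_pair_generic:
  assumes "linear_form a" "linear_form b" "linear_form c" "linear_form d"
  shows "hom_pair 4 (\<lambda>x. (a x * c x + b x ^ 2) * (d x * b x + c x ^ 2)) (\<lambda>x. (a x * d x) ^ 2)"
proof -
  have l: "f (k *s x) = k * f x" "chol f x" if "f \<in> {a, b, c, d}" for f k x
    using assms that by (auto simp: linear_form_def)
  have "(k * a x * (k * c x) + (k * b x) ^ 2) * (k * d x * (k * b x) + (k * c x) ^ 2) =
      k ^ 4 * ((a x * c x + b x ^ 2) * (d x * b x + c x ^ 2))"
    and "(k * a x * (k * d x)) ^ 2 = k ^ 4 * (a x * d x) ^ 2" for k x
    by Groebner_Basis.algebra+
  then show ?thesis unfolding hom_pair_def
    by (intro conjI allI chol_mult chol_add chol_power l(2)) (simp_all add: l(1))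
qed

text \<open>The second pair is the first one followed by the involution
  \<open>w \<mapsto> -4 / w\<close> of \<open>wmap_rot4\<close>.\<close>

lemma hom_pair_patch:
  assumes "linear_form a" "linear_form b" "linear_form c" "linear_form d"
  shows "hom_pair 8 (\<lambda>x. patch_num (a x) (b x) (c x) (d x)) (\<lambda>x. patch_den (a x) (b x) (c x) (d x))"
    and "hom_pair 8 (\<lambda>x. - 4 * patch_den (a x) (b x) (c x) (d x)) (\<lambda>x. patch_num (a x) (b x) (c x) (d x))"
proof -
  have l: "f (k *s x) = k * f x" "chol f x" if "f \<in> {a, b, c, d}" for f k x
    using assms that by (auto simp: linear_form_def)
  have p: "patch_num (k * a x) (k * b x) (k * c x) (k * d x) = k ^ 8 * patch_num (a x) (b x) (c x) (d x)"
    "patch_den (k * a x) (k * b x) (k * c x) (k * d x) = k ^ 8 * patch_den (a x) (b x) (c x) (d x)" for k x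
    unfolding patch_num_def patch_den_def by Groebner_Basis.algebra+
  have ch: "chol (\<lambda>x. patch_num (a x) (b x) (c x) (d x)) x" "chol (\<lambda>x. patch_den (a x) (b x) (c x) (d x)) x" for x
    unfolding patch_num_def patch_den_def
    by (intro chol_mult chol_add chol_power chol_diff chol_uminus l(2); simp)+
  show "hom_pair 8 (\<lambda>x. patch_num (a x) (b x) (c x) (d x)) (\<lambda>x. patch_den (a x) (b x) (c x) (d x))"
    unfolding hom_pair_def by (simp add: l p ch)
  show "hom_pair 8 (\<lambda>x. - 4 * patch_den (a x) (b x) (c x) (d x)) (\<lambda>x. patch_num (a x) (b x) (c x) (d x))"
    unfolding hom_pair_def by (auto simp: l p intro!: chol_mult chol_const ch)
qed

section \<open>Permutations acting on the curve, and its compactness\<close>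

definition actv :: "(5 \<Rightarrow> 5) \<Rightarrow> complex ^ 5 \<Rightarrow> complex ^ 5" where
  "actv g x = (\<chi> i. x $ inv_into UNIV g i)"

lemma actv_scale: "actv g (c *s x) = c *s actv g x"
  by (simp add: actv_def vec_eq_iff)

lemma act_line: "act g (line x) = line (actv g x)"
  unfolding act_def line_def image_image actv_def[symmetric] actv_scale ..

lemma actv_compose:
  assumes "bij g" "bij h"
  shows "actv g (actv h x) = actv (g \<circ> h) x"
  by (simp add: actv_def vec_eq_iff o_inv_distrib[OF assms])

lemma actv_id: "actv id x = x"
  by (simp add: actv_def vec_eq_iff inv_id[unfolded id_def] id_def)

lemma actv_nth: "bij g \<Longrightarrow> actv g x $ g i = x $ i"
  by (simp add: actv_def inv_f_f bij_is_inj)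

lemma on_bring_actv:
  assumes "bij g" "on_bring x"
  shows "on_bring (actv g x)"
proof -
  have "(\<Sum>i\<in>UNIV. f (actv g x $ i)) = (\<Sum>i\<in>UNIV. f (x $ i))" for f :: "complex \<Rightarrow> complex"
    using sum.reindex_bij_betw[OF assms(1), of "\<lambda>i. f (actv g x $ i)"] by (simp add: actv_nth[OF assms(1)])
  note s = this[of "\<lambda>t. t"] this[of "\<lambda>t. t ^ 2"] this[of "\<lambda>t. t ^ 3"]
  have "actv g x \<noteq> 0"
  proof
    assume "actv g x = 0"
    then have "x $ i = 0" for i using actv_nth[OF assms(1), of x i] by simp
    then show False using assms(2) by (auto simp: on_bring_def vec_eq_iff)
  qed
  then show ?thesis using assms(2) unfolding on_bring_def s by simp
qed

lemma on_bring_nz: "0 \<notin> {x. on_bring x}"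
  by (simp add: on_bring_def)

lemma on_bring_scale: "c \<noteq> 0 \<Longrightarrow> on_bring x \<Longrightarrow> on_bring (c *s x)"
  by (simp add: on_bring_def power_mult_distrib sum_distrib_left[symmetric])

lemma points_bring: "points bring = line ` {x. on_bring x}"
  using on_bring_nz by (auto simp: bring_def points_proj_space)

lemma local_hol_bring: "local_hol bring"
  unfolding bring_def by (intro local_hol_csubspace local_hol_proj_space)

lemma compact_space_bring: "compact_space (ctop bring)"
proof -
  let ?K = "{x :: complex ^ 5. on_bring x} \<inter> sphere 0 1"
  have "?K = {x. (\<Sum>i\<in>UNIV. x $ i) = 0} \<inter> {x. (\<Sum>i\<in>UNIV. (x $ i)^2) = 0} \<inter> {x. (\<Sum>i\<in>UNIV. (x $ i)^3) = 0} \<inter> sphere 0 1"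
    by (auto simp: on_bring_def)
  also have "compact \<dots>"
    by (intro closed_Int_compact closed_Int closed_Collect_eq continuous_intros compact_sphere)
  finally have "compact ?K" .
  then have "compactin (ctop proj_space) (line ` ?K)"
    by (rule compactin_line) (simp add: on_bring_def)
  moreover have "line ` {x. on_bring x} = line ` ?K"
    by (rule line_image_sphere) (auto simp: on_bring_scale on_bring_nz[simplified])
  ultimately have "compactin (ctop proj_space) (line ` {x. on_bring x})" by simp
  then show ?thesis
    unfolding bring_def by (simp add: compact_space_subtopology)
qed

lemma openin_bring_act:
  assumes g: "bij g" and U: "openin (ctop bring) U"
  shows "openin (ctop bring) {P \<in> points bring. act g P \<in> U}"
proof -
  obtain V where V: "openin (ctop proj_space) V" "U = V \<inter> line ` {x. on_bring x}"
    using U unfolding bring_def by (auto simp: openin_subtopology)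
  have nz: "actv g x \<noteq> 0" if "x \<noteq> 0" for x
  proof
    assume "actv g x = 0"
    then have "x $ i = 0" for i using actv_nth[OF g, of x i] by simp
    then show False using that by (simp add: vec_eq_iff)
  qed
  let ?T = "{x. actv g x \<noteq> 0 \<and> line (actv g x) \<in> V} \<inter> - {0}"
  have "open (actv g -` {x. x \<noteq> 0 \<and> line x \<in> V})"
    using V(1) unfolding openin_proj_space actv_def
    by (intro open_vimage continuous_intros) auto
  then have oT: "open ?T" by (auto simp: vimage_def)
  have cT: "c *s x \<in> ?T" if "c \<noteq> 0" "x \<in> ?T" for c x
    using that by (auto simp: actv_scale line_scale)
  have zT: "0 \<notin> ?T" by simp
  have "openin (ctop proj_space) (line ` ?T)" by (rule openin_cone(1)[OF oT zT cT])
  then have "openin (ctop bring) (line ` ?T \<inter> line ` {x. on_bring x})"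
    unfolding bring_def by (auto simp: openin_subtopology)
  moreover have "line ` ?T \<inter> line ` {x. on_bring x} = {P \<in> points bring. act g P \<in> U}"
  proof (intro equalityI subsetI)
    fix P assume P: "P \<in> line ` ?T \<inter> line ` {x. on_bring x}"
    then obtain x where x: "on_bring x" "P = line x" by blast
    have x0: "x \<noteq> 0" using x by (auto simp: on_bring_def)
    have "line x \<in> line ` ?T \<longleftrightarrow> x \<in> ?T" by (rule openin_cone(2)[OF oT zT cT x0])
    then have "line (actv g x) \<in> V" using P x by blast
    then show "P \<in> {P \<in> points bring. act g P \<in> U}"
      using x on_bring_actv[OF g x(1)] V(2) by (auto simp: points_bring act_line)
  next
    fix P assume P: "P \<in> {P \<in> points bring. act g P \<in> U}"
    then obtain x where x: "on_bring x" "P = line x" by (auto simp: points_bring)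
    have x0: "x \<noteq> 0" using x by (auto simp: on_bring_def)
    have "x \<in> ?T" using P x x0 nz V(2) by (auto simp: act_line)
    then show "P \<in> line ` ?T \<inter> line ` {x. on_bring x}" using x by blast
  qed
  ultimately show ?thesis by simp
qed

section \<open>Fourier coordinates for a fixed cyclic order of the coordinates\<close>

locale bring_labelling =
  fixes lab :: "nat \<Rightarrow> 5" and z :: complex
  assumes lab: "bij_betw lab {..<5} UNIV" and z: "1 + z + z^2 + z^3 + z^4 = 0"
begin

definition Y :: "nat \<Rightarrow> complex ^ 5 \<Rightarrow> complex" where
  "Y k x = dft z (\<lambda>j. x $ lab j) k"

definition vec_of :: "complex \<Rightarrow> complex \<Rightarrow> complex \<Rightarrow> complex \<Rightarrow> complex ^ 5" where
  "vec_of a b c d = (\<chi> i. idft z a b c d (inv_into {..<5} lab i))"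

definition W :: "complex ^ 5 \<Rightarrow> cp1" where
  "W x = wmap (Y 1 x) (Y 2 x) (Y 3 x) (Y 4 x)"

definition phi :: "cp4 \<Rightarrow> cp1" where
  "phi = lift W"

lemma sum_lab: "(\<Sum>i\<in>UNIV. f i) = f (lab 0) + f (lab 1) + f (lab 2) + f (lab 3) + f (lab 4)"
  for f :: "5 \<Rightarrow> complex"
  using sum.reindex_bij_betw[OF lab, of f] by (simp only: sum5)

lemma prod_lab: "(\<Prod>i\<in>UNIV. f i) = f (lab 0) * f (lab 1) * f (lab 2) * f (lab 3) * f (lab 4)"
  for f :: "5 \<Rightarrow> complex"
  using prod.reindex_bij_betw[OF lab, of f] by (simp only: prod5)

lemma lab_surj: obtains j where "j < 5" "i = lab j"
  using lab unfolding bij_betw_def by (metis UNIV_I imageE lessThan_iff)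

lemma vec_eq_lab:
  fixes x y :: "complex ^ 5"
  assumes "\<And>j. j < 5 \<Longrightarrow> x $ lab j = y $ lab j"
  shows "x = y"
  unfolding vec_eq_iff
proof
  fix i obtain j where "j < 5" "i = lab j" by (rule lab_surj)
  then show "x $ i = y $ i" using assms by simp
qed

lemma vec_of_lab: "j < 5 \<Longrightarrow> vec_of a b c d $ lab j = idft z a b c d j"
  using bij_betw_inv_into_left[OF lab, of j] by (simp add: vec_of_def)

lemma Y_scale: "Y k (c *s x) = c * Y k x"
  by (simp add: Y_def dft_def sum_distrib_left algebra_simps)

lemma linear_form_Y: "linear_form (Y k)"
proof -
  have "Y k = (\<lambda>x. \<Sum>j<5. z ^ (k * j) * x $ lab j)" by (simp add: fun_eq_iff Y_def dft_def)
  then have "chol (Y k) x" for x by (simp only:) (intro chol_sum chol_mult chol_const chol_nth)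
  then show ?thesis unfolding linear_form_def by (intro conjI allI Y_scale)
qed

lemma Y_vec_of:
  "Y 1 (vec_of a b c d) = 5 * a" "Y 2 (vec_of a b c d) = 5 * b"
  "Y 3 (vec_of a b c d) = 5 * c" "Y 4 (vec_of a b c d) = 5 * d"
proof -
  have "Y k (vec_of a b c d) = dft z (idft z a b c d) k" for k
    unfolding Y_def dft_def by (rule sum.cong) (simp_all add: vec_of_lab)
  then show "Y 1 (vec_of a b c d) = 5 * a" "Y 2 (vec_of a b c d) = 5 * b"
    "Y 3 (vec_of a b c d) = 5 * c" "Y 4 (vec_of a b c d) = 5 * d"
    by (simp_all only: dft_idft[OF z])
qed

lemma on_bring_idft:
  assumes "on_bring x" "j < 5"
  shows "5 * x $ lab j = idft z (Y 1 x) (Y 2 x) (Y 3 x) (Y 4 x) j"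
proof -
  have "(\<Sum>i\<in>UNIV. x $ i) = 0" using assms(1) by (simp add: on_bring_def)
  then have "x $ lab 0 + x $ lab 1 + x $ lab 2 + x $ lab 3 + x $ lab 4 = 0" unfolding sum_lab .
  from idft_dft[OF z this assms(2)] show ?thesis unfolding Y_def by (rule sym)
qed

lemma on_bring_Y:
  assumes x: "on_bring x"
  shows "bring_eq (Y 1 x) (Y 2 x) (Y 3 x) (Y 4 x)"
    and "\<not> (Y 1 x = 0 \<and> Y 2 x = 0 \<and> Y 3 x = 0 \<and> Y 4 x = 0)"
proof -
  let ?X = "idft z (Y 1 x) (Y 2 x) (Y 3 x) (Y 4 x)"
  have X: "?X j = 5 * x $ lab j" if "j < 5" for j using on_bring_idft[OF x that] by simp
  have "(\<Sum>j<5. ?X j ^ 2) = (\<Sum>j<5. 25 * (x $ lab j) ^ 2)" by (rule sum.cong) (simp_all add: X power_mult_distrib del: One_nat_def)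
  also have "\<dots> = 25 * (\<Sum>i\<in>UNIV. (x $ i) ^ 2)" unfolding sum5 sum_lab by (simp add: algebra_simps)
  also have "\<dots> = 0" using x by (simp add: on_bring_def)
  finally have 2: "10 * (Y 1 x * Y 4 x + Y 2 x * Y 3 x) = 0" unfolding idft_sum2[OF z] .
  have "(\<Sum>j<5. ?X j ^ 3) = (\<Sum>j<5. 125 * (x $ lab j) ^ 3)" by (rule sum.cong) (simp_all add: X power_mult_distrib del: One_nat_def)
  also have "\<dots> = 125 * (\<Sum>i\<in>UNIV. (x $ i) ^ 3)" unfolding sum5 sum_lab by (simp add: algebra_simps)
  also have "\<dots> = 0" using x by (simp add: on_bring_def)
  finally have 3: "15 * ((Y 1 x)^2 * Y 3 x + (Y 2 x)^2 * Y 1 x + (Y 4 x)^2 * Y 2 x + (Y 3 x)^2 * Y 4 x) = 0"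
    unfolding idft_sum3[OF z] .
  show "bring_eq (Y 1 x) (Y 2 x) (Y 3 x) (Y 4 x)"
    unfolding bring_eq_def using 2 3 by (metis mult_eq_0_iff zero_neq_numeral)
  show "\<not> (Y 1 x = 0 \<and> Y 2 x = 0 \<and> Y 3 x = 0 \<and> Y 4 x = 0)"
  proof
    assume "Y 1 x = 0 \<and> Y 2 x = 0 \<and> Y 3 x = 0 \<and> Y 4 x = 0"
    then have "x $ lab j = 0" if "j < 5" for j using X[OF that] by (simp add: idft_def)
    then have "x = 0" by (intro vec_eq_lab) simp
    then show False using x by (simp add: on_bring_def)
  qed
qed

lemma on_bring_vec_of:
  assumes "bring_eq a b c d" "\<not> (a = 0 \<and> b = 0 \<and> c = 0 \<and> d = 0)"
  shows "on_bring (vec_of a b c d)"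
proof -
  have l: "(\<Sum>i\<in>UNIV. f (vec_of a b c d $ i)) = (\<Sum>j<5. f (idft z a b c d j))" for f :: "complex \<Rightarrow> complex"
    unfolding sum_lab sum5 by (simp add: vec_of_lab vec_of_lab[of 1, simplified])
  have "vec_of a b c d \<noteq> 0"
  proof
    assume "vec_of a b c d = 0"
    then have "Y k (vec_of a b c d) = 0" for k by (simp add: Y_def dft_def)
    then show False using assms(2) Y_vec_of[of a b c d] by (metis mult_eq_0_iff zero_neq_numeral)
  qed
  then show ?thesis
    using assms(1) unfolding on_bring_def bring_eq_def l[of "\<lambda>t. t"] l[of "\<lambda>t. t ^ 2"] l[of "\<lambda>t. t ^ 3"]
      idft_sum[OF z] idft_sum2[OF z] idft_sum3[OF z] by simp
qed

lemma W_scale: "c \<noteq> 0 \<Longrightarrow> W (c *s x) = W x"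
  by (simp add: W_def Y_scale wmap_scale)

lemma phi_line: "x \<noteq> 0 \<Longrightarrow> phi (line x) = W x"
  unfolding phi_def by (rule lift_line) (simp_all add: W_scale)

lemma phi_on_bring: "on_bring x \<Longrightarrow> phi (line x) = W x"
  by (rule phi_line) (simp add: on_bring_def)

lemma W_vec_of: "W (vec_of a b c d) = wmap a b c d"
  unfolding W_def Y_vec_of by (rule wmap_scale) simp

text \<open>Five pairs of forms are enough: the quartic pair away from the coordinate points, and
  the patch of degree 8 in four orders of the indices, one for each coordinate point.\<close>

lemma holo_map_phi: "holo_map bring CP1 phi"
  unfolding bring_def
proof (rule holo_map_hom_pairs[OF on_bring_nz])
  have patchI: "\<exists>d F0 F1. hom_pair d F0 F1 \<and> (F0 x \<noteq> 0 \<or> F1 x \<noteq> 0) \<and>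
      (\<forall>y\<in>{x. on_bring x}. F0 y \<noteq> 0 \<or> F1 y \<noteq> 0 \<longrightarrow> phi (line y) = hc (F0 y) (F1 y))"
    if "hom_pair d F0 F1" "F0 x \<noteq> 0 \<or> F1 x \<noteq> 0"
      "\<And>y. on_bring y \<Longrightarrow> F0 y \<noteq> 0 \<or> F1 y \<noteq> 0 \<Longrightarrow> phi (line y) = hc (F0 y) (F1 y)" for d F0 F1 x
    using that by (intro exI[of _ d] exI[of _ F0] exI[of _ F1]) simp
  let ?P = "\<lambda>x d F0 F1. hom_pair d F0 F1 \<and> (F0 x \<noteq> 0 \<or> F1 x \<noteq> 0) \<and>
      (\<forall>y\<in>{x. on_bring x}. F0 y \<noteq> 0 \<or> F1 y \<noteq> 0 \<longrightarrow> phi (line y) = hc (F0 y) (F1 y))"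
  \<comment> \<open>These orders bring the second or the third Fourier coordinate to the front,
    where the patch applies; the Moebius involution undoes the effect on \<open>w\<close>.\<close>
  have rot: "W y = moebius 0 (-4) 1 0 (wmap (Y 2 y) (Y 4 y) (Y 1 y) (Y 3 y))"
    "W y = moebius 0 (-4) 1 0 (wmap (Y 3 y) (Y 1 y) (Y 4 y) (Y 2 y))" if y: "on_bring y" for y
  proof -
    have e: "bring_eq (Y 2 y) (Y 4 y) (Y 1 y) (Y 3 y)" "bring_eq (Y 3 y) (Y 1 y) (Y 4 y) (Y 2 y)"
      using on_bring_Y(1)[OF y] bring_eq_rot[of "Y 2 y" "Y 4 y" "Y 1 y" "Y 3 y"]
        bring_eq_swap[of "Y 2 y" "Y 4 y" "Y 1 y" "Y 3 y"] bring_eq_rot[of "Y 1 y" "Y 2 y" "Y 3 y" "Y 4 y"]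
      by simp_all
    have n: "\<not> (Y 2 y = 0 \<and> Y 4 y = 0 \<and> Y 1 y = 0 \<and> Y 3 y = 0)" "\<not> (Y 3 y = 0 \<and> Y 1 y = 0 \<and> Y 4 y = 0 \<and> Y 2 y = 0)"
      using on_bring_Y(2)[OF y] by auto
    show "W y = moebius 0 (-4) 1 0 (wmap (Y 2 y) (Y 4 y) (Y 1 y) (Y 3 y))"
      using wmap_rot4[OF e(1) n(1)] unfolding W_def wmap_swap[of "Y 1 y"] by simp
    show "W y = moebius 0 (-4) 1 0 (wmap (Y 3 y) (Y 1 y) (Y 4 y) (Y 2 y))"
      using wmap_rot4[OF e(2) n(2)] unfolding W_def by simp
  qed
  fix x assume "x \<in> {x. on_bring x}"
  then have x: "on_bring x" by simp
  from on_bring_Y[OF x] show "\<exists>d F0 F1. ?P x d F0 F1"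
  proof (cases rule: bring_eq_cases)
    case (generic p Y')
    then have nz: "Y 1 x * Y 4 x \<noteq> 0" by (auto simp: bring_nf_def)
    have "phi (line y) = hc ((Y 1 y * Y 3 y + Y 2 y ^ 2) * (Y 4 y * Y 2 y + Y 3 y ^ 2)) ((Y 1 y * Y 4 y) ^ 2)"
      if y: "on_bring y" and n: "(Y 1 y * Y 3 y + Y 2 y ^ 2) * (Y 4 y * Y 2 y + Y 3 y ^ 2) \<noteq> 0 \<or> (Y 1 y * Y 4 y) ^ 2 \<noteq> 0" for y
    proof -
      \<comment> \<open>Otherwise the point is a coordinate point, and there both quartic forms
        vanish.\<close>
      have "Y 1 y * Y 4 y \<noteq> 0"
      proof
        assume "Y 1 y * Y 4 y = 0"
        from bring_eq_degenerate[OF on_bring_Y(1)[OF y] this] n show False by auto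
      qed
      then show ?thesis using phi_on_bring[OF y] by (simp add: W_def wmap_def)
    qed
    then show ?thesis
      using nz by (intro patchI[OF hom_pair_generic[OF linear_form_Y[of 1] linear_form_Y[of 2] linear_form_Y[of 3] linear_form_Y[of 4]]]) simp_all
  next
    case a
    have "phi (line y) = hc (patch_num (Y 1 y) (Y 2 y) (Y 3 y) (Y 4 y)) (patch_den (Y 1 y) (Y 2 y) (Y 3 y) (Y 4 y))"
      if y: "on_bring y" and n: "patch_num (Y 1 y) (Y 2 y) (Y 3 y) (Y 4 y) \<noteq> 0 \<or> patch_den (Y 1 y) (Y 2 y) (Y 3 y) (Y 4 y) \<noteq> 0" for y
      unfolding phi_on_bring[OF y] W_def by (rule wmap_patch[OF on_bring_Y(1)[OF y] n])
    then show ?thesis using a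
      by (intro patchI[OF hom_pair_patch(1)[OF linear_form_Y[of 1] linear_form_Y[of 2] linear_form_Y[of 3] linear_form_Y[of 4]]])
        (simp_all add: patch_den_def)
  next
    case d
    have "phi (line y) = hc (patch_num (Y 4 y) (Y 3 y) (Y 2 y) (Y 1 y)) (patch_den (Y 4 y) (Y 3 y) (Y 2 y) (Y 1 y))"
      if y: "on_bring y" and n: "patch_num (Y 4 y) (Y 3 y) (Y 2 y) (Y 1 y) \<noteq> 0 \<or> patch_den (Y 4 y) (Y 3 y) (Y 2 y) (Y 1 y) \<noteq> 0" for y
      using wmap_patch[OF bring_eq_swap[THEN iffD2, OF on_bring_Y(1)[OF y]] n]
      unfolding phi_on_bring[OF y] W_def wmap_swap[of "Y 1 y"] .
    then show ?thesis using d
      by (intro patchI[OF hom_pair_patch(1)[OF linear_form_Y[of 4] linear_form_Y[of 3] linear_form_Y[of 2] linear_form_Y[of 1]]])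
        (simp_all add: patch_den_def)
  next
    case b
    have "phi (line y) = hc (- 4 * patch_den (Y 2 y) (Y 4 y) (Y 1 y) (Y 3 y)) (patch_num (Y 2 y) (Y 4 y) (Y 1 y) (Y 3 y))"
      if y: "on_bring y" and n: "- 4 * patch_den (Y 2 y) (Y 4 y) (Y 1 y) (Y 3 y) \<noteq> 0 \<or> patch_num (Y 2 y) (Y 4 y) (Y 1 y) (Y 3 y) \<noteq> 0" for y
    proof -
      have n': "patch_num (Y 2 y) (Y 4 y) (Y 1 y) (Y 3 y) \<noteq> 0 \<or> patch_den (Y 2 y) (Y 4 y) (Y 1 y) (Y 3 y) \<noteq> 0" using n by auto
      have e: "bring_eq (Y 2 y) (Y 4 y) (Y 1 y) (Y 3 y)"
        using on_bring_Y(1)[OF y] by (simp only: bring_eq_rot)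
      show ?thesis unfolding phi_on_bring[OF y] rot(1)[OF y] wmap_patch[OF e n']
        by (subst moebius_hc[OF n']) simp
    qed
    then show ?thesis using b
      by (intro patchI[OF hom_pair_patch(2)[OF linear_form_Y[of 2] linear_form_Y[of 4] linear_form_Y[of 1] linear_form_Y[of 3]]])
        (simp_all add: patch_den_def)
  next
    case c
    have "phi (line y) = hc (- 4 * patch_den (Y 3 y) (Y 1 y) (Y 4 y) (Y 2 y)) (patch_num (Y 3 y) (Y 1 y) (Y 4 y) (Y 2 y))"
      if y: "on_bring y" and n: "- 4 * patch_den (Y 3 y) (Y 1 y) (Y 4 y) (Y 2 y) \<noteq> 0 \<or> patch_num (Y 3 y) (Y 1 y) (Y 4 y) (Y 2 y) \<noteq> 0" for y
    proof -
      have n': "patch_num (Y 3 y) (Y 1 y) (Y 4 y) (Y 2 y) \<noteq> 0 \<or> patch_den (Y 3 y) (Y 1 y) (Y 4 y) (Y 2 y) \<noteq> 0" using n by auto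
      have e: "bring_eq (Y 3 y) (Y 1 y) (Y 4 y) (Y 2 y)"
        using on_bring_Y(1)[OF y] bring_eq_rot[of "Y 1 y" "Y 2 y" "Y 3 y" "Y 4 y"]
          bring_eq_swap[of "Y 2 y" "Y 4 y" "Y 1 y" "Y 3 y"] bring_eq_rot[of "Y 2 y" "Y 4 y" "Y 1 y" "Y 3 y"] by simp
      show ?thesis unfolding phi_on_bring[OF y] rot(2)[OF y] wmap_patch[OF e n']
        by (subst moebius_hc[OF n']) simp
    qed
    then show ?thesis using c
      by (intro patchI[OF hom_pair_patch(2)[OF linear_form_Y[of 3] linear_form_Y[of 1] linear_form_Y[of 4] linear_form_Y[of 2]]])
        (simp_all add: patch_den_def)
  qed
qed

lemma phi_surj: "phi ` points bring = points CP1"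
proof (intro equalityI subsetI)
  fix P assume "P \<in> phi ` points bring"
  then show "P \<in> points CP1" using holo_map_in[OF holo_map_phi] by blast
next
  fix P assume "P \<in> points CP1"
  from wmap_surj[OF this] obtain a b c d where
    e: "bring_eq a b c d" "\<not> (a = 0 \<and> b = 0 \<and> c = 0 \<and> d = 0)" "wmap a b c d = P"
    by (elim exE conjE)
  have "phi (line (vec_of a b c d)) = P"
    using phi_on_bring[OF on_bring_vec_of[OF e(1,2)]] e(3) by (simp add: W_vec_of)
  then show "P \<in> phi ` points bring"
    using on_bring_vec_of[OF e(1,2)] by (auto simp: points_bring)
qed

lemma phi_section:
  assumes "w \<notin> {0, 2 * \<i>, - (2 * \<i>)}"
  shows "\<exists>N \<gamma>. open N \<and> w \<in> N \<and> (\<forall>t\<in>N. \<gamma> t \<in> {x. on_bring x} \<and> phi (line (\<gamma> t)) = fin t \<and>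
     (\<forall>i. (\<lambda>t. \<gamma> t $ i) field_differentiable (at t)))"
proof -
  have w: "w \<noteq> 0" "w \<noteq> 2 * \<i>" "w \<noteq> - (2 * \<i>)" using assms by auto
  show ?thesis
  proof (rule bring_nf_section[OF w])
    fix r p q assume r: "r > 0" and p: "p holomorphic_on ball w r" and q: "q holomorphic_on ball w r"
      and nf: "\<And>t. t \<in> ball w r \<Longrightarrow> bring_nf (p t) (q t) \<and> p t - 1 / p t = t"
    define \<gamma> where "\<gamma> t = vec_of (p t * q t ^ 3) (p t * q t ^ 2) (- q t) 1" for t
    show ?thesis
    proof (intro exI[of _ "ball w r"] exI[of _ \<gamma>] conjI ballI allI)
      show "open (ball w r)" "w \<in> ball w r" using r by simp_all
      fix t assume t: "t \<in> ball w r"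
      then have n: "bring_nf (p t) (q t)" and pt: "p t - 1 / p t = t" using nf by simp_all
      have g: "on_bring (\<gamma> t)" unfolding \<gamma>_def by (rule on_bring_vec_of[OF bring_nf_eq[OF n]]) simp
      then show "\<gamma> t \<in> {x. on_bring x}" by simp
      show "phi (line (\<gamma> t)) = fin t"
        using phi_on_bring[OF g] unfolding \<gamma>_def W_vec_of wmap_nf[OF n] pt .
      fix i
      have "(\<lambda>t. idft z (p t * q t ^ 3) (p t * q t ^ 2) (- q t) 1 j) holomorphic_on ball w r" for j
        unfolding idft_def by (intro holomorphic_intros p q)
      then have "(\<lambda>t. \<gamma> t $ i) holomorphic_on ball w r" unfolding \<gamma>_def vec_of_def by simp
      then show "(\<lambda>t. \<gamma> t $ i) field_differentiable (at t)"
        using t holomorphic_on_imp_differentiable_at open_ball by blast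
    qed
  qed
qed

lemma fifth_root_power:
  assumes "t^5 = 1"
  obtains j where "t = z ^ j"
proof -
  have "(t - 1) * (t - z) * (t - z^2) * (t - z^3) * (t - z^4) = t^5 - 1"
    using z by Groebner_Basis.algebra
  then have "t = 1 \<or> t = z \<or> t = z^2 \<or> t = z^3 \<or> t = z^4" using assms by auto
  then show thesis using that[of 0] that[of 1] that[of 2] that[of 3] that[of 4] by auto
qed

lemma on_bring_eqI:
  assumes x: "on_bring x" "on_bring x'" and k: "Y 1 x' = k * Y 1 x" "Y 2 x' = k * Y 2 x" "Y 3 x' = k * Y 3 x" "Y 4 x' = k * Y 4 x"
  shows "x' = k *s x"
proof (rule vec_eq_lab)
  fix j :: nat assume j: "j < 5"
  have "5 * x' $ lab j = 5 * (k * x $ lab j)"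
    using on_bring_idft[OF x(1) j] on_bring_idft[OF x(2) j] unfolding k by (simp add: idft_def algebra_simps)
  then show "x' $ lab j = (k *s x) $ lab j" by simp
qed

lemma on_bring_e4: "on_bring x \<Longrightarrow> coeff_a x = e4 (\<lambda>j. x $ lab j)"
proof -
  assume x: "on_bring x"
  have s: "(\<Sum>i\<in>UNIV. x $ i) = 0" "(\<Sum>i\<in>UNIV. (x $ i)^2) = 0" using x by (simp_all add: on_bring_def)
  have "- 4 * e4 (\<lambda>j. x $ lab j) = (\<Sum>i\<in>UNIV. (x $ i) ^ 4)"
    unfolding sum_lab by (rule e4_power_sum) (use s in \<open>simp_all only: sum_lab\<close>)
  moreover have "- 4 * e4 (\<lambda>j. x $ of_nat j) = (\<Sum>i\<in>UNIV. (x $ i) ^ 4)"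
    using e4_power_sum[of "\<lambda>j. x $ of_nat j"] s unfolding sum_5 by simp
  ultimately show ?thesis unfolding coeff_a_explicit by (metis mult_left_cancel neg_equal_0_iff_equal zero_neq_numeral)
qed

lemma on_bring_normal_form:
  assumes x: "on_bring x"
    and n: "Y 1 x = Y 4 x * (p * q^3)" "Y 2 x = Y 4 x * (p * q^2)" "Y 3 x = Y 4 x * - q" and j: "j < 5"
  shows "x $ lab j = Y 4 x / 5 * idft z (p * q^3) (p * q^2) (- q) 1 j"
proof -
  have "5 * x $ lab j = Y 4 x * idft z (p * q^3) (p * q^2) (- q) 1 j"
    unfolding on_bring_idft[OF x j] n by (simp add: idft_def algebra_simps)
  then show ?thesis by (simp add: field_simps)
qed

text \<open>A coordinate point has a single nonzero Fourier coefficient, and each monomial of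
  \<open>idft_e4\<close> involves at least two. Thus the formula defining \<open>beta_I4\<close>
  says nothing at these points.\<close>

lemma coeff_a_degenerate:
  assumes x: "on_bring x" and y: "Y 1 x * Y 4 x = 0"
  shows "coeff_a x = 0"
proof -
  have X: "5 * x $ lab j = idft z (Y 1 x) (Y 2 x) (Y 3 x) (Y 4 x) j" if "j < 5" for j
    by (rule on_bring_idft[OF x that])
  have X': "5 * x $ lab 0 = idft z (Y 1 x) (Y 2 x) (Y 3 x) (Y 4 x) 0" "5 * x $ lab 1 = idft z (Y 1 x) (Y 2 x) (Y 3 x) (Y 4 x) 1"
    "5 * x $ lab 2 = idft z (Y 1 x) (Y 2 x) (Y 3 x) (Y 4 x) 2" "5 * x $ lab 3 = idft z (Y 1 x) (Y 2 x) (Y 3 x) (Y 4 x) 3"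
    "5 * x $ lab 4 = idft z (Y 1 x) (Y 2 x) (Y 3 x) (Y 4 x) 4"
    by (rule X; simp)+
  have "5^4 * e4 (\<lambda>j. x $ lab j) = e4 (idft z (Y 1 x) (Y 2 x) (Y 3 x) (Y 4 x))"
    unfolding e4_def X'[symmetric] by Groebner_Basis.algebra
  also have "\<dots> = 0"
    unfolding idft_e4[OF z] using bring_eq_degenerate[OF on_bring_Y(1)[OF x] y] by (elim disjE) simp_all
  finally show ?thesis unfolding on_bring_e4[OF x] by simp
qed

text \<open>The scalar \<open>k\<close> between \<open>x\<close> and its normal form cancels because
  \<open>a^5\<close> and \<open>b^2 * (125 * b^2 + \<surd>5 * V)\<close> both have degree 20. The
  hypothesis \<open>V\<close> is where the sign of the labelling and the choice of \<open>z\<close>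
  meet.\<close>

lemma beta_formula:
  assumes x: "on_bring x" and a: "coeff_a x \<noteq> 0"
    and V: "(z + z^4 - z^2 - z^3) * vandermonde5 (\<lambda>j. x $ lab j) = of_real (sqrt 5) * vandermonde x"
  shows "D10_map (D10_coord (W x)) = fin (1 + 25 * (coeff_b x)^2 / (128 * (coeff_a x)^5)
                   * (125 * (coeff_b x)^2 + of_real (sqrt 5) * vandermonde x))"
  using on_bring_Y[OF x]
proof (cases rule: bring_eq_cases)
  case (generic p q)
  let ?X = "idft z (p * q^3) (p * q^2) (- q) 1"
  define s where "s = z + z^4 - z^2 - z^3"
  define k where "k = Y 4 x / 5"
  have k0: "k \<noteq> 0" using generic(5) by (simp add: k_def)
  have X: "x $ lab j = k * ?X j" if "j < 5" for j
    unfolding k_def by (rule on_bring_normal_form[OF x generic(2-4) that])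
  have X': "x $ lab 0 = k * ?X 0" "x $ lab 1 = k * ?X 1" "x $ lab 2 = k * ?X 2" "x $ lab 3 = k * ?X 3" "x $ lab 4 = k * ?X 4"
    by (simp_all only: X)
  define A where "A = s * vandermonde5 ?X"
  define B where "B = 125 * (\<Prod>j<5. ?X j)^2"
  define E where "E = e4 ?X"
  have "coeff_b x = - (k^5 * (\<Prod>j<5. ?X j))"
    unfolding coeff_b_def prod_lab X' prod5 by Groebner_Basis.algebra
  then have b: "125 * (coeff_b x)^2 = k^10 * B" "25 * (coeff_b x)^2 = k^10 * (B / 5)"
    by (simp_all add: B_def power_mult_distrib power_mult[symmetric])
  have v: "of_real (sqrt 5) * vandermonde x = k^10 * A"
    unfolding V[symmetric] A_def s_def vandermonde5_def X' by Groebner_Basis.algebra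
  have e: "coeff_a x = k^4 * E"
    unfolding on_bring_e4[OF x] E_def e4_def X' by Groebner_Basis.algebra
  have E0: "E \<noteq> 0" using a e by auto
  have disc: "A^2 - B^2 = 1280 * E^5"
    unfolding A_def B_def E_def s_def by (rule nf_discriminant[OF z generic(1)])
  have "(A - B) * (A + B) = 1280 * E^5" unfolding disc[symmetric] by Groebner_Basis.algebra
  then have AB: "A - B \<noteq> 0" "A + B \<noteq> 0" using E0 by auto
  have "25 * (coeff_b x)^2 / (128 * (coeff_a x)^5) * (125 * (coeff_b x)^2 + of_real (sqrt 5) * vandermonde x) =
      (k^10 * (B / 5)) / (128 * (k^4 * E)^5) * (k^10 * B + k^10 * A)"
    unfolding b v e ..
  also have "\<dots> = (k^20 * (B * (A + B))) / (k^20 * (640 * E^5))"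
    by (simp add: power_mult_distrib power_mult[symmetric] field_simps)
  also have "\<dots> = B * (A + B) / (640 * E^5)" using k0 by simp
  \<comment> \<open>The discriminant identity removes \<open>a\<close>: the common factor
    \<open>A + B\<close> cancels, and \<open>1 + 2 * B / (A - B)\<close> remains.\<close>
  also have "640 * E^5 = (A - B) * (A + B) / 2" using disc by (simp add: power2_eq_square algebra_simps)
  also have "B * (A + B) / ((A - B) * (A + B) / 2) = (2 * B * (A + B)) / ((A - B) * (A + B))" by simp
  also have "\<dots> = 2 * B / (A - B)" by (rule mult_divide_mult_cancel_right[OF AB(2)])
  finally have r: "1 + 25 * (coeff_b x)^2 / (128 * (coeff_a x)^5) * (125 * (coeff_b x)^2 + of_real (sqrt 5) * vandermonde x)
      = (A + B) / (A - B)" using AB by (simp add: field_simps)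
  define D where "D = (p^2 * (1 - p)^3)^2"
  have p: "p \<noteq> 0" "p \<noteq> 1" using generic(1) by (simp_all add: bring_nf_def)
  have D0: "D \<noteq> 0" using p by (simp add: D_def)
  have num: "(A + B) * D = 250 * (p^2 - 1) * (p^2 - 4 * p - 1)^5"
    unfolding A_def B_def D_def s_def by (rule nf_beta_num[OF z generic(1)])
  have den: "(A - B) * D = - 16000 * p * (p^2 + p - 1)^5"
    unfolding A_def B_def D_def s_def by (rule nf_beta_den[OF z generic(1)])
  define w where "w = p - 1 / p"
  have pw: "p * w = p^2 - 1" "p * (w - 4) = p^2 - 4 * p - 1" "p * (w + 1) = p^2 + p - 1"
    using p by (simp_all add: w_def field_simps power2_eq_square)
  have "D10_map (D10_coord (W x)) = hc (- w * (w - 4)^5) (64 * (w + 1)^5)"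
    unfolding W_def generic(6) w_def[symmetric] by (rule D10_map_coord)
  \<comment> \<open>The power \<open>p^6\<close> turns the factors \<open>w\<close>,
    \<open>w - 4\<close>, \<open>w + 1\<close> into the polynomials in \<open>p\<close> of
    \<open>nf_beta_num\<close> and \<open>nf_beta_den\<close>, and -250 matches their
    constants.\<close>
  also have "\<dots> = hc (- 250 * p^6 * (- w * (w - 4)^5)) (- 250 * p^6 * (64 * (w + 1)^5))"
    by (rule hc_scale[symmetric]) (use p in simp)
  also have "- 250 * p^6 * (- w * (w - 4)^5) = 250 * (p * w) * (p * (w - 4))^5" by Groebner_Basis.algebra
  also have "\<dots> = D * (A + B)" unfolding pw num[symmetric] by (rule mult.commute)
  also have "- 250 * p^6 * (64 * (w + 1)^5) = - 16000 * p * (p * (w + 1))^5" by Groebner_Basis.algebra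
  also have "\<dots> = D * (A - B)" unfolding pw den[symmetric] by (rule mult.commute)
  also have "hc (D * (A + B)) (D * (A - B)) = hc (A + B) (A - B)" by (rule hc_scale[OF D0])
  also have "\<dots> = fin ((A + B) / (A - B))" by (rule hc_fin[OF AB(1)])
  finally show ?thesis unfolding r .
qed (use coeff_a_degenerate[OF x] a in simp_all)

text \<open>Leaving out 0 and infinity avoids the coordinate points. At the remaining points
  \<open>nf_e4\<close> shows that \<open>a\<close> vanishes only through \<open>w - 4\<close> or
  \<open>w + 1\<close>.\<close>

lemma coeff_a_nonzero:
  assumes x: "on_bring x" and w: "W x \<notin> {fin 0, fin 4, fin (-1), infty}"
  shows "coeff_a x \<noteq> 0"
  using on_bring_Y[OF x]
proof (cases rule: bring_eq_cases)
  case (generic p q)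
  let ?X = "idft z (p * q^3) (p * q^2) (- q) 1"
  define k where "k = Y 4 x / 5"
  have k0: "k \<noteq> 0" using generic(5) by (simp add: k_def)
  have X: "x $ lab j = k * ?X j" if "j < 5" for j
    unfolding k_def by (rule on_bring_normal_form[OF x generic(2-4) that])
  have X': "x $ lab 0 = k * ?X 0" "x $ lab 1 = k * ?X 1" "x $ lab 2 = k * ?X 2" "x $ lab 3 = k * ?X 3" "x $ lab 4 = k * ?X 4"
    by (simp_all only: X)
  have e: "coeff_a x = k^4 * e4 ?X"
    unfolding on_bring_e4[OF x] e4_def X' by Groebner_Basis.algebra
  define w where "w = p - 1 / p"
  have p: "p \<noteq> 0" "q \<noteq> 0" using generic(1) by (simp_all add: bring_nf_def)
  have pw: "p * (w - 4) = p^2 - 4 * p - 1" "p * (w + 1) = p^2 + p - 1"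
    using p by (simp_all add: w_def field_simps power2_eq_square)
  have "W x = fin w" unfolding W_def generic(6) w_def ..
  then have "w \<noteq> 4" "w \<noteq> -1" using assms(2) by auto
  then have "5 * q * (p * (w - 4)) * (p * (w + 1)) \<noteq> 0" using p by (simp add: add_eq_0_iff2)
  then have "e4 ?X * (p * (1 - p)^2) \<noteq> 0"
    unfolding pw nf_e4[OF z generic(1)] .
  then show ?thesis using e k0 by simp
qed (use w in \<open>simp_all add: W_def\<close>)

end

section \<open>The quotient by a dihedral group\<close>

context bring_labelling
begin

lemma Y_actv_rotation:
  assumes r: "bij r" "\<forall>j<5. r (lab j) = lab ((j + 1) mod 5)"
  shows "Y 1 (actv r x) = z * Y 1 x" "Y 2 (actv r x) = z^2 * Y 2 x"
    "Y 3 (actv r x) = z^3 * Y 3 x" "Y 4 (actv r x) = z^4 * Y 4 x"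
proof -
  have a: "actv r x $ lab ((j + 1) mod 5) = x $ lab j" if "j < 5" for j
    using actv_nth[OF r(1), of x "lab j"] r(2) that by simp
  have "actv r x $ lab 1 = x $ lab 0" "actv r x $ lab 2 = x $ lab 1" "actv r x $ lab 3 = x $ lab 2"
    "actv r x $ lab 4 = x $ lab 3" "actv r x $ lab 0 = x $ lab 4"
    using a[of 0] a[of 1] a[of 2] a[of 3] a[of 4] by (simp_all add: numeral_2_eq_2[symmetric])
  note a = this
  show "Y 1 (actv r x) = z * Y 1 x" "Y 2 (actv r x) = z^2 * Y 2 x"
    "Y 3 (actv r x) = z^3 * Y 3 x" "Y 4 (actv r x) = z^4 * Y 4 x"
    unfolding Y_def dft_values[OF z] a using z by Groebner_Basis.algebra+
qed

lemma Y_actv_reflection: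
  assumes s: "bij s" "\<forall>j<5. s (lab j) = lab ((5 - j) mod 5)"
  shows "Y 1 (actv s x) = Y 4 x" "Y 2 (actv s x) = Y 3 x"
    "Y 3 (actv s x) = Y 2 x" "Y 4 (actv s x) = Y 1 x"
proof -
  have a: "actv s x $ lab ((5 - j) mod 5) = x $ lab j" if "j < 5" for j
    using actv_nth[OF s(1), of x "lab j"] s(2) that by simp
  have "actv s x $ lab 0 = x $ lab 0" "actv s x $ lab 1 = x $ lab 4" "actv s x $ lab 2 = x $ lab 3"
    "actv s x $ lab 3 = x $ lab 2" "actv s x $ lab 4 = x $ lab 1"
    using a[of 0] a[of 1] a[of 2] a[of 3] a[of 4] by simp_all
  note a = this
  show "Y 1 (actv s x) = Y 4 x" "Y 2 (actv s x) = Y 3 x" "Y 3 (actv s x) = Y 2 x" "Y 4 (actv s x) = Y 1 x"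
    unfolding Y_def dft_values[OF z] a by (simp_all only: add_ac)
qed

lemma W_actv_rotation:
  assumes r: "bij r" "\<forall>j<5. r (lab j) = lab ((j + 1) mod 5)"
  shows "W (actv r x) = W x"
proof -
  \<comment> \<open>\<open>wmap_rotate\<close> lists the powers in descending order, so the rotation
    by \<open>z\<close> is its instance at the inverse \<open>z^4\<close>.\<close>
  have t: "(z^4)^4 = z" "(z^4)^3 = z^2" "(z^4)^2 = z^3" "(z^4)^5 = 1"
    using z by Groebner_Basis.algebra+
  show ?thesis
    using wmap_rotate[OF t(4), of "Y 1 x" "Y 2 x" "Y 3 x" "Y 4 x"]
    unfolding W_def Y_actv_rotation[OF r] t .
qed

lemma W_actv_reflection:
  assumes s: "bij s" "\<forall>j<5. s (lab j) = lab ((5 - j) mod 5)"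
  shows "W (actv s x) = W x"
  unfolding W_def Y_actv_reflection[OF s] by (rule wmap_swap)

end

text \<open>What the argument uses of the group: closure, one rotation and one reflection to make it
  transitive on fibres of \<open>W\<close>, and invariance of \<open>W\<close>. The last is an
  assumption here and is established for a given group from its generators; \<open>sgn\<close>
  records the normalisation of \<open>z\<close>.\<close>

locale bring_D10 = bring_labelling +
  fixes G :: "(5 \<Rightarrow> 5) set" and r s :: "5 \<Rightarrow> 5"
  assumes bijG: "g \<in> G \<Longrightarrow> bij g"
    and idG: "id \<in> G" and compG: "g \<in> G \<Longrightarrow> h \<in> G \<Longrightarrow> g \<circ> h \<in> G"
    and invG: "g \<in> G \<Longrightarrow> \<exists>h\<in>G. h \<circ> g = id"
    and rG: "r \<in> G" and sG: "s \<in> G"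
    and r_lab: "\<forall>j<5. r (lab j) = lab ((j + 1) mod 5)"
    and s_lab: "\<forall>j<5. s (lab j) = lab ((5 - j) mod 5)"
    and WG: "g \<in> G \<Longrightarrow> W (actv g x) = W x"
    and sgn: "(z + z^4 - z^2 - z^3) * vandermonde5 (\<lambda>j. x $ lab j) = of_real (sqrt 5) * vandermonde x"
begin

lemma powers_of_rotation: "(r ^^ m) \<in> G"
proof (induction m)
  case 0
  show ?case unfolding funpow.simps(1) by (rule idG)
next
  case (Suc m)
  show ?case unfolding funpow.simps(2) by (rule compG[OF rG Suc])
qed

lemma Y_actv_rotation_power:
  "Y 1 (actv (r ^^ m) x) = z^m * Y 1 x" "Y 2 (actv (r ^^ m) x) = (z^m)^2 * Y 2 x"
  "Y 3 (actv (r ^^ m) x) = (z^m)^3 * Y 3 x" "Y 4 (actv (r ^^ m) x) = (z^m)^4 * Y 4 x"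
proof (induction m)
  case 0
  case 1 show ?case unfolding funpow.simps(1) actv_id by simp
  case 2 show ?case unfolding funpow.simps(1) actv_id by simp
  case 3 show ?case unfolding funpow.simps(1) actv_id by simp
  case 4 show ?case unfolding funpow.simps(1) actv_id by simp
next
  case (Suc m)
  have c: "actv (r ^^ Suc m) x = actv r (actv (r ^^ m) x)"
    using actv_compose[OF bijG[OF rG] bijG[OF powers_of_rotation[of m]]] by simp
  note rot = Y_actv_rotation[OF bijG[OF rG] r_lab]
  case 1 show ?case unfolding c rot(1) Suc(1) power_Suc by Groebner_Basis.algebra
  case 2 show ?case unfolding c rot(2) Suc(2) power_Suc by Groebner_Basis.algebra
  case 3 show ?case unfolding c rot(3) Suc(3) power_Suc by Groebner_Basis.algebra
  case 4 show ?case unfolding c rot(4) Suc(4) power_Suc by Groebner_Basis.algebra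
qed

lemma same_rotation_orbit:
  assumes x: "on_bring x" "on_bring x'" and k: "k \<noteq> 0" and t: "t^5 = 1"
    and e: "Y 1 x' = k * (t^4 * Y 1 x)" "Y 2 x' = k * (t^3 * Y 2 x)" "Y 3 x' = k * (t^2 * Y 3 x)" "Y 4 x' = k * (t * Y 4 x)"
  shows "\<exists>g\<in>G. line x' = line (actv g x)"
proof -
  obtain j where j: "t = z ^ j" by (rule fifth_root_power[OF t])
  \<comment> \<open>The rotation \<open>r ^^ m\<close> multiplies the first Fourier coordinate by
    \<open>z^m\<close>, which has to be \<open>t^4\<close>.\<close>
  define m where "m = j * 4"
  have "z^m = t^4" unfolding m_def power_mult j ..
  moreover have "(t^4)^2 = t^3" "(t^4)^3 = t^2" "(t^4)^4 = t" using t by Groebner_Basis.algebra+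
  ultimately have "Y 1 x' = k * Y 1 (actv (r ^^ m) x)" "Y 2 x' = k * Y 2 (actv (r ^^ m) x)"
    "Y 3 x' = k * Y 3 (actv (r ^^ m) x)" "Y 4 x' = k * Y 4 (actv (r ^^ m) x)"
    unfolding Y_actv_rotation_power e by simp_all
  then have "x' = k *s actv (r ^^ m) x"
    by (rule on_bring_eqI[OF on_bring_actv[OF bijG[OF powers_of_rotation] x(1)] x(2)])
  then have "line x' = line (actv (r ^^ m) x)" using line_scale[OF k] by simp
  then show ?thesis using powers_of_rotation by blast
qed

lemma W_fibre:
  assumes x: "on_bring x" "on_bring x'" and W: "W x = W x'"
  shows "\<exists>g\<in>G. line x' = line (actv g x)"
proof -
  obtain k t where k: "k \<noteq> 0" and t: "t^5 = 1" and e: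
    "(Y 1 x' = k * (t^4 * Y 1 x) \<and> Y 2 x' = k * (t^3 * Y 2 x) \<and> Y 3 x' = k * (t^2 * Y 3 x) \<and> Y 4 x' = k * (t * Y 4 x)) \<or>
     (Y 1 x' = k * (t^4 * Y 4 x) \<and> Y 2 x' = k * (t^3 * Y 3 x) \<and> Y 3 x' = k * (t^2 * Y 2 x) \<and> Y 4 x' = k * (t * Y 1 x))"
    using wmap_fibre[OF on_bring_Y[OF x(1)] on_bring_Y[OF x(2)] W[unfolded W_def]] by (elim exE conjE)
  from e show ?thesis
  proof (elim disjE conjE)
    assume "Y 1 x' = k * (t^4 * Y 1 x)" "Y 2 x' = k * (t^3 * Y 2 x)" "Y 3 x' = k * (t^2 * Y 3 x)" "Y 4 x' = k * (t * Y 4 x)"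
    then show ?thesis by (rule same_rotation_orbit[OF x k t])
  next
    assume e: "Y 1 x' = k * (t^4 * Y 4 x)" "Y 2 x' = k * (t^3 * Y 3 x)" "Y 3 x' = k * (t^2 * Y 2 x)" "Y 4 x' = k * (t * Y 1 x)"
    have "\<exists>g\<in>G. line x' = line (actv g (actv s x))"
      by (rule same_rotation_orbit[OF on_bring_actv[OF bijG[OF sG] x(1)] x(2) k t])
        (simp_all only: e Y_actv_reflection[OF bijG[OF sG] s_lab])
    then obtain g where g: "g \<in> G" "line x' = line (actv g (actv s x))" by blast
    then show ?thesis using actv_compose[OF bijG[OF g(1)] bijG[OF sG]] compG[OF g(1) sG] by metis
  qed
qed

lemma act_bring:
  assumes "g \<in> G" "P \<in> points bring"
  shows "act g P \<in> points bring" "phi (act g P) = phi P"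
proof -
  obtain x where x: "on_bring x" "P = line x" using assms(2) by (auto simp: points_bring)
  have a: "on_bring (actv g x)" by (rule on_bring_actv[OF bijG[OF assms(1)] x(1)])
  show "act g P \<in> points bring" unfolding x(2) act_line points_bring using a by blast
  show "phi (act g P) = phi P"
    unfolding x(2) act_line phi_on_bring[OF a] phi_on_bring[OF x(1)] by (rule WG[OF assms(1)])
qed

lemma act_act:
  assumes "g \<in> G" "h \<in> G" "P \<in> points bring"
  shows "act g (act h P) = act (g \<circ> h) P"
proof -
  obtain x where x: "on_bring x" "P = line x" using assms(3) by (auto simp: points_bring)
  show ?thesis unfolding x(2) act_line actv_compose[OF bijG[OF assms(1)] bijG[OF assms(2)]] ..
qed

lemma orbit_self: "P \<in> points bring \<Longrightarrow> P \<in> orbit_of G P"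
proof -
  assume "P \<in> points bring"
  then obtain x where "P = line x" by (auto simp: points_bring)
  then have "act id P = P" by (simp add: act_line actv_id)
  then show ?thesis unfolding orbit_of_def using idG by force
qed

lemma orbit_act:
  assumes g: "g \<in> G" and P: "P \<in> points bring"
  shows "orbit_of G (act g P) = orbit_of G P"
proof -
  obtain g' where g': "g' \<in> G" "g' \<circ> g = id" using invG[OF g] by blast
  have "act h (act g P) \<in> orbit_of G P" if "h \<in> G" for h
    unfolding act_act[OF that g P] orbit_of_def using compG[OF that g] by blast
  moreover have "act h P \<in> orbit_of G (act g P)" if "h \<in> G" for h
  proof -
    have "act (h \<circ> g') (act g P) = act h P"
      unfolding act_act[OF compG[OF that g'(1)] g P] comp_assoc g'(2) by simp
    then show ?thesis unfolding orbit_of_def using compG[OF that g'(1)] by force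
  qed
  ultimately show ?thesis unfolding orbit_of_def by blast
qed

lemma orbit_eq_iff:
  assumes P: "P \<in> points bring" "P' \<in> points bring"
  shows "phi P = phi P' \<longleftrightarrow> orbit_of G P = orbit_of G P'"
proof
  assume e: "phi P = phi P'"
  obtain x x' where x: "on_bring x" "P = line x" "on_bring x'" "P' = line x'"
    using P by (auto simp: points_bring)
  have "W x = W x'" using e unfolding x(2,4) phi_on_bring[OF x(1)] phi_on_bring[OF x(3)] .
  then obtain g where g: "g \<in> G" "line x' = line (actv g x)" using W_fibre[OF x(1,3)] by blast
  then have "P' = act g P" unfolding x(2,4) act_line by simp
  then show "orbit_of G P = orbit_of G P'" using orbit_act[OF g(1) P(1)] by simp
next
  assume "orbit_of G P = orbit_of G P'"
  then have "P' \<in> orbit_of G P" using orbit_self[OF P(2)] by simp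
  then obtain g where "g \<in> G" "P' = act g P" unfolding orbit_of_def by blast
  then show "phi P = phi P'" using act_bring(2)[of g P] P(1) by simp
qed

lemma quotient_iso:
  "\<exists>\<Psi>. biholomorphic (bring_quotient G) CP1 \<Psi> \<and> (\<forall>P\<in>points bring. \<Psi> (orbit_of G P) = phi P)"
  unfolding bring_quotient_def bring_def
proof (rule quotient_biholomorphic_CP1)
  show "0 \<notin> {x :: complex ^ 5. on_bring x}" by (rule on_bring_nz)
  show "compact_space (ctop (csubspace proj_space (line ` {x. on_bring x})))"
    using compact_space_bring unfolding bring_def .
  show "holo_map (csubspace proj_space (line ` {x. on_bring x})) CP1 phi"
    using holo_map_phi unfolding bring_def .
  show "phi ` points (csubspace proj_space (line ` {x. on_bring x})) = points CP1"
    using phi_surj unfolding bring_def .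
  show "phi P = phi P' \<longleftrightarrow> orbit_of G P = orbit_of G P'"
    if "P \<in> points (csubspace proj_space (line ` {x. on_bring x}))"
      "P' \<in> points (csubspace proj_space (line ` {x. on_bring x}))" for P P'
    using orbit_eq_iff that unfolding bring_def by blast
  show "finite {0, 2 * \<i>, - (2 * \<i>)}" by simp
  show "\<exists>N \<gamma>. open N \<and> w \<in> N \<and> (\<forall>t\<in>N. \<gamma> t \<in> {x. on_bring x} \<and> phi (line (\<gamma> t)) = fin t \<and>
     (\<forall>i. (\<lambda>t. \<gamma> t $ i) field_differentiable (at t)))" if "w \<notin> {0, 2 * \<i>, - (2 * \<i>)}" for w
    by (rule phi_section[OF that])
qed

text \<open>A quotient map by a group acting continuously is open, and \<open>phi\<close> is this
  map followed by a homeomorphism. It supplies the density needed for the uniqueness of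
  \<open>beta_I4\<close>.\<close>

lemma openin_phi_image:
  assumes U: "openin (ctop bring) U"
  shows "openin (ctop CP1) (phi ` U)"
proof -
  obtain \<Psi> where Psi: "biholomorphic (bring_quotient G) CP1 \<Psi>" "\<forall>P\<in>points bring. \<Psi> (orbit_of G P) = phi P"
    using quotient_iso by (elim exE conjE)
  obtain k where k: "holo_map (bring_quotient G) CP1 \<Psi>" "holo_map CP1 (bring_quotient G) k"
    "\<And>Q. Q \<in> points (bring_quotient G) \<Longrightarrow> k (\<Psi> Q) = Q" "\<And>P. P \<in> points CP1 \<Longrightarrow> \<Psi> (k P) = P"
    using Psi(1) by (elim biholomorphicE) simp
  have Us: "U \<subseteq> points bring" using openin_subset[OF U] .
  have kq: "k (phi P) = orbit_of G P" if "P \<in> points bring" for P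
    using k(3)[of "orbit_of G P"] Psi(2) that by (simp add: bring_quotient_def)
  \<comment> \<open>The saturation of \<open>U\<close> is the union of its translates, each of them
    open.\<close>
  have "{P \<in> points bring. orbit_of G P \<in> orbit_of G ` U} = (\<Union>g\<in>G. {P \<in> points bring. act g P \<in> U})"
  proof (intro equalityI subsetI)
    fix P assume P: "P \<in> {P \<in> points bring. orbit_of G P \<in> orbit_of G ` U}"
    then obtain P' where P': "P' \<in> U" "orbit_of G P = orbit_of G P'" by auto
    then have "P' \<in> orbit_of G P" using orbit_self Us by blast
    then show "P \<in> (\<Union>g\<in>G. {P \<in> points bring. act g P \<in> U})"
      using P P'(1) unfolding orbit_of_def by auto
  next
    fix P assume "P \<in> (\<Union>g\<in>G. {P \<in> points bring. act g P \<in> U})"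
    then obtain g where g: "g \<in> G" "P \<in> points bring" "act g P \<in> U" by blast
    then show "P \<in> {P \<in> points bring. orbit_of G P \<in> orbit_of G ` U}"
      using orbit_act[OF g(1,2)] by (metis (mono_tags, lifting) image_eqI mem_Collect_eq)
  qed
  moreover have "openin (ctop bring) (\<Union>g\<in>G. {P \<in> points bring. act g P \<in> U})"
    by (intro openin_Union) (auto intro: openin_bring_act[OF bijG U])
  ultimately have "openin (ctop (bring_quotient G)) (orbit_of G ` U)"
    unfolding bring_quotient_def openin_cquotient using Us by auto
  then have "openin (ctop CP1) {P \<in> points CP1. k P \<in> orbit_of G ` U}"
    by (rule holo_map_openin[OF k(2)])
  moreover have "{P \<in> points CP1. k P \<in> orbit_of G ` U} = phi ` U"
  proof (intro equalityI subsetI)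
    fix P assume P: "P \<in> {P \<in> points CP1. k P \<in> orbit_of G ` U}"
    then obtain P' where P': "P' \<in> U" "k P = orbit_of G P'" by auto
    then have "P = phi P'" using k(4)[of P] P Psi(2) Us by (metis (mono_tags, lifting) mem_Collect_eq subsetD)
    then show "P \<in> phi ` U" using P'(1) by blast
  next
    fix P assume "P \<in> phi ` U"
    then obtain P' where P': "P' \<in> U" "P = phi P'" by blast
    then show "P \<in> {P \<in> points CP1. k P \<in> orbit_of G ` U}"
      using kq[of P'] Us holo_map_in[OF holo_map_phi, of P'] by auto
  qed
  ultimately show ?thesis by simp
qed

section \<open>The Belyi function on the curve and on the quotient\<close>

lemma beta_I4_eq:
  assumes "P \<in> points bring"
  shows "beta_I4 P = D10_map (D10_coord (phi P))"
proof -
  let ?R = "{(line x, 1 + 25 * (coeff_b x)^2 / (128 * (coeff_a x)^5)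
                   * (125 * (coeff_b x)^2 + of_real (sqrt 5) * vandermonde x))
      | x. on_bring x \<and> coeff_a x \<noteq> 0}"
  let ?f = "restrict (\<lambda>P. D10_map (D10_coord (phi P))) (points bring)"
  have "beta_I4 = ?f"
    unfolding beta_I4_def
  proof (rule meromorphic_given_by_eqI)
    show "?f \<in> extensional (points bring)" by simp
    obtain k where c: "holo_map CP1 CP1 D10_coord" "holo_map CP1 CP1 k"
      using biholomorphic_D10_coord by (elim biholomorphicE) simp
    have "holo_map bring CP1 (D10_map \<circ> (D10_coord \<circ> phi))"
      by (rule holo_map_compose[OF local_hol_bring holo_map_compose[OF local_hol_bring holo_map_phi c(1)] holo_map_D10_map])
    then show "holo_map bring CP1 ?f"
      by (rule holo_map_cong[OF local_hol_bring]) simp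
    show "\<forall>(p, w) \<in> ?R. ?f p = fin w"
    proof clarify
      fix x assume x: "on_bring x" "coeff_a x \<noteq> 0"
      have "line x \<in> points bring" using x(1) by (auto simp: points_bring)
      then show "?f (line x) = fin (1 + 25 * (coeff_b x)^2 / (128 * (coeff_a x)^5)
                   * (125 * (coeff_b x)^2 + of_real (sqrt 5) * vandermonde x))"
        using beta_formula[OF x sgn] phi_on_bring[OF x(1)] by simp
    qed
    fix U assume U: "openin (ctop bring) U" "U \<noteq> {}"
    \<comment> \<open>The coefficient \<open>a\<close> can vanish only over four values of
      \<open>phi\<close>, and an infinite set is not contained in them.\<close>
    have "infinite (phi ` U)" using openin_CP1_infinite[OF openin_phi_image[OF U(1)]] U(2) by simp
    then have "\<not> phi ` U \<subseteq> {fin 0, fin 4, fin (-1), infty}"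
      using finite_subset[of "phi ` U" "{fin 0, fin 4, fin (-1), infty}"] by auto
    then obtain P where P: "P \<in> U" "phi P \<notin> {fin 0, fin 4, fin (-1), infty}" by blast
    then obtain x where x: "on_bring x" "P = line x" using openin_subset[OF U(1)] by (auto simp: points_bring)
    have "coeff_a x \<noteq> 0"
      by (rule coeff_a_nonzero[OF x(1)]) (use P(2) x phi_on_bring[OF x(1)] in simp)
    then have "P \<in> fst ` ?R" unfolding x(2) using x(1) by force
    then show "\<exists>p\<in>U. p \<in> fst ` ?R" using P(1) by blast
  qed
  then have "beta_I4 P = ?f P" by (rule fun_cong)
  also have "\<dots> = D10_map (D10_coord (phi P))" using assms by (rule restrict_apply')
  finally show ?thesis .
qed

lemma induced_beta_orbit:
  assumes P: "P \<in> points bring"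
  shows "induced_beta (orbit_of G P) = beta_I4 P"
proof -
  have "beta_I4 (act g P) = beta_I4 P" if "g \<in> G" for g
    unfolding beta_I4_eq[OF act_bring(1)[OF that P]] beta_I4_eq[OF P] act_bring(2)[OF that P] ..
  then have "beta_I4 ` orbit_of G P = {beta_I4 P}"
    unfolding orbit_of_def image_image using idG by auto
  then show ?thesis unfolding induced_beta_def by simp
qed

lemma quotient_dessin: "I4_quotient G = belyi_dessin (bring_quotient G) induced_beta"
proof -
  have "orbit_of G ` {P \<in> points bring. Pr (beta_I4 P)} =
      {Q \<in> points (bring_quotient G). Pr (induced_beta Q)}" for Pr
    unfolding bring_quotient_def points_cquotient using induced_beta_orbit by auto
  note e = this[of "\<lambda>b. \<exists>t::real. 0 \<le> t \<and> t \<le> 1 \<and> b = fin (of_real t)"] this[of "\<lambda>b. b = fin 0"] this[of "\<lambda>b. b = fin 1"]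
  show ?thesis
    unfolding I4_quotient_def image_dessin_def I4_def belyi_dessin_def dessin.simps e ..
qed

lemma quotient_belyi:
  "belyi_pair_of (I4_quotient G) (bring_quotient G) induced_beta \<and>
   belyi_pairs_isomorphic (bring_quotient G) induced_beta CP1 beta_D10"
proof -
  obtain \<Psi> where Psi: "biholomorphic (bring_quotient G) CP1 \<Psi>" "\<forall>P\<in>points bring. \<Psi> (orbit_of G P) = phi P"
    using quotient_iso by (elim exE conjE)
  have lQ: "local_hol (bring_quotient G)"
    unfolding bring_quotient_def by (intro local_hol_cquotient local_hol_bring)
  have iso: "biholomorphic (bring_quotient G) CP1 (D10_coord \<circ> \<Psi>)"
    by (rule biholomorphic_compose[OF lQ local_hol_CP1 Psi(1) biholomorphic_D10_coord])
  have b: "induced_beta Q = D10_map ((D10_coord \<circ> \<Psi>) Q)" if Q: "Q \<in> points (bring_quotient G)" for Q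
  proof -
    obtain P where P: "P \<in> points bring" "Q = orbit_of G P" using Q by (auto simp: bring_quotient_def)
    have "\<Psi> (orbit_of G P) = phi P" using Psi(2) P(1) by blast
    then show ?thesis unfolding P(2) induced_beta_orbit[OF P(1)] beta_I4_eq[OF P(1)] by simp
  qed
  have bp: "belyi_pair (bring_quotient G) induced_beta"
    by (rule belyi_pair_pullback[OF lQ iso holo_map_D10_map D10_map_nonconstant unramified_D10_map b])
  \<comment> \<open>\<open>beta_D10\<close> is known to equal \<open>D10_map\<close> on the points
    of \<open>CP1\<close> only, so its Belyi property is pulled back along the identity, written as
    a Moebius map.\<close>
  have "moebius 1 0 0 1 P = P" if "P \<in> points CP1" for P
    using that by (elim CP1_hcE) (simp add: moebius_hc)
  then have "belyi_pair CP1 beta_D10"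
    by (intro belyi_pair_pullback[OF local_hol_CP1 _ holo_map_D10_map D10_map_nonconstant unramified_D10_map,
          of "moebius 1 0 0 1"] biholomorphic_moebius) (simp_all add: beta_D10_eq)
  moreover have "beta_D10 ((D10_coord \<circ> \<Psi>) Q) = induced_beta Q" if Q: "Q \<in> points (bring_quotient G)" for Q
  proof -
    obtain k where "holo_map (bring_quotient G) CP1 (D10_coord \<circ> \<Psi>)"
      using iso by (elim biholomorphicE) simp
    from holo_map_in[OF this Q] show ?thesis unfolding b[OF Q] by (rule beta_D10_eq)
  qed
  ultimately show ?thesis
    unfolding belyi_pair_of_def belyi_pairs_isomorphic_def using bp iso quotient_dessin by blast
qed

end

section \<open>From a dihedral subgroup to a labelling and a root of unity\<close>

theorem proposition5p2:
  fixes G :: "(5 \<Rightarrow> 5) set"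
  assumes "subgroup G A5"
    and "dihedral (A5\<lparr>carrier := G\<rparr>) 5"
  shows "belyi_pair_of (I4_quotient G) (bring_quotient G) induced_beta \<and>
         belyi_pairs_isomorphic (bring_quotient G) induced_beta CP1 beta_D10"
proof -
  let ?H = "A5\<lparr>carrier := G\<rparr>"
  have H: "carrier ?H = G" "\<And>g h. g \<otimes>\<^bsub>?H\<^esub> h = g \<circ> h" "\<one>\<^bsub>?H\<^esub> = id"
    by (simp_all add: A5_def)
  have grp: "group ?H" using assms(2) by (simp add: dihedral_def)
  interpret H: group ?H by (rule grp)
  obtain r s where rs: "r \<in> G" "s \<in> G" and gen: "G = generate ?H {r, s}"
    and ord: "H.ord r = 5" "H.ord s = 2" and srs: "s \<circ> r \<circ> s = inv\<^bsub>?H\<^esub> r"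
    using assms(2) unfolding dihedral_def H by (elim conjE bexE)
  have bijG: "bij g" if "g \<in> G" for g
    using subgroup.subset[OF assms(1)] that by (auto simp: A5_def permutes_bij)
  have r5: "r \<circ> r \<circ> r \<circ> r \<circ> r = id"
  proof -
    have "r [^]\<^bsub>?H\<^esub> (5 :: nat) = \<one>\<^bsub>?H\<^esub>" using H.pow_ord_eq_1[of r] rs(1) ord(1) H(1) by simp
    moreover have "(5 :: nat) = Suc (Suc (Suc (Suc (Suc 0))))" by simp
    ultimately show ?thesis by (simp only: H.nat_pow_Suc H.nat_pow_0 H id_comp)
  qed
  have ss: "s \<circ> s = id"
  proof -
    have "s [^]\<^bsub>?H\<^esub> (2 :: nat) = \<one>\<^bsub>?H\<^esub>" using H.pow_ord_eq_1[of s] rs(2) ord(2) H(1) by simp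
    moreover have "(2 :: nat) = Suc (Suc 0)" by simp
    ultimately show ?thesis by (simp only: H.nat_pow_Suc H.nat_pow_0 H id_comp)
  qed
  have rid: "r \<noteq> id"
  proof
    assume "r = id"
    then have "H.ord r = 1" using H.ord_eq_1[of r] rs(1) unfolding H by simp
    then show False using ord(1) by simp
  qed
  have "s \<circ> r \<circ> s \<circ> r = id"
    using H.l_inv[of r] rs(1) unfolding srs H by simp
  then obtain lab :: "nat \<Rightarrow> 5" where lab: "bij_betw lab {..<5} UNIV"
    and rl: "\<And>j. j < 5 \<Longrightarrow> r (lab j) = lab ((j + 1) mod 5)"
    and sl: "\<And>j. j < 5 \<Longrightarrow> s (lab j) = lab ((5 - j) mod 5)"
    using dihedral_D10_labelling[OF r5 rid ss] by blast
  have rl': "\<forall>j<5. r (lab j) = lab ((j + 1) mod 5)" and sl': "\<forall>j<5. s (lab j) = lab ((5 - j) mod 5)"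
    using rl sl by blast+
  obtain \<epsilon> :: complex where eps: "\<epsilon> = 1 \<or> \<epsilon> = -1"
    and V: "\<And>x. vandermonde5 (\<lambda>j. x $ lab j) = \<epsilon> * vandermonde x"
    using vandermonde_labelling[OF lab] by blast
  \<comment> \<open>The root of unity is chosen after the labelling, with Gauss sum of the sign that
    the labelling produces.\<close>
  obtain z where z: "1 + z + z^2 + z^3 + z^4 = 0" "z + z^4 - z^2 - z^3 = \<epsilon> * of_real (sqrt 5)"
    using primitive_fifth_root[OF eps] by blast
  interpret L: bring_labelling lab z by unfold_locales (fact lab, fact z(1))
  have invH: "inv\<^bsub>?H\<^esub> g \<circ> g = id" "g \<circ> inv\<^bsub>?H\<^esub> g = id" "inv\<^bsub>?H\<^esub> g \<in> G" if "g \<in> G" for g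
    using H.l_inv[of g] H.r_inv[of g] H.inv_closed[of g] that unfolding H by simp_all
  \<comment> \<open>Invariance is checked on the two generators and propagated. Membership in
    \<open>G\<close> is carried along because \<open>actv_compose\<close> needs bijections.\<close>
  have "g \<in> G \<and> (\<forall>x. L.W (actv g x) = L.W x)" if "g \<in> generate ?H {r, s}" for g
    using that
  proof (induction rule: generate.induct)
    case one
    have "id \<in> G" using H.one_closed unfolding H .
    then show ?case unfolding H actv_id by blast
  next
    case (incl h)
    then show ?case
      using rs L.W_actv_rotation[OF bijG[OF rs(1)] rl'] L.W_actv_reflection[OF bijG[OF rs(2)] sl'] by auto
  next
    case (inv h)
    then have h: "h \<in> G" and W: "L.W (actv h x) = L.W x" for x
      using rs L.W_actv_rotation[OF bijG[OF rs(1)] rl'] L.W_actv_reflection[OF bijG[OF rs(2)] sl'] by auto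
    have "L.W (actv (inv\<^bsub>?H\<^esub> h) x) = L.W x" for x
      using W[of "actv (inv\<^bsub>?H\<^esub> h) x"]
      unfolding actv_compose[OF bijG[OF h] bijG[OF invH(3)[OF h]]] invH(2)[OF h] actv_id by simp
    then show ?case using invH(3)[OF h] by blast
  next
    case (eng g h)
    then have gh: "g \<in> G" "h \<in> G" by auto
    have "L.W (actv (g \<circ> h) x) = L.W x" for x
      unfolding actv_compose[OF bijG[OF gh(1)] bijG[OF gh(2)], symmetric] using eng.IH by simp
    then show ?case using H.m_closed gh unfolding H by blast
  qed
  then have WG: "L.W (actv g x) = L.W x" if "g \<in> G" for g x using that gen by blast
  interpret D: bring_D10 lab z G r s
  proof unfold_locales
    show "(z + z^4 - z^2 - z^3) * vandermonde5 (\<lambda>j. x $ lab j) = of_real (sqrt 5) * vandermonde x" for x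
      unfolding z(2) V using eps by auto
    show "g \<circ> h \<in> G" if "g \<in> G" "h \<in> G" for g h using H.m_closed that unfolding H by blast
    show "id \<in> G" using H.one_closed unfolding H .
    show "\<exists>h\<in>G. h \<circ> g = id" if "g \<in> G" for g using invH[OF that] by blast
  qed (use bijG rs rl' sl' WG in auto)
  show ?thesis by (rule D.quotient_belyi)
qed

end
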